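(* Let $\mathcal{V}$ be a van Emde Boas tree over the universe $\mathcal{U}=[0,U)$ and let $B\subseteq\mathcal{U}$ be a batch of $m$ keys given in sorted order. Inserting all keys of $B$ into $\mathcal{V}$ can be done in parallel in $O(m\log\log U)$ work and $O(\log U)$ span.
   Context: A van Emde Boas (vEB) tree $\mathcal{V}$ over $[0,2^w)$ is a quadruple $(\mathit{summary},\mathit{cluster}[\cdot],\mathit{min},\mathit{max})$: $\mathit{min},\mathit{max}$ store the minimum and maximum keys ($+\infty$, $-\infty$ when empty); each other key $x$ is split into high bits $\lfloor x/2^{\lceil w/2\rceil}\rfloor$ and low bits $x\bmod 2^{\lceil w/2\rceil}$; distinct high bits are stored recursively in the vEB tree $\mathit{summary}$ and the low bits of keys with high bits $h$ recursively in the vEB tree $\mathit{cluster}[h]$; $\mathit{min}$ and $\mathit{max}$ are not stored again in the summary or clusters. After insertion the tree must again satisfy this structure with key set $\mathcal{V}\cup B$. Model: binary-forking work-span model (work = total operations, span = longest chain of sequentially dependent operations). *)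

theory Defs
  imports Complex_Main "HOL-Library.Disjoint_Sets"
begin

section \<open>A word RAM with binary forking\<close>

text \<open>
  A program is a finite list of procedures over a shared memory of \<open>W\<close>-bit words.
  Each procedure activation has its own local variables, numbered by naturals; the
  arguments arrive in variables 0, 1, ..., and the result is left in variable 0.
  Parallelism comes only from \<open>Fork\<close>, which runs two procedure calls in parallel and
  joins them.
\<close>

type_synonym memory = "nat \<Rightarrow> nat"
type_synonym frame = "nat \<Rightarrow> nat"

datatype binop = Add | Sub | Mul | Div | Mod | Shl | Shr | Less | Equal

datatype expr =
    Const nat
  | Var nat
  | Load expr
  | Bin binop expr expr

datatype com =
    Skip
  | Assign nat expr
  | Store expr expr  \<comment> \<open>address, value\<close>
  | Seq com com
  | If expr com com
  | Call nat nat "expr list"  \<comment> \<open>result variable, procedure, arguments\<close>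
  | Fork nat nat "expr list" nat nat "expr list"

type_synonym program = "com list"

text \<open>\<open>Sub\<close> is truncated at 0; \<open>Shl\<close> and \<open>Shr\<close> shift by the second operand.\<close>

fun binop_val :: "binop \<Rightarrow> nat \<Rightarrow> nat \<Rightarrow> nat" where
  "binop_val Add x y = x + y"
| "binop_val Sub x y = x - y"
| "binop_val Mul x y = x * y"
| "binop_val Div x y = x div y"
| "binop_val Mod x y = x mod y"
| "binop_val Shl x y = x * 2 ^ y"
| "binop_val Shr x y = x div 2 ^ y"
| "binop_val Less x y = (if x < y then 1 else 0)"
| "binop_val Equal x y = (if x = y then 1 else 0)"

text \<open>Every value is reduced modulo \<open>2 ^ W\<close>, so no step produces more than one machine word.\<close>

fun eval :: "nat \<Rightarrow> frame \<Rightarrow> memory \<Rightarrow> expr \<Rightarrow> nat" where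
  "eval W f H (Const n) = n mod 2 ^ W"
| "eval W f H (Var x) = f x mod 2 ^ W"
| "eval W f H (Load e) = H (eval W f H e) mod 2 ^ W"
| "eval W f H (Bin b e1 e2) = binop_val b (eval W f H e1) (eval W f H e2) mod 2 ^ W"

fun reads :: "nat \<Rightarrow> frame \<Rightarrow> memory \<Rightarrow> expr \<Rightarrow> nat set" where
  "reads W f H (Const n) = {}"
| "reads W f H (Var x) = {}"
| "reads W f H (Load e) = insert (eval W f H e) (reads W f H e)"
| "reads W f H (Bin b e1 e2) = reads W f H e1 \<union> reads W f H e2"

fun cost :: "expr \<Rightarrow> nat" where
  "cost (Const n) = 1"
| "cost (Var x) = 1"
| "cost (Load e) = 1 + cost e"
| "cost (Bin b e1 e2) = 1 + cost e1 + cost e2"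

definition args :: "nat \<Rightarrow> frame \<Rightarrow> memory \<Rightarrow> expr list \<Rightarrow> nat list" where
  "args W f H es = map (eval W f H) es"

definition args_reads :: "nat \<Rightarrow> frame \<Rightarrow> memory \<Rightarrow> expr list \<Rightarrow> nat set" where
  "args_reads W f H es = (\<Union>e\<in>set es. reads W f H e)"

definition args_cost :: "expr list \<Rightarrow> nat" where
  "args_cost es = (\<Sum>e\<leftarrow>es. cost e)"

definition entry_frame :: "nat list \<Rightarrow> frame" where
  "entry_frame vs = (\<lambda>i. if i < length vs then vs ! i else 0)"

text \<open>
  \<open>exec W P c f H f' H' T D R X\<close>: started with local variables \<open>f\<close> and memory \<open>H\<close>, the
  command \<open>c\<close> terminates with \<open>f'\<close> and \<open>H'\<close>, using work \<open>T\<close> and span \<open>D\<close>; \<open>R\<close> and \<open>X\<close> are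
  the sets of addresses that it reads and writes.  There is no rule for a fork whose
  branches race (one branch writes a cell that the other reads or writes), so an execution
  is independent of scheduling; concurrent reads are allowed.
\<close>

inductive exec ::
  "nat \<Rightarrow> program \<Rightarrow> com \<Rightarrow> frame \<Rightarrow> memory \<Rightarrow> frame \<Rightarrow> memory \<Rightarrow>
   nat \<Rightarrow> nat \<Rightarrow> nat set \<Rightarrow> nat set \<Rightarrow> bool"
  for W :: nat and P :: program
where
  Skip: "exec W P Skip f H f H 1 1 {} {}"
| Assign: "exec W P (Assign x e) f H (f(x := eval W f H e)) H
     (1 + cost e) (1 + cost e) (reads W f H e) {}"
| Store: "exec W P (Store e1 e2) f H f (H(eval W f H e1 := eval W f H e2))
     (1 + cost e1 + cost e2) (1 + cost e1 + cost e2)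
     (reads W f H e1 \<union> reads W f H e2) {eval W f H e1}"
| Seq: "\<lbrakk>exec W P c1 f H f1 H1 T1 D1 R1 X1; exec W P c2 f1 H1 f2 H2 T2 D2 R2 X2\<rbrakk> \<Longrightarrow>
   exec W P (Seq c1 c2) f H f2 H2 (T1 + T2) (D1 + D2) (R1 \<union> R2) (X1 \<union> X2)"
| IfTrue: "\<lbrakk>eval W f H e \<noteq> 0; exec W P c1 f H f' H' T D R X\<rbrakk> \<Longrightarrow>
   exec W P (If e c1 c2) f H f' H' (1 + cost e + T) (1 + cost e + D) (reads W f H e \<union> R) X"
| IfFalse: "\<lbrakk>eval W f H e = 0; exec W P c2 f H f' H' T D R X\<rbrakk> \<Longrightarrow>
   exec W P (If e c1 c2) f H f' H' (1 + cost e + T) (1 + cost e + D) (reads W f H e \<union> R) X"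
| Call: "\<lbrakk>p < length P;
    exec W P (P ! p) (entry_frame (args W f H es)) H f' H' T D R X\<rbrakk> \<Longrightarrow>
   exec W P (Call x p es) f H (f(x := f' 0)) H'
     (1 + args_cost es + T) (1 + args_cost es + D) (args_reads W f H es \<union> R) X"
| Fork: "\<lbrakk>p < length P; q < length P;
    exec W P (P ! p) (entry_frame (args W f H es)) H f1 H1 T1 D1 R1 X1;
    exec W P (P ! q) (entry_frame (args W f H es')) H f2 H2 T2 D2 R2 X2;
    X1 \<inter> (R2 \<union> X2) = {}; X2 \<inter> (R1 \<union> X1) = {}\<rbrakk> \<Longrightarrow>
   exec W P (Fork x p es y q es') f H
     (f(x := f1 0, y := f2 0)) (\<lambda>i. if i \<in> X1 then H1 i else H2 i)
     (1 + args_cost es + args_cost es' + T1 + T2)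
     (1 + args_cost es + args_cost es' + max D1 D2)
     (args_reads W f H es \<union> args_reads W f H es' \<union> R1 \<union> R2) (X1 \<union> X2)"

lemma exec_unchanged: "exec W P c f H f' H' T D R X \<Longrightarrow> i \<notin> X \<Longrightarrow> H' i = H i"
  by (induction rule: exec.induct) auto

lemma exec_deterministic:
  "exec W P c f H f1 H1 T1 D1 R1 X1 \<Longrightarrow> exec W P c f H f2 H2 T2 D2 R2 X2 \<Longrightarrow>
   f1 = f2 \<and> H1 = H2 \<and> T1 = T2 \<and> D1 = D2 \<and> R1 = R2 \<and> X1 = X2"
proof (induction arbitrary: f2 H2 T2 D2 R2 X2 rule: exec.induct)
  case Skip
  from Skip show ?case by (cases rule: exec.cases) simp_all
next
  case Assign
  from Assign show ?case by (cases rule: exec.cases) simp_all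
next
  case Store
  from Store show ?case by (cases rule: exec.cases) simp_all
next
  case Seq
  note IH = Seq.IH
  from Seq.prems show ?case
    by (cases rule: exec.cases) (auto dest!: IH)
next
  case IfTrue
  note IH = IfTrue.IH and h = IfTrue.hyps
  from IfTrue.prems h show ?case
    by (cases rule: exec.cases) (auto dest!: IH)
next
  case IfFalse
  note IH = IfFalse.IH and h = IfFalse.hyps
  from IfFalse.prems h show ?case
    by (cases rule: exec.cases) (auto dest!: IH)
next
  case Call
  note IH = Call.IH
  from Call.prems show ?case
    by (cases rule: exec.cases) (auto dest!: IH)
next
  case Fork
  note IH = Fork.IH
  from Fork.prems show ?case
    by (cases rule: exec.cases) (clarsimp, drule IH(1), drule IH(2), clarsimp)
qed

text \<open>A program is started by calling procedure 0 with the arguments \<open>vs\<close>.\<close>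

definition runs ::
  "nat \<Rightarrow> program \<Rightarrow> nat list \<Rightarrow> memory \<Rightarrow> memory \<Rightarrow> nat \<Rightarrow> nat \<Rightarrow> bool" where
  "runs W P vs H H' T D \<longleftrightarrow>
     P \<noteq> [] \<and> (\<exists>f' R X. exec W P (P ! 0) (entry_frame vs) H f' H' T D R X)"

section \<open>Van Emde Boas trees in memory\<close>

definition high :: "nat \<Rightarrow> nat \<Rightarrow> nat" where
  "high w x = x div 2 ^ ((w + 1) div 2)"

definition low :: "nat \<Rightarrow> nat \<Rightarrow> nat" where
  "low w x = x mod 2 ^ ((w + 1) div 2)"

text \<open>
  The infinite values in the min and max fields of an empty tree are both encoded by
  \<open>2 ^ w\<close>, the first number outside the universe; the field determines the sign.
\<close>

definition min_word :: "nat \<Rightarrow> nat set \<Rightarrow> nat" where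
  "min_word w K = (if K = {} then 2 ^ w else Min K)"

definition max_word :: "nat \<Rightarrow> nat set \<Rightarrow> nat" where
  "max_word w K = (if K = {} then 2 ^ w else Max K)"

text \<open>
  \<open>veb_at H w a K F\<close>: the memory \<open>H\<close> holds at address \<open>a\<close> a van Emde Boas tree over
  \<open>[0, 2 ^ w)\<close> with key set \<open>K\<close>, occupying exactly the cells \<open>F\<close>.  A node is a quadruple
  of cells: min, max, the address of the summary, and the address of the array of
  cluster addresses.  If \<open>w \<le> 1\<close> the universe has at most two elements, so there are no
  keys besides min and max and the recursion stops.
\<close>

function veb_at :: "memory \<Rightarrow> nat \<Rightarrow> nat \<Rightarrow> nat set \<Rightarrow> nat set \<Rightarrow> bool" where
  "veb_at H w a K F \<longleftrightarrow>
     K \<subseteq> {..<2 ^ w} \<and> H a = min_word w K \<and> H (a + 1) = max_word w K \<and>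
     (if w \<le> 1 then F = {a, a + 1}
      else let summary = H (a + 2); clusters = H (a + 3); n = 2 ^ (w div 2);
               rest = K - {Min K, Max K}
        in \<exists>Fs Fc.
          veb_at H (w div 2) summary (high w ` rest) Fs \<and>
          (\<forall>h<n. veb_at H ((w + 1) div 2) (H (clusters + h))
                   (low w ` {x \<in> rest. high w x = h}) (Fc h)) \<and>
          F = {a..<a + 4} \<union> {clusters..<clusters + n} \<union> Fs \<union> (\<Union>h<n. Fc h) \<and>
          {a..<a + 4} \<inter> {clusters..<clusters + n} = {} \<and>
          ({a..<a + 4} \<union> {clusters..<clusters + n}) \<inter> Fs = {} \<and>
          (\<forall>h<n. ({a..<a + 4} \<union> {clusters..<clusters + n} \<union> Fs) \<inter> Fc h = {}) \<and>
          disjoint_family_on Fc {..<n})"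
  by pat_completeness auto
termination
  by (relation "Wellfounded.measure (\<lambda>(H, w, a, K, F). w)") auto

declare veb_at.simps [simp del]

definition sorted_array_at :: "memory \<Rightarrow> nat \<Rightarrow> nat set \<Rightarrow> bool" where
  "sorted_array_at H b B \<longleftrightarrow> (\<forall>i<card B. H (b + i) = sorted_list_of_set B ! i)"

end

theory Submission
  imports Defs
begin

text \<open>
  The cells of all nodes are preallocated, so an insertion only changes min and max fields.
  A batch is a sorted array segment; the keys of a node of width \<open>w\<close> are the cells of the
  segment modulo \<open>2 ^ w\<close>, so that a cluster receives a subsegment of the same array.  To insert
  a batch, first insert its smallest and its largest key one after the other with the classical
  sequential algorithm.  Every remaining key then lies strictly between min and max, so it never
  displaces them, and only has to be passed on: the keys with high bits \<open>h\<close> go to cluster \<open>h\<close>,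
  and those \<open>h\<close> whose cluster was empty go, as a new sorted array, to the summary; all these
  batches are inserted in parallel.  The new array is packed by a parallel prefix sum.

  Work: a sequential insertion costs \<open>O(log w)\<close>, but \<open>O(1)\<close> in a tree with at most one key.
  Hence inserting \<open>n \<ge> 1\<close> keys costs at most \<open>A n (lg w + 1)\<close>, and only
  \<open>A\<^sub>0 + A (n - 1) (lg w + 1)\<close> if the tree was empty; this saving in a new cluster pays for the
  insertion of its index into the summary.  Span: a level of width \<open>w\<close> contributes \<open>O(w)\<close>, since
  \<open>n \<le> 2 ^ w\<close>, and the widths are halved from level to level, so the sum is geometric.
\<close>

section \<open>Weakest preconditions\<close>

text \<open>The obstacle is \<open>exec\<close> itself: a fork whose branches race has no execution
  at all, so running in parallel is a proof obligation about addresses. Every specification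
  therefore bounds the sets of cells read and written, and every call owns a region disjoint from
  those of its siblings. Nor is there an allocator, so each possible recursive call has a scratch
  area reserved at a computable address, one per cluster plus one for the summary, whether or not
  the call happens. This costs space only: all passes run over the keys of the batch, never over the
  \<open>2 ^ (w div 2)\<close> clusters, and nothing is initialised, since every scratch cell that
  is read has been written before. The size \<open>S w = 2 ^ (4 * w)\<close> solves \<open>4 * 2 ^ w
  + (2 ^ (w div 2) + 1) * S ((w + 1) div 2) \<le> S w\<close> for \<open>w \<ge> 2\<close>.
  Correctness, work, span and footprint of \<open>batch\<close> are proved in one induction on the
  width, because the footprints are what allows the results of parallel calls to be
  combined.\<close>

definition wp ::
  "nat \<Rightarrow> program \<Rightarrow> com \<Rightarrow> frame \<Rightarrow> memory \<Rightarrow>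
   (frame \<Rightarrow> memory \<Rightarrow> nat \<Rightarrow> nat \<Rightarrow> nat set \<Rightarrow> nat set \<Rightarrow> bool) \<Rightarrow> bool" where
  "wp W P c f H Q \<longleftrightarrow>
     (\<exists>f' H' T D R X. exec W P c f H f' H' T D R X \<and> Q f' H' T D R X)"

lemma exec_span_le_work: "exec W P c f H f' H' T D R X \<Longrightarrow> D \<le> T"
  by (induction rule: exec.induct) auto

text \<open>Two facts true of every execution are handed to the continuation: unwritten cells keep
  their value, and the span is at most the work. So a specification only has to bound
  \<open>X\<close>, and one for sequential code only its work.\<close>

lemma wp_conseq:
  assumes "wp W P c f H Q"
    and "\<And>f' H' T D R X. Q f' H' T D R X \<Longrightarrow> (\<And>i. i \<notin> X \<Longrightarrow> H' i = H i) \<Longrightarrow> D \<le> T \<Longrightarrow>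
      Q' f' H' T D R X"
  shows "wp W P c f H Q'"
proof -
  from assms(1) obtain f' H' T D R X
    where e: "exec W P c f H f' H' T D R X" and Q: "Q f' H' T D R X"
    by (auto simp: wp_def)
  have "Q' f' H' T D R X"
    by (rule assms(2)[OF Q]) (use exec_unchanged[OF e] exec_span_le_work[OF e] in auto)
  with e show ?thesis unfolding wp_def by blast
qed

inductive_cases exec_SeqE: "exec W P (Seq c1 c2) f H f' H' T D R X"
inductive_cases exec_IfE: "exec W P (If e c1 c2) f H f' H' T D R X"

text \<open>Determinism leaves a single witness for the existential in \<open>wp\<close>. Hence the
  rules for skip, assignment and store are equations, and the simplifier can use them for symbolic
  execution.\<close>

lemma wp_Skip [simp]: "wp W P Skip f H Q \<longleftrightarrow> Q f H 1 1 {} {}"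
  unfolding wp_def using exec.Skip[of W P f H] exec_deterministic by blast

lemma wp_Assign [simp]:
  "wp W P (Assign x e) f H Q \<longleftrightarrow>
     Q (f(x := eval W f H e)) H (1 + cost e) (1 + cost e) (reads W f H e) {}"
  unfolding wp_def using exec.Assign[of W P x e f H] exec_deterministic by blast

lemma wp_Store [simp]:
  "wp W P (Store e1 e2) f H Q \<longleftrightarrow>
     Q f (H(eval W f H e1 := eval W f H e2)) (1 + cost e1 + cost e2) (1 + cost e1 + cost e2)
       (reads W f H e1 \<union> reads W f H e2) {eval W f H e1}"
  unfolding wp_def using exec.Store[of W P e1 e2 f H] exec_deterministic by blast

lemma wp_Seq [simp]:
  "wp W P (Seq c1 c2) f H Q \<longleftrightarrow>
     wp W P c1 f H (\<lambda>f1 H1 T1 D1 R1 X1. wp W P c2 f1 H1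
       (\<lambda>f2 H2 T2 D2 R2 X2. Q f2 H2 (T1 + T2) (D1 + D2) (R1 \<union> R2) (X1 \<union> X2)))"
  (is "?l \<longleftrightarrow> ?r")
proof
  assume ?l
  then obtain f' H' T D R X where "exec W P (Seq c1 c2) f H f' H' T D R X" and "Q f' H' T D R X"
    by (auto simp: wp_def)
  then show ?r
    by (elim exec_SeqE) (unfold wp_def, blast)
next
  assume ?r
  then show ?l
    unfolding wp_def by (elim exE conjE) (intro exI conjI, erule (1) exec.Seq, assumption)
qed

lemma wp_If [simp]:
  "wp W P (If e c1 c2) f H Q \<longleftrightarrow>
     wp W P (if eval W f H e \<noteq> 0 then c1 else c2) f H
       (\<lambda>f' H' T D R X. Q f' H' (1 + cost e + T) (1 + cost e + D) (reads W f H e \<union> R) X)"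
  (is "?l \<longleftrightarrow> ?r")
proof
  assume ?l
  then obtain f' H' T D R X where "exec W P (If e c1 c2) f H f' H' T D R X" and "Q f' H' T D R X"
    by (auto simp: wp_def)
  then show ?r
    by (elim exec_IfE) (simp_all add: wp_def, blast+)
next
  assume r: ?r
  show ?l
  proof (cases "eval W f H e = 0")
    case True
    with r show ?thesis
      unfolding wp_def
      by (simp, elim exE conjE) (intro exI conjI, erule (1) exec.IfFalse, simp)
  next
    case False
    with r show ?thesis
      unfolding wp_def
      by (simp, elim exE conjE) (intro exI conjI, erule exec.IfTrue[rotated], simp, simp)
  qed
qed

text \<open>Not an equation, since unfolding recursive bodies would not terminate. The callee enters
  through a specification \<open>Q'\<close> that was proved before or is an induction
  hypothesis.\<close>

lemma wp_Call:
  assumes "p < length P" and "args W f H es = vs"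
    and "wp W P (P ! p) (entry_frame vs) H Q'"
    and "\<And>f' H' T D R X. Q' f' H' T D R X \<Longrightarrow> (\<And>i. i \<notin> X \<Longrightarrow> H' i = H i) \<Longrightarrow> D \<le> T \<Longrightarrow>
      Q (f(x := f' 0)) H' (1 + args_cost es + T) (1 + args_cost es + D)
        (args_reads W f H es \<union> R) X"
  shows "wp W P (Call x p es) f H Q"
proof -
  from assms(3) obtain f' H' T D R X
    where e: "exec W P (P ! p) (entry_frame vs) H f' H' T D R X" and q: "Q' f' H' T D R X"
    by (auto simp: wp_def)
  from exec.Call[OF assms(1) e[folded assms(2)]]
  have "exec W P (Call x p es) f H (f(x := f' 0)) H' (1 + args_cost es + T) (1 + args_cost es + D)
     (args_reads W f H es \<union> R) X" .
  moreover have "Q (f(x := f' 0)) H' (1 + args_cost es + T) (1 + args_cost es + D)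
        (args_reads W f H es \<union> R) X"
    by (rule assms(4)[OF q]) (use exec_unchanged[OF e] exec_span_le_work[OF e] in auto)
  ultimately show ?thesis unfolding wp_def by blast
qed

text \<open>Race freedom has to follow from the two postconditions alone. The merged memory is
  described only by where it agrees with \<open>H1\<close>, \<open>H2\<close> and \<open>H\<close>;
  this is symmetric although the rule of \<open>exec\<close> prefers the first branch, because each
  branch leaves the cells of the other one unchanged.\<close>

lemma wp_Fork:
  assumes "p < length P" "q < length P"
    and "args W f H es = vs" "args W f H es' = vs'"
    and "wp W P (P ! p) (entry_frame vs) H Q1"
    and "wp W P (P ! q) (entry_frame vs') H Q2"
    and "\<And>f1 H1 T1 D1 R1 X1 f2 H2 T2 D2 R2 X2.
      Q1 f1 H1 T1 D1 R1 X1 \<Longrightarrow> Q2 f2 H2 T2 D2 R2 X2 \<Longrightarrow>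
      X1 \<inter> (R2 \<union> X2) = {} \<and> X2 \<inter> (R1 \<union> X1) = {}"
    and "\<And>f1 H1 T1 D1 R1 X1 f2 H2 T2 D2 R2 X2 H'.
      Q1 f1 H1 T1 D1 R1 X1 \<Longrightarrow> Q2 f2 H2 T2 D2 R2 X2 \<Longrightarrow>
      (\<And>i. i \<notin> X2 \<Longrightarrow> H' i = H1 i) \<Longrightarrow> (\<And>i. i \<notin> X1 \<Longrightarrow> H' i = H2 i) \<Longrightarrow>
      (\<And>i. i \<notin> X1 \<Longrightarrow> i \<notin> X2 \<Longrightarrow> H' i = H i) \<Longrightarrow>
      Q (f(x := f1 0, y := f2 0)) H'
       (1 + args_cost es + args_cost es' + T1 + T2)
       (1 + args_cost es + args_cost es' + max D1 D2)
       (args_reads W f H es \<union> args_reads W f H es' \<union> R1 \<union> R2) (X1 \<union> X2)"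
  shows "wp W P (Fork x p es y q es') f H Q"
proof -
  from assms(5) obtain f1 H1 T1 D1 R1 X1
    where e1: "exec W P (P ! p) (entry_frame vs) H f1 H1 T1 D1 R1 X1" and q1: "Q1 f1 H1 T1 D1 R1 X1"
    by (auto simp: wp_def)
  from assms(6) obtain f2 H2 T2 D2 R2 X2
    where e2: "exec W P (P ! q) (entry_frame vs') H f2 H2 T2 D2 R2 X2" and q2: "Q2 f2 H2 T2 D2 R2 X2"
    by (auto simp: wp_def)
  have d: "X1 \<inter> (R2 \<union> X2) = {}" "X2 \<inter> (R1 \<union> X1) = {}"
    using assms(7)[OF q1 q2] by auto
  let ?H = "\<lambda>i. if i \<in> X1 then H1 i else H2 i"
  note e = exec.Fork[OF assms(1,2) e1[folded assms(3)] e2[folded assms(4)] d, of x y]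
  have u: "H1 i = H i" if "i \<notin> X1" for i using exec_unchanged[OF e1 that] .
  have u2: "H2 i = H i" if "i \<notin> X2" for i using exec_unchanged[OF e2 that] .
  have "Q (f(x := f1 0, y := f2 0)) ?H
       (1 + args_cost es + args_cost es' + T1 + T2)
       (1 + args_cost es + args_cost es' + max D1 D2)
       (args_reads W f H es \<union> args_reads W f H es' \<union> R1 \<union> R2) (X1 \<union> X2)"
    by (rule assms(8)[OF q1 q2]) (auto simp: u u2)
  with e show ?thesis unfolding wp_def by blast
qed

section \<open>Van Emde Boas trees whose shape is fixed\<close>

definition inner :: "nat set \<Rightarrow> nat set" where
  "inner K = K - {Min K, Max K}"

text \<open>The part of \<open>veb_at\<close> that mentions neither memory nor keys once the address
  of the cluster array is given. Insertion never moves a node, so it passes unchanged from the old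
  tree to the new one.\<close>

definition veb_cells ::
  "nat \<Rightarrow> nat \<Rightarrow> nat \<Rightarrow> nat set \<Rightarrow> (nat \<Rightarrow> nat set) \<Rightarrow> nat set \<Rightarrow> bool" where
  "veb_cells a cl n Fs Fc F \<longleftrightarrow>
     F = {a..<a + 4} \<union> {cl..<cl + n} \<union> Fs \<union> (\<Union>h<n. Fc h) \<and>
     {a..<a + 4} \<inter> {cl..<cl + n} = {} \<and>
     ({a..<a + 4} \<union> {cl..<cl + n}) \<inter> Fs = {} \<and>
     (\<forall>h<n. ({a..<a + 4} \<union> {cl..<cl + n} \<union> Fs) \<inter> Fc h = {}) \<and>
     disjoint_family_on Fc {..<n}"

lemma veb_cellsD:
  assumes "veb_cells a cl n Fs Fc F"
  shows "i \<in> Fs \<Longrightarrow> i \<notin> {a..<a + 4} \<union> {cl..<cl + n}"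
    and "h < n \<Longrightarrow> i \<in> Fc h \<Longrightarrow> i \<notin> {a..<a + 4} \<union> {cl..<cl + n} \<union> Fs"
    and "i \<in> {cl..<cl + n} \<Longrightarrow> i \<notin> {a..<a + 4}"
    and "h < n \<Longrightarrow> h' < n \<Longrightarrow> h \<noteq> h' \<Longrightarrow> Fc h \<inter> Fc h' = {}"
    and "Fs \<subseteq> F" "h < n \<Longrightarrow> Fc h \<subseteq> F" "{a..<a + 4} \<subseteq> F" "{cl..<cl + n} \<subseteq> F"
    and "F = {a..<a + 4} \<union> {cl..<cl + n} \<union> Fs \<union> (\<Union>h<n. Fc h)"
  using assms unfolding veb_cells_def disjoint_family_on_def lessThan_iff by blast+

lemma veb_at_small:
  "w \<le> 1 \<Longrightarrow> veb_at H w a K F \<longleftrightarrow>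
     K \<subseteq> {..<2 ^ w} \<and> H a = min_word w K \<and> H (a + 1) = max_word w K \<and> F = {a, a + 1}"
  by (subst veb_at.simps) simp

lemma veb_at_split:
  "2 \<le> w \<Longrightarrow> veb_at H w a K F \<longleftrightarrow>
     K \<subseteq> {..<2 ^ w} \<and> H a = min_word w K \<and> H (a + 1) = max_word w K \<and>
     (\<exists>Fs Fc. veb_at H (w div 2) (H (a + 2)) (high w ` inner K) Fs \<and>
       (\<forall>h<2 ^ (w div 2). veb_at H ((w + 1) div 2) (H (H (a + 3) + h))
          (low w ` {x \<in> inner K. high w x = h}) (Fc h)) \<and>
       veb_cells a (H (a + 3)) (2 ^ (w div 2)) Fs Fc F)"
  unfolding inner_def veb_cells_def
  by (subst veb_at.simps, simp only: Let_def not_le[symmetric] if_False split: if_split, simp)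

lemma veb_at_keys:
  assumes "veb_at H w a K F"
  shows "K \<subseteq> {..<2 ^ w}" "finite K" "H a = min_word w K" "H (a + 1) = max_word w K"
    "a \<in> F" "a + 1 \<in> F"
proof -
  show *: "K \<subseteq> {..<2 ^ w}" "H a = min_word w K" "H (a + 1) = max_word w K"
    using assms by (simp_all add: veb_at.simps[of H w])
  show "finite K"
    using *(1) finite_subset by blast
  show "a \<in> F" "a + 1 \<in> F"
    using assms by (cases "w \<le> 1"; auto simp: veb_at_small veb_at_split veb_cells_def)+
qed

text \<open>The frame rule: every cell on which the predicate depends, pointers included, lies in
  \<open>F\<close>. It preserves each subtree that a call for a sibling leaves alone.\<close>

lemma veb_at_cong:
  assumes "veb_at H w a K F" and "\<And>i. i \<in> F \<Longrightarrow> H' i = H i"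
  shows "veb_at H' w a K F"
  using assms
proof (induction w arbitrary: a K F rule: less_induct)
  case (less w)
  show ?case
  proof (cases "w \<le> 1")
    case True
    with less.prems show ?thesis by (simp add: veb_at_small)
  next
    case False
    then have w: "2 \<le> w" by simp
    from less.prems(1) obtain Fs Fc where
      s: "veb_at H (w div 2) (H (a + 2)) (high w ` inner K) Fs" and
      c: "\<And>h. h < 2 ^ (w div 2) \<Longrightarrow> veb_at H ((w + 1) div 2) (H (H (a + 3) + h))
          (low w ` {x \<in> inner K. high w x = h}) (Fc h)" and
      F: "veb_cells a (H (a + 3)) (2 ^ (w div 2)) Fs Fc F"
      unfolding veb_at_split[OF w] by blast
    note eq = less.prems(2)
    have H': "H' a = H a" "H' (a + 1) = H (a + 1)" "H' (a + 2) = H (a + 2)" "H' (a + 3) = H (a + 3)"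
      by (rule eq; use F in \<open>simp add: veb_cells_def\<close>)+
    have C': "H' (H (a + 3) + h) = H (H (a + 3) + h)" if "h < 2 ^ (w div 2)" for h
      by (rule eq) (use F that in \<open>simp add: veb_cells_def\<close>)
    have s': "veb_at H' (w div 2) (H (a + 2)) (high w ` inner K) Fs"
      by (rule less.IH[OF _ s]) (use w F eq in \<open>auto simp: veb_cells_def\<close>)
    have c': "veb_at H' ((w + 1) div 2) (H (H (a + 3) + h))
          (low w ` {x \<in> inner K. high w x = h}) (Fc h)" if "h < 2 ^ (w div 2)" for h
      by (rule less.IH[OF _ c[OF that]]) (use w F eq that in \<open>auto simp: veb_cells_def\<close>)
    show ?thesis
      unfolding veb_at_split[OF w] H'
      using veb_at_keys[OF less.prems(1)] s' c' F C' by auto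
  qed
qed

text \<open>Reassembles a node after its parts have been updated independently. The pointers are
  taken from the old memory \<open>H\<close>, where the calls evaluated them; \<open>eq\<close>
  carries them over to \<open>H'\<close>.\<close>

lemma veb_at_join:
  assumes w: "2 \<le> w"
    and s: "veb_at H' (w div 2) (H (a + 2)) (high w ` inner K) Fs"
    and c: "\<And>h. h < 2 ^ (w div 2) \<Longrightarrow> veb_at H' ((w + 1) div 2) (H (H (a + 3) + h))
          (low w ` {x \<in> inner K. high w x = h}) (Fc h)"
    and F: "veb_cells a (H (a + 3)) (2 ^ (w div 2)) Fs Fc F"
    and K: "K \<subseteq> {..<2 ^ w}" "H' a = min_word w K" "H' (a + 1) = max_word w K"
    and eq: "\<And>i. i \<in> {a + 2..<a + 4} \<union> {H (a + 3)..<H (a + 3) + 2 ^ (w div 2)} \<Longrightarrow> H' i = H i"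
  shows "veb_at H' w a K F"
proof -
  have "H' (a + 2) = H (a + 2)" "H' (a + 3) = H (a + 3)"
    by (auto intro!: eq)
  moreover have "H' (H (a + 3) + h) = H (H (a + 3) + h)" if "h < 2 ^ (w div 2)" for h
    by (rule eq) (use that in simp)
  ultimately show ?thesis
    unfolding veb_at_split[OF w] using s c F K by auto
qed

text \<open>For insertion into a tree with at most one key: no key is inner before or after, so only
  two cells change.\<close>

lemma veb_at_set_min_max:
  assumes v: "veb_at H w a K F" and "inner K' = inner K"
    and K: "K' \<subseteq> {..<2 ^ w}" "H' a = min_word w K'" "H' (a + 1) = max_word w K'"
    and eq: "\<And>i. i \<noteq> a \<Longrightarrow> i \<noteq> a + 1 \<Longrightarrow> H' i = H i"
  shows "veb_at H' w a K' F"
proof (cases "w \<le> 1")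
  case True
  with v K show ?thesis by (simp add: veb_at_small)
next
  case False
  then have w: "2 \<le> w" by simp
  from v obtain Fs Fc where
      s: "veb_at H (w div 2) (H (a + 2)) (high w ` inner K) Fs" and
      c: "\<And>h. h < 2 ^ (w div 2) \<Longrightarrow> veb_at H ((w + 1) div 2) (H (H (a + 3) + h))
          (low w ` {x \<in> inner K. high w x = h}) (Fc h)" and
      F: "veb_cells a (H (a + 3)) (2 ^ (w div 2)) Fs Fc F"
      unfolding veb_at_split[OF w] by blast
  show ?thesis
  proof (rule veb_at_join[where H = H and Fs = Fs and Fc = Fc, OF w _ _ F K])
    show "veb_at H' (w div 2) (H (a + 2)) (high w ` inner K') Fs"
      unfolding assms(2)
    proof (rule veb_at_cong[OF s], rule eq)
      show "i \<noteq> a" "i \<noteq> a + 1" if "i \<in> Fs" for i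
        using veb_cellsD(1)[OF F that] by auto
    qed
    show "veb_at H' ((w + 1) div 2) (H (H (a + 3) + h))
          (low w ` {x \<in> inner K'. high w x = h}) (Fc h)" if h: "h < 2 ^ (w div 2)" for h
      unfolding assms(2)
    proof (rule veb_at_cong[OF c[OF h]], rule eq)
      show "i \<noteq> a" "i \<noteq> a + 1" if "i \<in> Fc h" for i
        using veb_cellsD(2)[OF F h that] by auto
    qed
    show "H' i = H i" if "i \<in> {a + 2..<a + 4} \<union> {H (a + 3)..<H (a + 3) + 2 ^ (w div 2)}" for i
      by (rule eq) (use veb_cellsD(3)[OF F, of i] that in auto)
  qed
qed

text \<open>The depth of the recursion: the ceiling of the binary logarithm.\<close>

function lg :: "nat \<Rightarrow> nat" where
  "lg w = (if w \<le> 1 then 0 else Suc (lg ((w + 1) div 2)))"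
  by auto
termination by (relation "Wellfounded.measure id") auto

declare lg.simps [simp del]

lemma lg_ge2: "2 \<le> w \<Longrightarrow> lg w = Suc (lg ((w + 1) div 2))"
  by (simp add: lg.simps[of w])

lemma lg_mono: "v \<le> w \<Longrightarrow> lg v \<le> lg w"
proof (induction w arbitrary: v rule: less_induct)
  case (less w)
  show ?case
  proof (cases "v \<le> 1")
    case True
    then show ?thesis by (simp add: lg.simps[of v])
  next
    case False
    with less.prems have "lg ((v + 1) div 2) \<le> lg ((w + 1) div 2)"
      by (intro less.IH) (auto intro: div_le_mono)
    with False less.prems show ?thesis by (simp add: lg_ge2)
  qed
qed

lemma lg_le: "lg w \<le> w"
proof (induction w rule: less_induct)
  case (less w)
  show ?case
  proof (cases "w \<le> 1")
    case False
    then have "(w + 1) div 2 < w" by auto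
    with less.IH[of "(w + 1) div 2"] False show ?thesis by (simp add: lg_ge2)
  qed (simp add: lg.simps[of w])
qed

text \<open>The \<open>- 2\<close> makes the induction work. Halving rounds up, and
  \<open>2 * (2 * ((w + 1) div 2) - 2) \<le> 2 * (w + 1 - 2)\<close> returns to the same form, which
  a bound \<open>2 * w\<close> would not.\<close>

lemma two_power_lg: "2 \<le> w \<Longrightarrow> 2 ^ lg w \<le> 2 * w - 2"
proof (induction w rule: less_induct)
  case (less w)
  show ?case
  proof (cases "w = 2")
    case False
    with less.prems have "3 \<le> w" by simp
    then have "2 ^ lg ((w + 1) div 2) \<le> 2 * ((w + 1) div 2) - 2"
      by (intro less.IH) auto
    moreover have "2 * ((w + 1) div 2) \<le> w + 1" by (rule times_div_less_eq_dividend)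
    ultimately show ?thesis using \<open>3 \<le> w\<close> by (subst lg_ge2) (auto simp del: times_div_less_eq_dividend)
  qed (simp add: lg.simps[of 2] lg.simps[of "Suc 0"])
qed

section \<open>The program\<close>

abbreviation add_e (infixl "[+]" 65) where "x [+] y \<equiv> Bin Add x y"
abbreviation sub_e (infixl "[-]" 65) where "x [-] y \<equiv> Bin Sub x y"
abbreviation mod_e (infixl "[%]" 70) where "x [%] y \<equiv> Bin Mod x y"
abbreviation shl_e (infixl "[<<]" 70) where "x [<<] y \<equiv> Bin Shl x y"
abbreviation shr_e (infixl "[>>]" 70) where "x [>>] y \<equiv> Bin Shr x y"
abbreviation less_e (infix "[<]" 60) where "x [<] y \<equiv> Bin Less x y"
abbreviation equal_e (infix "[=]" 60) where "x [=] y \<equiv> Bin Equal x y"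
abbreviation seq_c (infixr ";;" 55) where "c ;; d \<equiv> Seq c d"

text \<open>
  Variable 0 of every procedure holds the width \<open>w\<close>.  Procedures 2 to 4 (count, pack, loop) work on
  the indices \<open>i, ..., i + n - 1\<close> of a segment; variables 1 to 5 hold the array of cluster addresses,
  the segment, the scratch area, \<open>i\<close> and \<open>n\<close>, and variable 6 is the output address of pack and the
  length of the segment in loop.

  A scratch area at \<open>q\<close> has \<open>2 ^ (4 * w)\<close> cells.  From \<open>q\<close> on there are the counts of the prefix sum,
  from \<open>q + 2 ^ w\<close> the packed batch for the summary, from \<open>q + 2 * 2 ^ w\<close> the index of the first key
  of each group, addressed by the high bits of the group, and from \<open>q + 4 * 2 ^ w\<close> the scratch
  areas of the recursive calls: number 0 for the summary and number \<open>h + 1\<close> for cluster \<open>h\<close>.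
\<close>

definition half_e :: expr where
  "half_e = (Var 0 [+] Const 1) [>>] Const 1"

definition high_e :: "expr \<Rightarrow> expr" where
  "high_e i = (Load (Var 2 [+] i) [%] (Const 1 [<<] Var 0)) [>>] half_e"

text \<open>Truth values are numbers: a sum is a disjunction, and subtraction from 1 a negation.
  Both operands are always evaluated; at index 0 truncated subtraction compares key 0 with itself,
  so no cell in front of the segment is read.\<close>

definition start_e :: expr where
  "start_e = (Var 4 [=] Const 0) [+] (Const 1 [-] (high_e (Var 4) [=] high_e (Var 4 [-] Const 1)))"

text \<open>
  At the last index \<open>end_e\<close> reads the cell behind the segment.  This is no race: the cell holds
  the largest key of the batch, which has been inserted before.
\<close>

definition end_e :: expr where
  "end_e = (Var 4 [+] Const 1 [=] Var 6) [+]
     (Const 1 [-] (high_e (Var 4) [=] high_e (Var 4 [+] Const 1)))"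

definition empty_e :: "expr \<Rightarrow> expr" where
  "empty_e h = (Load (Load (Var 1 [+] h)) [=] (Const 1 [<<] half_e))"

definition slot_e :: "expr \<Rightarrow> expr" where
  "slot_e h = Var 3 [+] (Const 2 [<<] Var 0) [+] h"

definition scratch_e :: "expr \<Rightarrow> expr" where
  "scratch_e j = Var 3 [+] (Const 4 [<<] Var 0) [+] (j [<<] (half_e [<<] Const 2))"

definition descend :: com where
  "descend =
    (Assign 7 half_e ;;
     Assign 5 (Var 2 [>>] Var 7) ;;
     Assign 6 (Load (Load (Var 1 [+] Const 3) [+] Var 5)) ;;
     Assign 2 (Var 2 [%] (Const 1 [<<] Var 7)) ;;
     If (Load (Var 6) [=] (Const 1 [<<] Var 7))
       (Call 8 1 [Var 0 [>>] Const 1, Load (Var 1 [+] Const 2), Var 5])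
       Skip ;;
     Call 8 1 [Var 7, Var 6, Var 2])"

definition ins :: com where
  "ins =
    (Assign 3 (Load (Var 1)) ;; Assign 4 (Load (Var 1 [+] Const 1)) ;;
     If (Var 3 [=] (Const 1 [<<] Var 0))
       (Store (Var 1) (Var 2) ;; Store (Var 1 [+] Const 1) (Var 2))
     (If ((Var 2 [=] Var 3) [+] (Var 2 [=] Var 4)) Skip
     (If (Var 3 [=] Var 4)
       (If (Var 2 [<] Var 3) (Store (Var 1) (Var 2)) (Store (Var 1 [+] Const 1) (Var 2)))
       (If (Var 2 [<] Var 3) (Store (Var 1) (Var 2) ;; Assign 2 (Var 3))
         (If (Var 4 [<] Var 2) (Store (Var 1 [+] Const 1) (Var 2) ;; Assign 2 (Var 4)) Skip) ;;
        descend))))"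

definition count :: com where
  "count =
    If (Var 5 [=] Const 1)
      (Assign 6 (high_e (Var 4)) ;;
       If start_e (Store (slot_e (Var 6)) (Var 4) ;; Assign 0 (empty_e (Var 6))) (Assign 0 (Const 0)))
      (Assign 6 (Var 5 [>>] Const 1) ;;
       Fork 7 2 [Var 0, Var 1, Var 2, Var 3, Var 4, Var 6]
            8 2 [Var 0, Var 1, Var 2, Var 3, Var 4 [+] Var 6, Var 5 [-] Var 6] ;;
       Store (Var 3 [+] (Var 4 [+] Var 6)) (Var 7) ;;
       Assign 0 (Var 7 [+] Var 8))"

text \<open>The count stored at the split index says how many cells the left half will fill, so the
  right half knows its final output address without waiting.\<close>

definition pack :: com where
  "pack =
    If (Var 5 [=] Const 1)
      (Assign 7 (high_e (Var 4)) ;;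
       If start_e (If (empty_e (Var 7)) (Store (Var 6) (Var 7)) Skip) Skip)
      (Assign 7 (Var 5 [>>] Const 1) ;;
       Fork 8 3 [Var 0, Var 1, Var 2, Var 3, Var 4, Var 7, Var 6]
            8 3 [Var 0, Var 1, Var 2, Var 3, Var 4 [+] Var 7, Var 5 [-] Var 7,
                 Var 6 [+] Load (Var 3 [+] (Var 4 [+] Var 7))])"

text \<open>A group is handled at its last index, where both ends are known: the first index was
  left in the slot of the group during counting.\<close>

definition loop :: com where
  "loop =
    If (Var 5 [=] Const 1)
      (Assign 7 (high_e (Var 4)) ;;
       If end_e
        (Assign 8 (Load (slot_e (Var 7))) ;;
         Call 9 0 [half_e, Load (Var 1 [+] Var 7), Var 2 [+] Var 8, Var 4 [+] Const 1 [-] Var 8,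
                   scratch_e (Var 7 [+] Const 1)])
        Skip)
      (Assign 7 (Var 5 [>>] Const 1) ;;
       Fork 8 4 [Var 0, Var 1, Var 2, Var 3, Var 4, Var 7, Var 6]
            8 4 [Var 0, Var 1, Var 2, Var 3, Var 4 [+] Var 7, Var 5 [-] Var 7, Var 6])"

definition distribute :: com where
  "distribute =
    (Assign 2 (Var 2 [+] Const 1) ;; Assign 3 (Var 3 [-] Const 2) ;;
     Assign 5 (Load (Var 1 [+] Const 3)) ;;
     Call 6 2 [Var 0, Var 5, Var 2, Var 4, Const 0, Var 3] ;;
     Call 7 3 [Var 0, Var 5, Var 2, Var 4, Const 0, Var 3, Var 4 [+] (Const 1 [<<] Var 0)] ;;
     Fork 7 0 [Var 0 [>>] Const 1, Load (Var 1 [+] Const 2), Var 4 [+] (Const 1 [<<] Var 0),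
               Var 6, Var 4 [+] (Const 4 [<<] Var 0)]
          7 4 [Var 0, Var 5, Var 2, Var 4, Const 0, Var 3, Var 3])"

text \<open>For a single key both calls insert the same key, so this case needs no branch of its
  own.\<close>

definition batch :: com where
  "batch =
    If (Var 3)
     (Call 6 1 [Var 0, Var 1, Load (Var 2) [%] (Const 1 [<<] Var 0)] ;;
      Call 6 1 [Var 0, Var 1, Load (Var 2 [+] (Var 3 [-] Const 1)) [%] (Const 1 [<<] Var 0)] ;;
      If (Const 2 [<] Var 3) distribute Skip)
     Skip"

definition prog :: program where
  "prog = [batch, ins, count, pack, loop]"

lemma prog_simps [simp]:
  "length prog = 5" "prog ! 0 = batch" "prog ! Suc 0 = ins" "prog ! 2 = count" "prog ! 3 = pack"
  "prog ! 4 = loop"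
  by (simp_all add: prog_def)

section \<open>Sequential insertion\<close>

text \<open>There is no span clause: the procedure is sequential, and its work bounds its
  span.\<close>

definition ins_ok :: "nat \<Rightarrow> nat \<Rightarrow> nat \<Rightarrow> nat set \<Rightarrow> nat set \<Rightarrow> nat \<Rightarrow>
    frame \<Rightarrow> memory \<Rightarrow> nat \<Rightarrow> nat \<Rightarrow> nat set \<Rightarrow> nat set \<Rightarrow> bool" where
  "ins_ok w a x K F t f' H' T D R X \<longleftrightarrow>
     veb_at H' w a (insert x K) F \<and> R \<subseteq> F \<and> X \<subseteq> F \<and> T \<le> t"

lemma wp_Assign_Seq:
  assumes "eval W f H e = v" "reads W f H e = r" "cost e = k"
    and "wp W P c (f(x := v)) H (\<lambda>f' H' T D R X. Q f' H' (1 + k + T) (1 + k + D) (r \<union> R) X)"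
  shows "wp W P (Assign x e ;; c) f H Q"
  using assms by simp

lemma le_less_power: "v \<le> W \<Longrightarrow> v < 2 ^ W" for v :: nat
  using less_exp le_less_trans by blast

section \<open>Ranges of addresses, keys and min/max fields\<close>

lemma veb_cells_le:
  assumes "veb_cells a cl n Fs Fc F" "F \<subseteq> {..<m}" "0 < n"
  shows "a + 3 < m" "cl + n \<le> m"
proof -
  show "a + 3 < m"
    using veb_cellsD(7)[OF assms(1)] assms(2) by (auto simp: subset_iff)
  have "cl + (n - 1) \<in> F"
    using veb_cellsD(8)[OF assms(1)] assms(3) by auto
  then show "cl + n \<le> m"
    using assms(2,3) by auto
qed

lemma high_less: "x < 2 ^ w \<Longrightarrow> high w x < 2 ^ (w div 2)"
proof -
  assume x: "x < 2 ^ w"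
  have "w div 2 + (w + 1) div 2 = w" by presburger
  then have "(2::nat) ^ w = 2 ^ (w div 2) * 2 ^ ((w + 1) div 2)"
    by (metis power_add)
  with x show ?thesis
    unfolding high_def by (intro less_mult_imp_div_less) simp
qed

lemma low_less: "low w x < 2 ^ ((w + 1) div 2)"
  by (simp add: low_def)

lemma Min_Max_less:
  fixes K :: "nat set"
  assumes "K \<subseteq> {..<2 ^ w}" "K \<noteq> {}"
  shows "finite K" "Min K \<in> K" "Max K \<in> K" "Min K < 2 ^ w" "Max K < 2 ^ w"
proof -
  show "finite K" using finite_subset[OF assms(1)] by simp
  then show "Min K \<in> K" "Max K \<in> K" using assms(2) by auto
  then show "Min K < 2 ^ w" "Max K < 2 ^ w" using assms(1) by auto
qed

lemma min_word_eq_iff: "K \<subseteq> {..<2 ^ w} \<Longrightarrow> min_word w K = 2 ^ w \<longleftrightarrow> K = {}"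
  using Min_Max_less(4)[of K w] by (cases "K = {}") (simp_all add: min_word_def)

lemma min_max_word_le:
  "K \<subseteq> {..<2 ^ w} \<Longrightarrow> min_word w K \<le> 2 ^ w" "K \<subseteq> {..<2 ^ w} \<Longrightarrow> max_word w K \<le> 2 ^ w"
  using Min_Max_less(4,5)[of K w] by (cases "K = {}"; simp add: min_word_def max_word_def)+

text \<open>Only one of the two calls is expensive: if the cluster is empty, the call for it takes
  constant time, and otherwise the call for the summary is skipped. \<open>Ks\<close> and
  \<open>Kc\<close> are related to each other only by \<open>ne\<close>, and no
  \<open>veb_at\<close> is assumed for the node itself, because its min or max may already have been
  overwritten while the displaced key is still to be stored below.\<close>

lemma ins_descend:
  assumes w: "2 \<le> w" and W: "w + 4 \<le> W"
    and x: "f 2 < 2 ^ w" and f: "f 0 = w" "f 1 = a"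
    and F: "veb_cells a (H (a + 3)) (2 ^ (w div 2)) Fs Fc F" "F \<subseteq> {..<2 ^ W}"
    and s: "veb_at H (w div 2) (H (a + 2)) Ks Fs"
    and c: "\<And>h. h < 2 ^ (w div 2) \<Longrightarrow> veb_at H ((w + 1) div 2) (H (H (a + 3) + h)) (Kc h) (Fc h)"
    and ne: "\<And>h. h < 2 ^ (w div 2) \<Longrightarrow> Kc h \<noteq> {} \<Longrightarrow> h \<in> Ks"
    and IH: "\<And>v a x K F H. v < w \<Longrightarrow> veb_at H v a K F \<Longrightarrow> x < 2 ^ v \<Longrightarrow> F \<subseteq> {..<2 ^ W} \<Longrightarrow>
       wp W prog ins (entry_frame [v, a, x]) H
         (ins_ok v a x K F (if card K \<le> 1 then 100 else 100 + 300 * lg v))"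
  shows "wp W prog descend f H (\<lambda>f' H' T D R X.
      veb_at H' (w div 2) (H (a + 2)) (insert (high w (f 2)) Ks) Fs \<and>
      (\<forall>h<2 ^ (w div 2). veb_at H' ((w + 1) div 2) (H (H (a + 3) + h))
         (if h = high w (f 2) then insert (low w (f 2)) (Kc h) else Kc h) (Fc h)) \<and>
      (\<forall>i \<in> {a..<a + 4} \<union> {H (a + 3)..<H (a + 3) + 2 ^ (w div 2)}. H' i = H i) \<and>
      R \<subseteq> F \<and> X \<subseteq> F \<and> T \<le> 300 + 300 * lg ((w + 1) div 2))"
proof -
  define hw where "hw = (w + 1) div 2"
  define h where "h = high w (f 2)"
  define l where "l = low w (f 2)"
  define cl where "cl = H (H (a + 3) + h)"
  have h: "h < 2 ^ (w div 2)" and l: "l < 2 ^ hw"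
    using high_less[OF x] low_less unfolding h_def l_def hw_def by auto
  have pw: "(2::nat) ^ w < 2 ^ W" "(2::nat) ^ hw < 2 ^ W" "(2::nat) ^ (w div 2) < 2 ^ W" "Suc 0 < 2 ^ W" "Suc w < 2 ^ W" "w < 2 ^ W" "0 < W"
    using W w unfolding hw_def by (auto intro!: power_strict_increasing le_less_power)
  have b: "a + 3 < 2 ^ W" "H (a + 3) + 2 ^ (w div 2) \<le> 2 ^ W"
    using veb_cells_le[OF F] by auto
  note cc = c[OF h, folded hw_def cl_def]
  have clF: "cl \<in> F" "H (a + 2) \<in> F"
    using veb_at_keys(5)[OF cc] veb_cellsD(6)[OF F(1) h] veb_at_keys(5)[OF s] veb_cellsD(5)[OF F(1)]
    by auto
  then have clW: "cl < 2 ^ W" "H (a + 2) < 2 ^ W"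
    using F(2) by auto
  have aF: "{a..<a+4} \<subseteq> F" "H (a + 3) + h \<in> F"
    using veb_cellsD(7,8)[OF F(1)] h by auto
  have small: "h < 2 ^ W" "l < 2 ^ W" "H (a + 3) < 2 ^ W" "hw < 2 ^ W" "f 2 < 2 ^ W" "H (a + 3) + h < 2 ^ W"
    using less_trans[OF h pw(3)] less_trans[OF l pw(2)] less_trans[OF x pw(1)] h pw b hw_def by auto
  have hw: "Suc w div 2 = hw" by (simp add: hw_def)
  have Hcl: "H cl = min_word hw (Kc h)" "Kc h \<subseteq> {..<2 ^ hw}"
    using veb_at_keys[OF cc] by auto
  then have Hcl2: "H cl < 2 ^ W"
    using pw(2) min_max_word_le(1)[OF Hcl(2)] by linarith
  define f1 where "f1 = f(7 := hw, 5 := h, 6 := cl, 2 := l)"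
  have f1: "f1 0 = w" "f1 (Suc 0) = a" "f1 2 = l" "f1 5 = h" "f1 6 = cl" "f1 7 = hw"
    using f by (simp_all add: f1_def)
  define Q where "Q = (\<lambda>H'.
      veb_at H' (w div 2) (H (a + 2)) (insert h Ks) Fs \<and>
      (\<forall>j<2 ^ (w div 2). veb_at H' ((w + 1) div 2) (H (H (a + 3) + j))
         (if j = h then insert l (Kc j) else Kc j) (Fc j)) \<and>
      (\<forall>i \<in> {a..<a + 4} \<union> {H (a + 3)..<H (a + 3) + 2 ^ (w div 2)}. H' i = H i))"
  have main: "wp W prog (If (Load (Var 6) [=] (Const 1 [<<] Var 7))
       (Call 8 1 [Var 0 [>>] Const 1, Load (Var 1 [+] Const 2), Var 5])
       Skip ;;
     Call 8 1 [Var 7, Var 6, Var 2]) f1 H (\<lambda>f' H' T D R X.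
       Q H' \<and> R \<subseteq> F \<and> X \<subseteq> F \<and> T \<le> 250 + 300 * lg hw)"
  proof (cases "Kc h = {}")
    case True
    have e: "eval W f1 H (Load (Var 6) [=] (Const 1 [<<] Var 7)) \<noteq> 0"
      using True Hcl W by (simp add: f1 small clW pw min_word_def)
    have s1: "wp W prog (prog ! 1) (entry_frame [w div 2, H (a + 2), h]) H
        (ins_ok (w div 2) (H (a + 2)) h Ks Fs (100 + 300 * lg (w div 2)))"
      unfolding One_nat_def prog_simps
      by (rule wp_conseq[OF IH[OF _ s h]])
        (use w F(2) veb_cellsD(5)[OF F(1)] in \<open>auto simp: ins_ok_def split: if_splits\<close>)
    have lgm: "lg (w div 2) \<le> lg hw"
      unfolding hw_def by (intro lg_mono) auto
    show ?thesis
      unfolding wp_Seq wp_If if_P[OF e]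
    proof (rule wp_Call[OF _ _ s1], goal_cases)
      case 2
      show ?case using f1 pw clW small b by (simp add: args_def)
    next
      case (3 f1' H1 T1 D1 R1 X1)
      have K1: "veb_at H1 (w div 2) (H (a + 2)) (insert h Ks) Fs" "R1 \<subseteq> Fs" "X1 \<subseteq> Fs"
          "T1 \<le> 100 + 300 * lg (w div 2)"
        using 3(1) by (simp_all add: ins_ok_def)
      \<comment> \<open>The call for the summary wrote only inside \<open>Fs\<close>, so the cluster
        is still empty and the constant bound of the hypothesis applies.\<close>
      have vc: "veb_at H1 hw cl {} (Fc h)"
        by (rule veb_at_cong[OF cc[unfolded True]])
          (use 3(2) K1(3) veb_cellsD(2)[OF F(1) h] in blast)
      have s2: "wp W prog (prog ! 1) (entry_frame [hw, cl, l]) H1 (ins_ok hw cl l {} (Fc h) 100)"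
        unfolding One_nat_def prog_simps
        by (rule wp_conseq[OF IH[OF _ vc l]])
          (use w hw_def F(2) veb_cellsD(6)[OF F(1) h] in \<open>auto simp: ins_ok_def split: if_splits\<close>)
      show ?case
      proof (rule wp_Call[OF _ _ s2], goal_cases)
        case 2
        show ?case using f1 pw clW small b by (simp add: args_def)
      next
        case vv: (3 f2' H2 T2 D2 R2 X2)
        have K2: "veb_at H2 hw cl {l} (Fc h)" "R2 \<subseteq> Fc h" "X2 \<subseteq> Fc h" "T2 \<le> 100"
          using vv(1) by (simp_all add: ins_ok_def)
        have H2: "H2 i = H1 i" if "i \<notin> Fc h" for i
          using vv(2) K2(3) that by auto
        have H1: "H1 i = H i" if "i \<notin> Fs" for i
          using 3(2) K1(3) that by auto
        have "veb_at H2 (w div 2) (H (a + 2)) (insert h Ks) Fs"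
          by (rule veb_at_cong[OF K1(1)], rule H2) (use veb_cellsD(2)[OF F(1) h] in auto)
        moreover have "veb_at H2 ((w + 1) div 2) (H (H (a + 3) + j))
           (if j = h then insert l (Kc j) else Kc j) (Fc j)" if j: "j < 2 ^ (w div 2)" for j
        proof (cases "j = h")
          case True
          then show ?thesis
            using K2(1) \<open>Kc h = {}\<close> by (simp add: hw_def cl_def)
        next
          case False
          then have "Fc h \<inter> Fc j = {}"
            using veb_cellsD(4)[OF F(1) h j] by simp
          then have "veb_at H2 ((w + 1) div 2) (H (H (a + 3) + j)) (Kc j) (Fc j)"
            using veb_cellsD(2)[OF F(1) j] by (intro veb_at_cong[OF c[OF j]]) (subst H2, auto intro: H1)
          with False show ?thesis by simp
        qed
        moreover have "H2 i = H i" if "i \<in> {a..<a + 4} \<union> {H (a + 3)..<H (a + 3) + 2 ^ (w div 2)}" for i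
          using veb_cellsD(1,2)[OF F(1)] h that by (subst H2, blast, subst H1, blast, simp)
        ultimately have "Q H2" by (simp add: Q_def)
        moreover have "Fs \<subseteq> F" "Fc h \<subseteq> F"
          using veb_cellsD(5,6)[OF F(1)] h by auto
        moreover have "args_reads W f1 H [Var 0 [>>] Const 1, Load (Var 1 [+] Const 2), Var 5] \<subseteq> F"
          "args_reads W (f1(8 := f1' 0)) H1 [Var 7, Var 6, Var 2] \<subseteq> F"
          "reads W f1 H (Load (Var 6) [=] Const 1 [<<] Var 7) \<subseteq> F"
          using aF clF clW b pw by (auto simp: args_reads_def f1)
        moreover have "X1 \<union> X2 \<subseteq> F" "R1 \<union> R2 \<subseteq> F"
          using K1 K2 calculation(2,3) by auto
        ultimately show ?case
          using K1(4) K2(4) lgm by (simp add: args_cost_def)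
      qed simp
    qed simp
  next
    case False
    have e: "\<not> (eval W f1 H (Load (Var 6) [=] (Const 1 [<<] Var 7)) \<noteq> 0)"
      using False Hcl Hcl2 min_word_eq_iff[OF Hcl(2)] by (simp add: f1 small clW pw)
    have s1: "wp W prog (prog ! 1) (entry_frame [hw, cl, l]) H
        (ins_ok hw cl l (Kc h) (Fc h) (100 + 300 * lg hw))"
      unfolding One_nat_def prog_simps
      by (rule wp_conseq[OF IH[OF _ cc l]])
        (use w hw_def F(2) veb_cellsD(6)[OF F(1) h] in \<open>auto simp: ins_ok_def split: if_splits\<close>)
    show ?thesis
      unfolding wp_Seq wp_If if_not_P[OF e] wp_Skip
    proof (rule wp_Call[OF _ _ s1], goal_cases)
      case 2
      show ?case using f1 pw clW small b by (simp add: args_def)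
    next
      case (3 f1' H1 T1 D1 R1 X1)
      have K1: "veb_at H1 hw cl (insert l (Kc h)) (Fc h)" "R1 \<subseteq> Fc h" "X1 \<subseteq> Fc h"
          "T1 \<le> 100 + 300 * lg hw"
        using 3(1) by (simp_all add: ins_ok_def)
      have H1: "H1 i = H i" if "i \<notin> Fc h" for i
        using 3(2) K1(3) that by auto
      \<comment> \<open>A nonempty cluster already has its index in the summary, so skipping that
        call is correct.\<close>
      have "veb_at H1 (w div 2) (H (a + 2)) (insert h Ks) Fs"
        unfolding insert_absorb[OF ne[OF h False]]
        by (rule veb_at_cong[OF s], rule H1) (use veb_cellsD(2)[OF F(1) h] in auto)
      moreover have "veb_at H1 ((w + 1) div 2) (H (H (a + 3) + j))
         (if j = h then insert l (Kc j) else Kc j) (Fc j)" if j: "j < 2 ^ (w div 2)" for j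
      proof (cases "j = h")
        case True
        then show ?thesis
          using K1(1) by (simp add: hw_def cl_def)
      next
        case False
        then have "Fc h \<inter> Fc j = {}"
          using veb_cellsD(4)[OF F(1) h j] by simp
        then have "veb_at H1 ((w + 1) div 2) (H (H (a + 3) + j)) (Kc j) (Fc j)"
          by (intro veb_at_cong[OF c[OF j]] H1) auto
        with False show ?thesis by simp
      qed
      moreover have "H1 i = H i" if "i \<in> {a..<a + 4} \<union> {H (a + 3)..<H (a + 3) + 2 ^ (w div 2)}" for i
        using veb_cellsD(1,2)[OF F(1)] h that by (subst H1, blast, simp)
      ultimately have "Q H1" by (simp add: Q_def)
      moreover have "Fc h \<subseteq> F"
        using veb_cellsD(6)[OF F(1)] h by auto
      moreover have "args_reads W f1 H [Var 7, Var 6, Var 2] \<subseteq> F"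
        "reads W f1 H (Load (Var 6) [=] Const 1 [<<] Var 7) \<subseteq> F"
        using aF clF clW b pw by (auto simp: args_reads_def f1)
      moreover have "X1 \<subseteq> F" "R1 \<subseteq> F"
        using K1 calculation(2) by auto
      ultimately show ?case
        using K1(4) by (simp add: args_cost_def)
    qed simp
  qed
  have "a + 3 \<in> F" using aF by auto
  then have rr: "reads W (f(7 := hw, 5 := h)) H (Load (Load (Var 1 [+] Const 3) [+] Var 5)) \<subseteq> F"
    using aF small b pw f by simp
  show ?thesis
    unfolding descend_def
    apply (rule wp_Assign_Seq[where v = hw, OF _ refl refl])
    subgoal by (simp add: half_e_def f pw hw small)
    apply (rule wp_Assign_Seq[where v = h, OF _ refl refl])
    subgoal using small(1) by (simp add: h_def[unfolded high_def, folded hw_def] f pw small)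
    apply (rule wp_Assign_Seq[where v = cl, OF _ refl refl])
    subgoal using small clW b by (simp add: cl_def[symmetric] f f(2)[unfolded One_nat_def] pw)
    apply (rule wp_Assign_Seq[where v = l, OF _ refl refl])
    subgoal using small(2) by (simp add: l_def[unfolded low_def, folded hw_def] f pw small)
    apply (rule wp_conseq[OF main[unfolded f1_def]])
    unfolding Q_def h_def[symmetric] l_def[symmetric] hw_def[symmetric]
    using rr
    by (simp add: half_e_def)
qed

text \<open>A key outside the range displaces an extreme, which then becomes inner; otherwise the
  key itself is inner. Either way a single key has to be passed down.\<close>

lemma inner_insert:
  assumes "finite K" "K \<noteq> {}" "x \<noteq> Min K" "x \<noteq> Max K" "Min K \<noteq> Max K"
  shows "inner (insert x K) =
    insert (if x < Min K then Min K else if Max K < x then Max K else x) (inner K)"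
proof -
  have m: "Min K \<in> K" "Max K \<in> K" "Min K < Max K" "\<And>y. y \<in> K \<Longrightarrow> Min K \<le> y \<and> y \<le> Max K"
    using assms by (simp_all add: order_less_le)
  have "Min (insert x K) = min x (Min K)" "Max (insert x K) = max x (Max K)"
    using assms by simp_all
  then show ?thesis
    unfolding inner_def using m assms(3,4) by (auto simp: min_def max_def dest: m(4))
qed

lemma entry_frame_simps [simp]:
  "entry_frame (v # vs) 0 = v"
  "entry_frame (v # vs) (Suc i) = entry_frame vs i"
  "entry_frame (v # vs) (numeral n) = entry_frame vs (pred_numeral n)"
  by (simp_all add: entry_frame_def numeral_eq_Suc)

text \<open>\<open>100\<close> pays for every path that does not descend, in particular for trees
  with at most one key; \<open>300\<close> pays for one level of descent.\<close>

lemma ins_spec: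
  assumes W: "w + 4 \<le> W"
  shows "veb_at H w a K F \<Longrightarrow> x < 2 ^ w \<Longrightarrow> F \<subseteq> {..<2 ^ W} \<Longrightarrow>
    wp W prog ins (entry_frame [w, a, x]) H
      (ins_ok w a x K F (if card K \<le> 1 then 100 else 100 + 300 * lg w))"
  using W
proof (induction w arbitrary: H a K F x rule: less_induct)
  case (less w)
  note v = less.prems(1) and x = less.prems(2) and FW = less.prems(3) and W = less.prems(4)
  note k = veb_at_keys[OF v]
  define K' where "K' = insert x K"
  have K': "K' \<subseteq> {..<2 ^ w}" using x k(1) by (simp add: K'_def)
  have pw: "(2::nat) ^ w < 2 ^ W" "Suc 0 < 2 ^ W" "w < 2 ^ W" "0 < W" "1 < W"
    using W by (auto intro!: power_strict_increasing le_less_power)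
  have aW: "a < 2 ^ W" "Suc a < 2 ^ W" "Suc a \<in> F"
    using k(5,6) FW by auto
  have xW: "x < 2 ^ W" using x pw(1) by linarith
  have mW: "min_word w K < 2 ^ W" "max_word w K < 2 ^ W"
    using min_max_word_le[OF k(1)] pw(1) by linarith+
  note Ha = k(3) k(4)[unfolded Suc_eq_plus1[symmetric]]
  note sm = pw aW xW mW Ha k(5)
  consider (empty) "K = {}" | (old) "K \<noteq> {}" "x = Min K \<or> x = Max K"
    | (single) "K \<noteq> {}" "x \<noteq> Min K" "x \<noteq> Max K" "Min K = Max K"
    | (desc) "K \<noteq> {}" "x \<noteq> Min K" "x \<noteq> Max K" "Min K \<noteq> Max K"
    by blast
  then show ?case
  proof cases
    case empty
    have "veb_at (H(a := x, Suc a := x)) w a K' F"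
      by (rule veb_at_set_min_max[OF v])
        (use empty K' in \<open>auto simp: inner_def K'_def min_word_def max_word_def\<close>)
    then show ?thesis
      using empty by (simp add: ins_def sm ins_ok_def K'_def min_word_def)
  next
    case old
    have kk: "min_word w K = Min K" "max_word w K = Max K"
      using old by (simp_all add: min_word_def max_word_def)
    have "Min K \<noteq> 2 ^ w"
      using Min_Max_less(4)[OF k(1) old(1)] by simp
    moreover have "insert x K = K"
      using old Min_Max_less(2,3)[OF k(1) old(1)] by (auto simp: insert_absorb)
    \<comment> \<open>If the tree has the single key \<open>x\<close>, both equality tests succeed;
      their sum 2 must not wrap around to 0.\<close>
    moreover have "Suc 1 < 2 ^ W"
      using W le_less_power[of "Suc 1" W] by linarith
    moreover have "eval W (entry_frame [w, a, x, Min K, Max K]) H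
        ((Var 2 [=] Var 3) [+] (Var 2 [=] Var 4)) \<noteq> 0"
      using calculation(3) old(2) xW mW[unfolded kk] pw by (cases "Min K = Max K") auto
    ultimately show ?thesis
      using v mW[unfolded kk] by (simp add: ins_def sm ins_ok_def kk)
  next
    case single
    have kk: "min_word w K = Min K" "max_word w K = Min K"
      using single by (simp_all add: min_word_def max_word_def)
    have K: "K = {Min K}"
      using Min_le[OF k(2)] Max_ge[OF k(2)] Min_Max_less(2)[OF k(1) single(1)] single(4)
      by (auto intro: antisym)
    obtain y where Ky: "K = {y}" using K by blast
    have mn: "Min K \<noteq> 2 ^ w" "Min K < 2 ^ W"
      using Min_Max_less(4)[OF k(1) single(1)] pw(1) by linarith+
    define H' where "H' = (if x < Min K then H(a := x) else H(Suc a := x))"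
    have "inner K' = inner K" "Min K' = min x (Min K)" "Max K' = max x (Min K)"
      using single(1) k(2) Ky by (auto simp: inner_def K'_def min_def max_def)
    then have "veb_at H' w a K' F"
      by (intro veb_at_set_min_max[OF v])
        (use K' k kk in \<open>auto simp: H'_def K'_def min_word_def max_word_def min_def max_def\<close>)
    then show ?thesis
      using single mn k(6) by (auto simp: ins_def sm ins_ok_def kk K'_def H'_def)
  next
    case desc
    define hw where "hw = (w + 1) div 2"
    define x' where "x' = (if x < Min K then Min K else if Max K < x then Max K else x)"
    have inn: "inner K' = insert x' (inner K)"
      using inner_insert[OF k(2) desc] by (simp add: K'_def x'_def)
    have kk: "min_word w K = Min K" "max_word w K = Max K"
      using desc by (simp_all add: min_word_def max_word_def)
    have mn: "Min K < 2 ^ w" "Max K < 2 ^ w" "Min K \<noteq> 2 ^ w"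
      using Min_Max_less(4,5)[OF k(1) desc(1)] by simp_all
    then have mn2: "Min K < 2 ^ W" "Max K < 2 ^ W"
      using pw(1) by linarith+
    have x': "x' < 2 ^ w"
      using mn x by (simp add: x'_def)
    \<comment> \<open>\<open>x\<close>, \<open>Min K\<close> and \<open>Max K\<close> are three
      distinct keys, too many for a universe of two elements.\<close>
    have w: "2 \<le> w"
    proof (rule ccontr)
      assume "\<not> 2 \<le> w"
      then have "(2::nat) ^ w \<le> 2 ^ 1" by (intro power_increasing) auto
      then have "Min K < 2" "Max K < 2" "x < 2" using mn x by simp_all
      then show False using desc by arith
    qed
    from v obtain Fs Fc where
      s: "veb_at H (w div 2) (H (a + 2)) (high w ` inner K) Fs" and
      c: "\<And>h. h < 2 ^ (w div 2) \<Longrightarrow> veb_at H ((w + 1) div 2) (H (H (a + 3) + h))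
          (low w ` {x \<in> inner K. high w x = h}) (Fc h)" and
      F: "veb_cells a (H (a + 3)) (2 ^ (w div 2)) Fs Fc F"
      unfolding veb_at_split[OF w] by blast
    have down: "wp W prog descend f H1 (\<lambda>f' H' T D R X.
       veb_at H' w a K' F \<and> R \<subseteq> F \<and> X \<subseteq> F \<and> T \<le> 300 + 300 * lg hw)"
      if f: "f 0 = w" "f 1 = a" "f 2 = x'"
        and H1: "\<And>i. i \<noteq> a \<Longrightarrow> i \<noteq> Suc a \<Longrightarrow> H1 i = H i" "H1 a = Min K'" "H1 (Suc a) = Max K'"
      for f H1
    proof -
      have H3: "H1 (a + 2) = H (a + 2)" "H1 (a + 3) = H (a + 3)"
        by (simp_all add: H1)
      have Hc: "H1 (H (a + 3) + h) = H (H (a + 3) + h)" if "h < 2 ^ (w div 2)" for h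
        using that veb_cellsD(3)[OF F, of "H (a + 3) + h"] by (intro H1(1)) auto
      have s1: "veb_at H1 (w div 2) (H (a + 2)) (high w ` inner K) Fs"
        by (rule veb_at_cong[OF s], rule H1(1)) (use veb_cellsD(1)[OF F] in force)+
      have c1: "veb_at H1 ((w + 1) div 2) (H (H (a + 3) + h))
          (low w ` {x \<in> inner K. high w x = h}) (Fc h)" if h: "h < 2 ^ (w div 2)" for h
        by (rule veb_at_cong[OF c[OF h]], rule H1(1)) (use veb_cellsD(2)[OF F h] in force)+
      show ?thesis
      proof (rule wp_conseq[OF ins_descend[where f = f and H = H1 and Fs = Fs and Fc = Fc and F = F
              and a = a and Ks = "high w ` inner K" and Kc = "\<lambda>h. low w ` {x \<in> inner K. high w x = h}",
              OF w W]], goal_cases)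
        case 1 then show ?case using f x' by simp
      next
        case 2 then show ?case using f by simp
      next
        case 3 then show ?case using f by simp
      next
        case 4 then show ?case using F H3 by simp
      next
        case 5 then show ?case using FW by simp
      next
        case 6 then show ?case using s1 H3 by simp
      next
        case (7 h) then show ?case using c1[OF 7] Hc H3 by simp
      next
        case (8 h) then show ?case by auto
      next
        case (9 v a x K F H)
        with W less.IH[of v H a K F x] show ?case by simp
      next
        case (10 f' H' T D R X)
        have eq: "H' i = H1 i" if "i \<in> {a..<a + 4} \<union> {H1 (a + 3)..<H1 (a + 3) + 2 ^ (w div 2)}" for i
          using 10(1) that by blast
        have "veb_at H' w a K' F"
        proof (rule veb_at_join[where H = H1 and Fs = Fs and Fc = Fc, OF w])
          show "veb_at H' (w div 2) (H1 (a + 2)) (high w ` inner K') Fs"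
            using 10(1) f by (simp add: inn)
          have *: "low w ` {x \<in> insert x' (inner K). high w x = h} =
             (if h = high w x' then insert (low w x') (low w ` {x \<in> inner K. high w x = h})
              else low w ` {x \<in> inner K. high w x = h})" for h
            by auto
          show "veb_at H' ((w + 1) div 2) (H1 (H1 (a + 3) + h))
            (low w ` {x \<in> inner K'. high w x = h}) (Fc h)" if "h < 2 ^ (w div 2)" for h
            unfolding inn * using 10(1)[unfolded f(3)] that by blast
          show "veb_cells a (H1 (a + 3)) (2 ^ (w div 2)) Fs Fc F" using F H3 by simp
          show "H' a = min_word w K'" "H' (a + 1) = max_word w K'"
            using eq[of a] eq[of "Suc a"] H1 by (simp_all add: min_word_def max_word_def K'_def)
          show "H' i = H1 i" if "i \<in> {a + 2..<a + 4} \<union> {H1 (a + 3)..<H1 (a + 3) + 2 ^ (w div 2)}" for i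
            using that by (intro eq) auto
        qed fact
        then show ?case using 10(1) by (simp add: hw_def)
      qed
    qed
    have mm: "Min K' = min x (Min K)" "Max K' = max x (Max K)" "Min K < Max K"
      using desc k(2) by (simp_all add: K'_def order_less_le)
    have lgw: "lg w = Suc (lg hw)"
      using lg_ge2[OF w] by (simp add: hw_def)
    have card: "\<not> card K \<le> 1"
      using desc(1,4) k(2) Min_Max_less(2,3)[OF k(1) desc(1)]
      by (metis card_le_Suc0_iff_eq One_nat_def)
    consider "x < Min K" | "Max K < x" | "Min K < x" "x < Max K"
      using desc by linarith
    then show ?thesis
    proof cases
      case 1
      then show ?thesis
        unfolding ins_def
        using desc mn mn2 mm
        apply (simp add: sm kk card[unfolded One_nat_def])
        apply (rule wp_conseq[OF down])
        by (simp_all add: ins_ok_def K'_def lgw card sm x'_def kk split: if_splits)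
    next
      case 2
      then have "\<not> x < Min K" using mm(3) by linarith
      with 2 show ?thesis
        unfolding ins_def
        using desc mn mn2 mm
        apply (simp add: sm kk card[unfolded One_nat_def])
        apply (rule wp_conseq[OF down])
        by (simp_all add: ins_ok_def K'_def lgw card sm x'_def kk split: if_splits)
    next
      case 3
      then have "\<not> x < Min K" "\<not> Max K < x" by linarith+
      then show ?thesis
        unfolding ins_def
        using desc mn mn2 mm
        apply (simp add: sm kk card[unfolded One_nat_def])
        apply (rule wp_conseq[OF down])
        by (simp_all add: ins_ok_def K'_def lgw card sm x'_def kk split: if_splits)
    qed
  qed
qed

section \<open>Groups of keys with equal high bits\<close>

text \<open>
  The segment of \<open>N\<close> keys that remain after the two sequential insertions: \<open>hk i\<close> are the high
  bits of key \<open>i\<close>, \<open>cp h\<close> is the address of cluster \<open>h\<close>, and \<open>emp h\<close> says that this cluster is empty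
  beforehand.  No cell of \<open>RO\<close> is written before the recursive calls start.
\<close>

locale segment =
  fixes W w cls lo q N :: nat
    and hk :: "nat \<Rightarrow> nat" and emp :: "nat \<Rightarrow> bool" and cp :: "nat \<Rightarrow> nat" and RO :: "nat set"
  assumes W: "4 * (w + 1) \<le> W" and w: "2 \<le> w"
    and lo: "lo + N < 2 ^ W" and cls: "cls + 2 ^ (w div 2) \<le> 2 ^ W" and q: "q + 2 ^ (4 * w) \<le> 2 ^ W"
    and N: "N \<le> 2 ^ w"
    and cp: "h < 2 ^ (w div 2) \<Longrightarrow> cp h < 2 ^ W"
    and hk: "i < N \<Longrightarrow> hk i < 2 ^ (w div 2)"
    and hk_mono: "i \<le> j \<Longrightarrow> j < N \<Longrightarrow> hk i \<le> hk j"
    and RO: "{lo..<lo + N + 1} \<subseteq> RO" "{cls..<cls + 2 ^ (w div 2)} \<subseteq> RO"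
      "h < 2 ^ (w div 2) \<Longrightarrow> cp h \<in> RO"
    and RO_disj: "RO \<inter> {q..<q + 2 ^ (4 * w)} = {}"
begin

text \<open>\<open>hk\<close>, \<open>cp\<close> and \<open>emp\<close> are fixed data of the
  locale; \<open>view\<close> ties a memory to them. It depends on \<open>RO\<close> only, so it
  survives all writes to the scratch area. The bound on \<open>H (cp h)\<close> ensures that loading
  the min field loses no bits.\<close>

definition view :: "memory \<Rightarrow> bool" where
  "view H \<longleftrightarrow> (\<forall>j<N. (H (lo + j) mod 2 ^ w) div 2 ^ ((w + 1) div 2) = hk j) \<and>
     (\<forall>h<2 ^ (w div 2). H (cls + h) = cp h \<and> H (cp h) < 2 ^ W \<and>
        (H (cp h) = 2 ^ ((w + 1) div 2) \<longleftrightarrow> emp h))"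

definition start :: "nat \<Rightarrow> bool" where
  "start i \<longleftrightarrow> i = 0 \<or> hk i \<noteq> hk (i - 1)"

definition last_of_group :: "nat \<Rightarrow> bool" where
  "last_of_group i \<longleftrightarrow> i + 1 = N \<or> hk i \<noteq> hk (i + 1)"

definition news :: "nat \<Rightarrow> nat \<Rightarrow> nat list" where
  "news i n = map hk (filter (\<lambda>j. start j \<and> emp (hk j)) [i..<i + n])"

definition slot :: "nat \<Rightarrow> nat" where
  "slot h = q + 2 * 2 ^ w + h"

lemma view_cong:
  assumes "view H" "\<And>i. i \<in> RO \<Longrightarrow> H' i = H i"
  shows "view H'"
proof -
  have "H' (lo + j) = H (lo + j)" if "j < N" for j
    by (rule assms(2)) (use that RO(1) in auto)
  moreover have "H' (cls + h) = H (cls + h)" "H' (cp h) = H (cp h)" if "h < 2 ^ (w div 2)" for h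
    by (rule assms(2), use that RO(2,3) in auto)+
  ultimately show ?thesis using assms(1) by (auto simp: view_def)
qed

lemma powers:
  "(2::nat) ^ w < 2 ^ W" "w < 2 ^ W" "Suc w < 2 ^ W" "0 < W" "Suc 0 < 2 ^ W" "2 < (2::nat) ^ W"
  "(2::nat) ^ ((w + 1) div 2) < 2 ^ W" "4 * (2::nat) ^ w \<le> 2 ^ (4 * w)" "(2::nat) ^ (w div 2) \<le> 2 ^ w"
  "(w + 1) div 2 < 2 ^ W" "4 < (2::nat) ^ W" "Suc (Suc 0) < 2 ^ W"
proof -
  have "(4::nat) * 2 ^ w = 2 ^ (w + 2)" by simp
  also have "\<dots> \<le> 2 ^ (4 * w)" using w by (intro power_increasing) auto
  finally show "4 * (2::nat) ^ w \<le> 2 ^ (4 * w)" .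
  show "(2::nat) ^ (w div 2) \<le> 2 ^ w" by (intro power_increasing) auto
  show "(2::nat) ^ w < 2 ^ W" "w < 2 ^ W" "Suc w < 2 ^ W" "0 < W" "Suc 0 < 2 ^ W" "2 < (2::nat) ^ W"
    "(2::nat) ^ ((w + 1) div 2) < 2 ^ W" "(w + 1) div 2 < 2 ^ W" "4 < (2::nat) ^ W"
    "Suc (Suc 0) < 2 ^ W"
    using W w by (auto intro!: power_strict_increasing le_less_power)
qed

lemma space: "q + 4 * 2 ^ w \<le> 2 ^ W"
  using q powers(8) by linarith

section \<open>Value, footprint and cost of the index expressions\<close>

lemma eval_half [simp]:
  assumes "f 0 = w"
  shows "eval W f H half_e = (w + 1) div 2" "reads W f H half_e = {}" "cost half_e = 5"
  using assms powers by (simp_all add: half_e_def)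

lemma cost_high_e [simp]: "cost (high_e e) = cost e + 13"
  by (simp add: high_e_def half_e_def)

lemma eval_high:
  assumes "view H" "f 0 = w" "f 2 = lo" "eval W f H e = j" "j < N" "reads W f H e = {}"
  shows "eval W f H (high_e e) = hk j" "reads W f H (high_e e) \<subseteq> RO"
    "reads W f H (high_e e) \<subseteq> {lo..<lo + N + 1}"
proof -
  have "lo + j < 2 ^ W" "lo < 2 ^ W" using lo assms(5) by auto
  moreover have "hk j < 2 ^ W"
    using hk[OF assms(5)] powers by linarith
  moreover have "(H (lo + j) mod 2 ^ W) mod 2 ^ w = H (lo + j) mod 2 ^ w"
    using powers by (intro mod_mod_cancel le_imp_power_dvd) auto
  moreover have "H (lo + j) mod 2 ^ w < 2 ^ W"
    using powers(1) by (meson le_less_trans mod_less_divisor order_less_imp_le zero_less_power zero_less_numeral)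
  ultimately show "eval W f H (high_e e) = hk j"
    using assms powers by (simp add: high_e_def view_def)
  show "reads W f H (high_e e) \<subseteq> {lo..<lo + N + 1}"
    using \<open>lo + j < 2 ^ W\<close> \<open>lo < 2 ^ W\<close> assms by (auto simp: high_e_def)
  with RO(1) show "reads W f H (high_e e) \<subseteq> RO"
    by blast
qed

lemma eval_start:
  assumes "view H" "f 0 = w" "f 2 = lo" "f 4 = i" "i < N"
  shows "eval W f H start_e \<noteq> 0 \<longleftrightarrow> start i" "reads W f H start_e \<subseteq> RO" "cost start_e = 37"
proof -
  have i: "i < 2 ^ W" using assms(5) lo by linarith
  have e: "eval W f H (Var 4) = i" "eval W f H (Var 4 [-] Const 1) = i - 1"
    using i assms powers by simp_all
  note h = eval_high[OF assms(1-3) e(1) assms(5)] eval_high[OF assms(1-3) e(2)]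
  show "eval W f H start_e \<noteq> 0 \<longleftrightarrow> start i"
    using h assms(4,5) i powers by (auto simp: start_e_def start_def)
  show "reads W f H start_e \<subseteq> RO"
    using h assms(5) by (auto simp: start_e_def)
  show "cost start_e = 37" by (simp add: start_e_def)
qed

lemma eval_end:
  assumes "view H" "f 0 = w" "f 2 = lo" "f 4 = i" "f 6 = N" "i < N"
  shows "eval W f H end_e \<noteq> 0 \<longleftrightarrow> last_of_group i" "reads W f H end_e \<subseteq> {lo..<lo + N + 1}" "cost end_e = 39"
proof -
  have i: "i < 2 ^ W" "Suc i < 2 ^ W" "N < 2 ^ W" using assms(6) lo by linarith+
  have e: "eval W f H (Var 4) = i" "eval W f H (Var 4 [+] Const 1) = i + 1"
    using i assms powers by simp_all
  note h1 = eval_high[OF assms(1-3) e(1) assms(6)]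
  note h2 = eval_high[OF assms(1-3) e(2)]
  have r: "reads W f H (high_e (Var 4 [+] Const 1)) \<subseteq> {lo..<lo + N + 1}"
    using i assms lo powers by (auto simp: high_e_def)
  show "eval W f H end_e \<noteq> 0 \<longleftrightarrow> last_of_group i"
  proof (cases "i + 1 = N")
    case True
    \<comment> \<open>At the last index the comparison involves the cell behind the segment, about
      which \<open>view\<close> says nothing. Whatever its outcome \<open>x\<close> is, the sum is 1
      or 2 and does not wrap around.\<close>
    have "x \<le> 1 \<Longrightarrow> (1 + (1 - x)) mod 2 ^ W \<noteq> 0" for x :: nat
      using powers by (cases x) auto
    from this[of "if eval W f H (high_e (Var 4)) = eval W f H (high_e (Var 4 [+] Const 1)) then 1 else 0"]
    show ?thesis
      using True i assms powers by (simp add: end_e_def last_of_group_def)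
  next
    case False
    with assms(6) have "i + 1 < N" by simp
    with h1 h2 False show ?thesis
      using i assms powers by (simp add: end_e_def last_of_group_def)
  qed
  show "reads W f H end_e \<subseteq> {lo..<lo + N + 1}"
    using h1(3) r by (auto simp: end_e_def)
  show "cost end_e = 39" by (simp add: end_e_def)
qed

lemma eval_empty:
  assumes "view H" "f 0 = w" "f 1 = cls" "eval W f H e = h" "h < 2 ^ (w div 2)" "reads W f H e = {}"
  shows "eval W f H (empty_e e) = (if emp h then 1 else 0)" "reads W f H (empty_e e) \<subseteq> RO"
    "cost (empty_e e) = cost e + 12"
proof -
  have c: "cls + h < 2 ^ W" "cls < 2 ^ W" using cls assms(5) by auto
  have v: "H (cls + h) = cp h" "H (cp h) < 2 ^ W" "H (cp h) = 2 ^ ((w + 1) div 2) \<longleftrightarrow> emp h"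
    using assms(1,5) by (auto simp: view_def)
  show "eval W f H (empty_e e) = (if emp h then 1 else 0)"
    using c v cp[OF assms(5)] assms powers by (simp add: empty_e_def)
  show "reads W f H (empty_e e) \<subseteq> RO"
    using c v cp[OF assms(5)] assms RO(2,3) by (auto simp: empty_e_def)
  show "cost (empty_e e) = cost e + 12"
    by (simp add: empty_e_def half_e_def)
qed

lemma slot_bounds: "h < 2 ^ (w div 2) \<Longrightarrow> q + 2 * 2 ^ w \<le> slot h \<and> slot h < q + 3 * 2 ^ w"
  using powers(9) unfolding slot_def by linarith

lemma eval_slot:
  assumes "f 0 = w" "f 3 = q" "eval W f H e = h" "h < 2 ^ (w div 2)" "reads W f H e = {}"
  shows "eval W f H (slot_e e) = slot h" "reads W f H (slot_e e) = {}" "cost (slot_e e) = cost e + 6"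
proof -
  have "q + 2 * 2 ^ w + h < 2 ^ W" "q < 2 ^ W" "q + 2 * 2 ^ w < 2 ^ W"  "2 * 2 ^ w < (2::nat) ^ W"
    using space slot_bounds[OF assms(4)] by (auto simp: slot_def)
  then show "eval W f H (slot_e e) = slot h"
    using assms powers by (simp add: slot_e_def slot_def)
  show "reads W f H (slot_e e) = {}" "cost (slot_e e) = cost e + 6"
    using assms by (simp_all add: slot_e_def)
qed

text \<open>For starts \<open>i < j\<close> sortedness gives
  \<open>hk i \<le> hk (j - 1) < hk j\<close>. This keeps the slots written by different branches of
  the count apart.\<close>

lemma inj_hk_start: "inj_on hk {j. j < N \<and> start j}"
proof (rule linorder_inj_onI')
  fix i j
  assume "i \<in> {j. j < N \<and> start j}" "j \<in> {j. j < N \<and> start j}" "i < j"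
  then have "hk i \<le> hk (j - 1)" "hk (j - 1) \<le> hk j" "hk j \<noteq> hk (j - 1)"
    by (auto intro!: hk_mono simp: start_def)
  then show "hk i \<noteq> hk j" by simp
qed

text \<open>The mirror image; it guarantees that the loop never calls the same cluster from two
  branches.\<close>

lemma inj_hk_last: "inj_on hk {j. j < N \<and> last_of_group j}"
proof (rule linorder_inj_onI')
  fix i j
  assume "i \<in> {j. j < N \<and> last_of_group j}" "j \<in> {j. j < N \<and> last_of_group j}" "i < j"
  then have "hk (i + 1) \<le> hk j" "hk i \<le> hk (i + 1)" "hk i \<noteq> hk (i + 1)"
    by (auto intro!: hk_mono simp: last_of_group_def)
  then show "hk i \<noteq> hk j" by simp
qed

end

section \<open>Counting and packing the new clusters\<close>

context segment
begin

text \<open>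
  Distinct inner nodes of the recursion have distinct split points \<open>i + n div 2\<close>, hence the number of
  new clusters in the left half can be stored at the split point.
\<close>

function ctree :: "memory \<Rightarrow> nat \<Rightarrow> nat \<Rightarrow> bool" where
  "ctree H i n \<longleftrightarrow> (if n \<le> 1 then True else
     H (q + (i + n div 2)) = length (news i (n div 2)) \<and>
     ctree H i (n div 2) \<and> ctree H (i + n div 2) (n - n div 2))"
  by pat_completeness auto
termination by (relation "Wellfounded.measure (\<lambda>(H, i, n). n)") auto

declare ctree.simps [simp del]

text \<open>All split points below the node for \<open>i, ..., i + n - 1\<close> lie strictly
  between \<open>i\<close> and \<open>i + n\<close>. So the cell of the node itself separates those
  of its two halves.\<close>

lemma ctree_cong:
  assumes "ctree H i n" and "\<And>x. x \<in> {q + i + 1..<q + i + n} \<Longrightarrow> H' x = H x"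
  shows "ctree H' i n"
  using assms
proof (induction n arbitrary: i rule: less_induct)
  case (less n)
  show ?case
  proof (cases "n \<le> 1")
    case False
    then have "H' (q + (i + n div 2)) = H (q + (i + n div 2))" by (intro less.prems(2)) auto
    moreover have "ctree H' i (n div 2)" "ctree H' (i + n div 2) (n - n div 2)"
      using False less.prems(1) ctree.simps[of H i n]
      by (auto intro!: less.IH less.prems(2))
    ultimately show ?thesis
      using False less.prems(1) ctree.simps[of _ i n] by simp
  qed (simp add: ctree.simps)
qed

lemma news_split: "h \<le> n \<Longrightarrow> news i n = news i h @ news (i + h) (n - h)"
  using upt_add_eq_append[of i "i + h" "n - h"] by (simp add: news_def)

lemma news_length: "length (news i n) \<le> n"
  unfolding news_def using length_filter_le[of _ "[i..<i + n]"] by simp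

lemma news_1: "news i (Suc 0) = (if start i \<and> emp (hk i) then [hk i] else [])"
  by (simp add: news_def)

lemma halves:
  fixes n k :: nat
  assumes "2 \<le> n" "n \<le> 2 ^ Suc k"
  shows "1 \<le> n div 2" "1 \<le> n - n div 2" "n div 2 \<le> 2 ^ k" "n - n div 2 \<le> 2 ^ k" "n div 2 < n"
  using assms by auto

lemma frame_bounds:
  assumes "i + n \<le> N"
  shows "i < 2 ^ W \<and> n < 2 ^ W \<and> cls < 2 ^ W \<and> lo < 2 ^ W \<and> q < 2 ^ W \<and> i + n < 2 ^ W
    \<and> q + i + n < 2 ^ W"
proof -
  have "(0::nat) < 2 ^ (w div 2)" "(0::nat) < 2 ^ w" by simp_all
  with assms lo cls space N show ?thesis by linarith
qed

lemma words:
  assumes "i < N"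
  shows "i < 2 ^ W" "lo + i < 2 ^ W" "slot (hk i) < 2 ^ W" "hk i < 2 ^ W" "hk i < 2 ^ (w div 2)"
    "hk i < 2 ^ w"
  using slot_bounds[OF hk[OF assms]] space hk[OF assms] assms lo powers(1,9) by linarith+

definition count_cells :: "nat \<Rightarrow> nat \<Rightarrow> nat set" where
  "count_cells i n = {q + i + 1..<q + i + n} \<union> (\<lambda>j. slot (hk j)) ` {j \<in> {i..<i + n}. start j}"

text \<open>The surplus 100 in \<open>T + 100\<close> is what makes the bound linear: of the 200
  saved by two halves, 100 pay for the node that joins them. A leaf takes at most 200 steps, and
  every level adds at most 100 to the span.\<close>

definition count_ok where
  "count_ok i n k f' H' T D R X \<longleftrightarrow>
     f' 0 = length (news i n) \<and> ctree H' i n \<and>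
     (\<forall>j\<in>{i..<i + n}. start j \<longrightarrow> H' (slot (hk j)) = j) \<and> R \<subseteq> RO \<and>
     X \<subseteq> count_cells i n \<and>
     T + 100 \<le> 300 * n \<and> D \<le> 200 + 100 * (k::nat)"

lemma count_leaf:
  assumes v: "view H" and i: "i < N"
  shows "wp W prog count (entry_frame [w, cls, lo, q, i, 1]) H (count_ok i 1 k)"
proof -
  note b = words[OF i]
  let ?f = "entry_frame [w, cls, lo, q, i, 1]"
  let ?g = "?f(6 := hk i)"
  have e: "eval W ?f H (Var 4) = i" using b by simp
  note h = eval_high[OF v _ _ e i, simplified]
  note st = eval_start[OF v, of ?g i, simplified, OF i]
  have e6: "eval W ?g H (Var 6) = hk i" using b by simp
  note sl = eval_slot[of ?g H "Var 6", OF _ _ e6, simplified, OF b(5)]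
  let ?H = "H(slot (hk i) := i)"
  \<comment> \<open>The emptiness test follows the store into the slot, which lies in the scratch
    area and hence outside \<open>RO\<close>.\<close>
  have v2: "view ?H"
    by (rule view_cong[OF v]) (use RO_disj slot_bounds[OF hk[OF i]] powers in auto)
  have e62: "eval W ?g ?H (Var 6) = hk i" using b by simp
  note em = eval_empty[OF v2 _ _ e62 b(5), simplified]
  show ?thesis
    unfolding count_def
    using h st sl em b powers
    by (auto simp: count_ok_def count_cells_def news_1 ctree.simps)
qed

lemma slot_start_eq:
  assumes "j < N" "j' < N" "start j" "start j'" "slot (hk j) = slot (hk j')"
  shows "j = j'"
  using assms inj_onD[OF inj_hk_start, of j j'] by (simp add: slot_def)

text \<open>The counts of the halves lie on either side of \<open>q + (i + h)\<close>, the slots lie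
  above all counts because \<open>N \<le> 2 ^ w\<close>, and different starts have different
  slots.\<close>

lemma count_cells_disj:
  assumes "i + h + m \<le> N"
  shows "count_cells i h \<inter> count_cells (i + h) m = {}"
proof -
  have s: "q + (i + h + m) \<le> slot (hk j)" if "j < N" for j
    using slot_bounds[OF hk[OF that]] assms N by linarith
  have False if "x \<in> count_cells i h" "x \<in> count_cells (i + h) m" for x
  proof -
    have "x < q + (i + h) \<or> (\<exists>j. x = slot (hk j) \<and> i \<le> j \<and> j < i + h \<and> start j)"
      using that(1) by (auto simp: count_cells_def)
    moreover have "(q + (i + h) < x \<and> x < q + (i + h + m)) \<or>
        (\<exists>j. x = slot (hk j) \<and> i + h \<le> j \<and> j < i + h + m \<and> start j)"
      using that(2) by (auto simp: count_cells_def)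
    ultimately consider "x < q + (i + h)" "q + (i + h) < x"
      | j where "x < q + (i + h)" "x = slot (hk j)" "j < i + h + m"
      | j where "x < q + (i + h + m)" "x = slot (hk j)" "j < i + h"
      | j j' where "x = slot (hk j)" "x = slot (hk j')" "start j" "start j'" "j < i + h"
          "i + h \<le> j'" "j' < i + h + m"
      by blast
    then show False
    proof cases
      case 2 with s[of j] assms show ?thesis by linarith
    next
      case 3 with s[of j] assms show ?thesis by linarith
    next
      case 4 with slot_start_eq[of j j'] assms show ?thesis by simp
    qed linarith
  qed
  then show ?thesis by blast
qed

lemma count_cells_scratch:
  assumes "i + n \<le> N"
  shows "count_cells i n \<subseteq> {q..<q + 3 * 2 ^ w}"
proof -
  have "slot (hk j) \<in> {q..<q + 3 * 2 ^ w}" if "j < N" for j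
    using slot_bounds[OF hk[OF that]] by auto
  moreover have "q + i + n \<le> q + 3 * 2 ^ w" using assms N by linarith
  ultimately show ?thesis using assms by (auto simp: count_cells_def)
qed

lemma RO_scratch: "RO \<inter> {q..<q + 4 * 2 ^ w} = {}"
proof -
  have "{q..<q + 4 * 2 ^ w} \<subseteq> {q..<q + 2 ^ (4 * w)}" using powers(8) by auto
  with RO_disj show ?thesis by blast
qed

text \<open>The induction is on the depth \<open>k\<close>, which appears in the span bound. It is
  used with \<open>k = w\<close>, so the span is linear in \<open>w\<close> however large the batch
  is.\<close>

lemma count_spec:
  assumes v: "view H"
  shows "i + n \<le> N \<Longrightarrow> 1 \<le> n \<Longrightarrow> n \<le> 2 ^ k \<Longrightarrow>
    wp W prog count (entry_frame [w, cls, lo, q, i, n]) H (count_ok i n k)"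
proof (induction k arbitrary: i n)
  case 0
  then have "n = 1" by simp
  with 0 show ?case using count_leaf[OF v, of i 0] by simp
next
  case (Suc k)
  show ?case
  proof (cases "n = 1")
    case True
    with Suc.prems show ?thesis using count_leaf[OF v, of i "Suc k"] by simp
  next
    case False
    with Suc.prems have n: "2 \<le> n" by simp
    define h where "h = n div 2"
    define m where "m = n - h"
    have hm: "1 \<le> h" "1 \<le> m" "h \<le> 2 ^ k" "m \<le> 2 ^ k" "h < n" "n = h + m"
      using halves[OF n Suc.prems(3)] by (auto simp: h_def m_def)
    note fb = frame_bounds[OF Suc.prems(1)]
    have le: "i + h \<le> N" "i + h + m \<le> N" using Suc.prems(1) hm by auto
    note s1 = Suc.IH[OF le(1) hm(1,3)] and s2 = Suc.IH[OF le(2) hm(2,4)]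
    let ?f = "entry_frame [w, cls, lo, q, i, n]"
    have e: "\<not> (eval W ?f H (Var 5 [=] Const 1) \<noteq> 0)"
      using fb powers n by simp
    have wm: "h < 2 ^ W" "m < 2 ^ W" "i + h < 2 ^ W" "q + (i + h) < 2 ^ W"
      using fb hm by linarith+
    note d = count_cells_disj[OF le(2)] count_cells_scratch[OF le(1)] count_cells_scratch[OF le(2)]
    have d3: "count_cells j l \<inter> RO = {}" if "j + l \<le> N" for j l
      using count_cells_scratch[OF that] RO_scratch by fastforce
    show ?thesis
      unfolding count_def wp_If if_not_P[OF e]
    proof (rule wp_Assign_Seq[where v = h, OF _ refl refl], goal_cases)
      case 1
      then show ?case using wm fb powers by (simp add: h_def)
    next
      case 2
      show ?case
        unfolding wp_Seq
      proof (rule wp_Fork[where vs = "[w, cls, lo, q, i, h]" and vs' = "[w, cls, lo, q, i + h, m]" and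
            ?Q1.0 = "count_ok i h k" and ?Q2.0 = "count_ok (i + h) m k"], goal_cases)
        case 3
        show ?case using wm fb powers by (simp add: args_def)
      next
        case 4
        show ?case using wm fb powers by (simp add: args_def m_def)
      next
        case 5
        show ?case using s1 by simp
      next
        case 6
        show ?case using s2 by simp
      next
        case (7 f1 H1 T1 D1 R1 X1 f2 H2 T2 D2 R2 X2)
        then have "X1 \<subseteq> count_cells i h" "X2 \<subseteq> count_cells (i + h) m" "R1 \<subseteq> RO" "R2 \<subseteq> RO"
          by (simp_all add: count_ok_def)
        then show ?case using d(1) d3[OF le(1)] d3[OF le(2)] by blast
      next
        case (8 f1 H1 T1 D1 R1 X1 f2 H2 T2 D2 R2 X2 H')
        note a1 = 8(1)[unfolded count_ok_def] and a2 = 8(2)[unfolded count_ok_def]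
        define c where "c = length (news i h)"
        define H'' where "H'' = H'(q + (i + h) := c)"
        have sb: "q + (i + h) \<noteq> slot (hk j)" if "j < N" for j
          using slot_bounds[OF hk[OF that]] le(2) hm(2) N by linarith
        \<comment> \<open>The count stored after the join goes to the one cell between those of the
          halves, so it destroys nothing.\<close>
        have mid: "q + (i + h) \<notin> count_cells i h" "q + (i + h) \<notin> count_cells (i + h) m"
          using le by (auto simp: count_cells_def sb)
        have X: "X1 \<subseteq> count_cells i h" "X2 \<subseteq> count_cells (i + h) m"
          using a1 a2 by simp_all
        have eq1: "H'' x = H1 x" if "x \<in> count_cells i h" for x
          using that mid d(1) X 8(3)[of x] by (auto simp: H''_def)
        have eq2: "H'' x = H2 x" if "x \<in> count_cells (i + h) m" for x
          using that mid d(1) X 8(4)[of x] by (auto simp: H''_def)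
        have "ctree H'' i h"
          by (rule ctree_cong[where H = H1]) (use a1 eq1 in \<open>auto simp: count_cells_def\<close>)
        moreover have "ctree H'' (i + h) m"
          by (rule ctree_cong[where H = H2]) (use a2 eq2 in \<open>auto simp: count_cells_def\<close>)
        ultimately have ct: "ctree H'' i n"
          using n by (subst ctree.simps) (simp add: h_def[symmetric] m_def[symmetric] H''_def c_def)
        have sl: "H'' (slot (hk j)) = j" if "j \<in> {i..<i + n}" "start j" for j
        proof (cases "j < i + h")
          case True
          then show ?thesis using that a1 eq1[of "slot (hk j)"] by (auto simp: count_cells_def)
        next
          case False
          then show ?thesis using that a2 eq2[of "slot (hk j)"] hm(6) by (auto simp: count_cells_def)
        qed
        have "count_cells i h \<subseteq> count_cells i n" "count_cells (i + h) m \<subseteq> count_cells i n"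
          "q + (i + h) \<in> count_cells i n"
          using hm by (auto simp: count_cells_def)
        with X have xx: "X1 \<union> X2 \<union> {q + (i + h)} \<subseteq> count_cells i n"
          by blast
        have cw: "c < 2 ^ W" "length (news (i + h) m) < 2 ^ W" "length (news i n) < 2 ^ W"
          unfolding c_def using news_length[of i h] news_length[of "i + h" m] news_length[of i n] wm fb by linarith+
        have cn: "length (news i n) = c + length (news (i + h) m)"
          using news_split[of h n i] hm by (simp add: c_def)
        show ?case
          using wm fb powers a1 a2 xx ct sl cw cn hm(6)
          apply (simp add: args_cost_def args_reads_def c_def[symmetric] H''_def[symmetric])
          by (simp add: count_ok_def)
      qed simp_all
    qed
  qed
qed

text \<open>The writes are bounded by the number of new clusters found, not by \<open>n\<close>;
  only this separates the outputs of the two halves.\<close>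

definition pack_ok where
  "pack_ok i n out k f' H' T D R X \<longleftrightarrow>
     (\<forall>t<length (news i n). H' (out + t) = news i n ! t) \<and> R \<subseteq> RO \<union> {q..<q + 2 ^ w} \<and>
     X \<subseteq> {out..<out + length (news i n)} \<and> T + 100 \<le> 300 * n \<and> D \<le> 200 + 100 * (k::nat)"

lemma pack_leaf:
  assumes v: "view H" and i: "i < N" and out: "out < 2 ^ W"
  shows "wp W prog pack (entry_frame [w, cls, lo, q, i, 1, out]) H (pack_ok i 1 out k)"
proof -
  note b = words[OF i]
  let ?f = "entry_frame [w, cls, lo, q, i, 1, out]"
  let ?g = "?f(7 := hk i)"
  have e: "eval W ?f H (Var 4) = i" using b by simp
  note h = eval_high[OF v _ _ e i, simplified]
  note st = eval_start[OF v, of ?g i, simplified, OF i]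
  have e7: "eval W ?g H (Var 7) = hk i" using b by simp
  note em = eval_empty[OF v _ _ e7 b(5), simplified]
  show ?thesis
    unfolding pack_def
    using h st em b powers out
    by (auto simp: pack_ok_def news_1 b(4))
qed

lemma pack_spec:
  assumes v: "view H"
  shows "i + n \<le> N \<Longrightarrow> 1 \<le> n \<Longrightarrow> n \<le> 2 ^ k \<Longrightarrow> ctree H i n \<Longrightarrow> q + 2 ^ w \<le> out \<Longrightarrow>
    out + n \<le> q + 2 * 2 ^ w \<Longrightarrow>
    wp W prog pack (entry_frame [w, cls, lo, q, i, n, out]) H (pack_ok i n out k)"
proof (induction k arbitrary: i n out)
  case 0
  then have "n = 1" by simp
  moreover have "out < 2 ^ W" using 0 space by simp
  ultimately show ?case using 0 pack_leaf[OF v, of i out 0] by simp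
next
  case (Suc k)
  have out: "out + n < 2 ^ W"
    using Suc.prems(6) space zero_less_power[of "2::nat" w] by linarith
  show ?case
  proof (cases "n = 1")
    case True
    with Suc.prems out show ?thesis using pack_leaf[OF v, of i out "Suc k"] by simp
  next
    case False
    with Suc.prems have n: "2 \<le> n" by simp
    define h where "h = n div 2"
    define m where "m = n - h"
    define c where "c = length (news i h)"
    have hm: "1 \<le> h" "1 \<le> m" "h \<le> 2 ^ k" "m \<le> 2 ^ k" "h < n" "n = h + m"
      using halves[OF n Suc.prems(3)] by (auto simp: h_def m_def)
    note fb = frame_bounds[OF Suc.prems(1)]
    have le: "i + h \<le> N" "i + h + m \<le> N" using Suc.prems(1) hm by auto
    have ct: "ctree H i h" "ctree H (i + h) m" "H (q + (i + h)) = c"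
      using Suc.prems(4) n ctree.simps[of H i n] by (simp_all add: h_def m_def c_def)
    have c: "c \<le> h" using news_length by (simp add: c_def)
    have cn: "news i n = news i h @ news (i + h) m"
      using news_split[of h n i] hm by simp
    have "out + h \<le> q + 2 * 2 ^ w" using Suc.prems(6) hm by simp
    note s1 = Suc.IH[OF le(1) hm(1,3) ct(1) Suc.prems(5) this]
    \<comment> \<open>The left half finds at most as many new clusters as it has keys, so the shift
      \<open>c \<le> h\<close> leaves room for the right half within the \<open>n\<close>
      cells.\<close>
    have "q + 2 ^ w \<le> out + c" "out + c + m \<le> q + 2 * 2 ^ w" using Suc.prems(5,6) hm c by simp_all
    note s2 = Suc.IH[OF le(2) hm(2,4) ct(2) this]
    let ?f = "entry_frame [w, cls, lo, q, i, n, out]"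
    have e: "\<not> (eval W ?f H (Var 5 [=] Const 1) \<noteq> 0)"
      using fb powers n by simp
    have wm: "h < 2 ^ W" "m < 2 ^ W" "i + h < 2 ^ W" "q + (i + h) < 2 ^ W" "c < 2 ^ W"
        "out + c < 2 ^ W" "out < 2 ^ W"
      using fb hm out c by linarith+
    have qr: "q + (i + h) \<in> {q..<q + 2 ^ w}"
      using le hm(2) N by auto
    have ro: "{out..<out + n} \<inter> (RO \<union> {q..<q + 2 ^ w}) = {}"
    proof -
      have "{out..<out + n} \<subseteq> {q..<q + 4 * 2 ^ w}" using Suc.prems(5,6) by auto
      moreover have "{out..<out + n} \<inter> {q..<q + 2 ^ w} = {}" using Suc.prems(5) by auto
      ultimately show ?thesis using RO_scratch by blast
    qed
    have l2: "c + length (news (i + h) m) \<le> n"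
      using news_length[of "i + h" m] c hm(6) by linarith
    show ?thesis
      unfolding pack_def wp_If if_not_P[OF e]
    proof (rule wp_Assign_Seq[where v = h, OF _ refl refl], goal_cases)
      case 1
      then show ?case using wm fb powers by (simp add: h_def)
    next
      case 2
      show ?case
      proof (rule wp_Fork[where vs = "[w, cls, lo, q, i, h, out]" and
            vs' = "[w, cls, lo, q, i + h, m, out + c]" and
            ?Q1.0 = "pack_ok i h out k" and ?Q2.0 = "pack_ok (i + h) m (out + c) k"], goal_cases)
        case 3
        show ?case using wm fb powers by (simp add: args_def)
      next
        case 4
        show ?case using wm fb powers ct(3) by (simp add: args_def m_def)
      next
        case 5
        show ?case using s1 by simp
      next
        case 6
        show ?case using s2 by simp
      next
        case (7 f1 H1 T1 D1 R1 X1 f2 H2 T2 D2 R2 X2)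
        then have X: "X1 \<subseteq> {out..<out + c}" "X2 \<subseteq> {out + c..<out + c + length (news (i + h) m)}"
          and R: "R1 \<subseteq> RO \<union> {q..<q + 2 ^ w}" "R2 \<subseteq> RO \<union> {q..<q + 2 ^ w}"
          by (simp_all add: pack_ok_def c_def)
        have "X1 \<inter> X2 = {}" using X by fastforce
        moreover have "X1 \<subseteq> {out..<out + n}" "X2 \<subseteq> {out..<out + n}"
          using X l2 by fastforce+
        ultimately show ?case using R ro by blast
      next
        case (8 f1 H1 T1 D1 R1 X1 f2 H2 T2 D2 R2 X2 H')
        note a1 = 8(1)[unfolded pack_ok_def, folded c_def] and a2 = 8(2)[unfolded pack_ok_def]
        have r: "H' (out + t) = news i n ! t" if t: "t < length (news i n)" for t
        proof (cases "t < c")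
          case True
          then have "out + t \<notin> X2" using a2 by fastforce
          then show ?thesis using True a1 8(3) by (simp add: cn nth_append c_def)
        next
          case False
          then have t': "t - c < length (news (i + h) m)" "out + t = out + c + (t - c)"
            using t by (auto simp: cn c_def)
          from False have "out + t \<notin> X1" using a1 by fastforce
          then have "H' (out + t) = H2 (out + t)" by (rule 8(4))
          also have "\<dots> = news (i + h) m ! (t - c)" using a2 t' by metis
          finally show ?thesis using False by (simp add: cn nth_append c_def)
        qed
        have xx: "X1 \<union> X2 \<subseteq> {out..<out + length (news i n)}"
          using a1 a2 unfolding cn length_append c_def[symmetric] by fastforce
        show ?case
          using wm fb powers a1 a2 xx r qr hm(6)
          by (simp add: args_cost_def args_reads_def pack_ok_def le_supI1)
      qed simp_all
    qed
  qed
qed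

end

section \<open>The parallel loop over the groups\<close>

text \<open>A scratch area holds its own tables of total size \<open>4 * 2 ^ w\<close>, one area for
  each cluster, and one for the summary, which is the \<open>+ 1\<close>. The three summands are at
  most a quarter, a half and a quarter of the right-hand side.\<close>

lemma scratch_space:
  fixes w :: nat
  assumes "2 \<le> w"
  shows "4 * 2 ^ w + (2 ^ (w div 2) + 1) * 2 ^ (4 * ((w + 1) div 2)) \<le> (2::nat) ^ (4 * w)"
proof -
  define u where "u = (w + 1) div 2"
  have u: "w = w div 2 + u" "u + 1 \<le> w" using assms by (auto simp: u_def)
  have "(4::nat) * 2 ^ w = 2 ^ (w + 2)" by simp
  also have "\<dots> \<le> 2 ^ (4 * w - 2)" using assms by (intro power_increasing) auto
  finally have 1: "(4::nat) * 2 ^ w \<le> 2 ^ (4 * w - 2)" .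
  have "(2::nat) ^ (w div 2) * 2 ^ (4 * u) = 2 ^ (w div 2 + 4 * u)" by (simp add: power_add)
  also have "\<dots> \<le> 2 ^ (4 * w - 1)" using u by (intro power_increasing) auto
  finally have 2: "(2::nat) ^ (w div 2) * 2 ^ (4 * u) \<le> 2 ^ (4 * w - 1)" .
  have 3: "(2::nat) ^ (4 * u) \<le> 2 ^ (4 * w - 2)" using u by (intro power_increasing) auto
  have 4: "2 ^ (4 * w - 1) + 2 * 2 ^ (4 * w - 2) = (2::nat) ^ (4 * w)"
  proof -
    obtain v where "w = Suc v" using assms by (cases w) auto
    then show ?thesis by (simp add: numeral_eq_Suc)
  qed
  show ?thesis
    using 1 2 3 4 unfolding u_def[symmetric] add_mult_distrib mult_1 by linarith
qed

section \<open>Groups as index intervals, and the scratch areas of their calls\<close>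

context segment
begin

text \<open>\<open>LEAST\<close> also ranges over indices beyond the segment, where
  \<open>hk\<close> is arbitrary; for \<open>i < N\<close> the witness \<open>i\<close> keeps the
  result inside.\<close>

definition gstart :: "nat \<Rightarrow> nat" where
  "gstart i = (LEAST j. hk j = hk i)"

definition scr :: "nat \<Rightarrow> nat" where
  "scr j = q + 4 * 2 ^ w + j * 2 ^ (4 * ((w + 1) div 2))"

lemma gstart:
  assumes "i < N"
  shows "hk (gstart i) = hk i" "gstart i \<le> i" "start (gstart i)"
proof -
  show 1: "hk (gstart i) = hk i" unfolding gstart_def by (rule LeastI) (rule refl)
  show "gstart i \<le> i" unfolding gstart_def by (rule Least_le) (rule refl)
  show "start (gstart i)"
  proof (rule ccontr)
    assume "\<not> start (gstart i)"
    then have "gstart i \<noteq> 0" "hk (gstart i - 1) = hk i"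
      using 1 by (auto simp: start_def)
    moreover from this(2) have "gstart i \<le> gstart i - 1"
      unfolding gstart_def by (rule Least_le)
    ultimately show False by simp
  qed
qed

text \<open>Sortedness makes every group an interval, so two indices suffice to describe the batch
  of a cluster and no key is copied.\<close>

lemma group_of_last:
  assumes "i < N" "last_of_group i"
  shows "{j. j < N \<and> hk j = hk i} = {gstart i..i}"
proof (intro equalityI subsetI)
  fix j assume "j \<in> {j. j < N \<and> hk j = hk i}"
  then have j: "j < N" "hk j = hk i" by auto
  then have "gstart i \<le> j" unfolding gstart_def by (intro Least_le)
  moreover have "j \<le> i"
  proof (rule ccontr)
    assume "\<not> j \<le> i"
    with j have "hk i \<le> hk (i + 1)" "hk (i + 1) \<le> hk j"
      by (intro hk_mono; simp)+
    moreover have "hk i \<noteq> hk (i + 1)"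
      using j \<open>\<not> j \<le> i\<close> assms(2) by (auto simp: last_of_group_def)
    ultimately show False using j by simp
  qed
  ultimately show "j \<in> {gstart i..i}" by simp
next
  fix j assume "j \<in> {gstart i..i}"
  then have "hk (gstart i) \<le> hk j" "hk j \<le> hk i" "j < N"
    using assms by (auto intro!: hk_mono)
  then show "j \<in> {j. j < N \<and> hk j = hk i}" using gstart(1)[OF assms(1)] by simp
qed

lemma ex_last_of_group:
  assumes "i < N"
  shows "\<exists>j<N. last_of_group j \<and> hk j = hk i"
proof -
  define j where "j = Max {j. j < N \<and> hk j = hk i}"
  have "j \<in> {j. j < N \<and> hk j = hk i}"
    unfolding j_def by (rule Max_in) (use assms in auto)
  moreover have "Suc j < N \<Longrightarrow> hk (Suc j) = hk i \<Longrightarrow> Suc j \<le> j"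
    unfolding j_def by (intro Max_ge) auto
  ultimately have "j < N \<and> last_of_group j \<and> hk j = hk i"
    by (auto simp: last_of_group_def)
  then show ?thesis by blast
qed

text \<open>Every group has a last index, so the loop reaches each of them. The form
  \<open>0 + N\<close> is that of \<open>groups 0 N\<close> once unfolded.\<close>

lemma hk_last_image: "hk ` {j \<in> {0..<0 + N}. last_of_group j} = hk ` {..<N}"
  using ex_last_of_group by (fastforce simp: image_iff)

lemma scr_bounds:
  assumes "j \<le> 2 ^ (w div 2)"
  shows "q + 4 * 2 ^ w \<le> scr j" "scr j + 2 ^ (4 * ((w + 1) div 2)) \<le> q + 2 ^ (4 * w)"
proof -
  show "q + 4 * 2 ^ w \<le> scr j" by (simp add: scr_def)
  have "(j + 1) * 2 ^ (4 * ((w + 1) div 2)) \<le> (2 ^ (w div 2) + 1) * (2::nat) ^ (4 * ((w + 1) div 2))"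
    using assms by (intro mult_right_mono) auto
  with scratch_space[OF w] have "4 * 2 ^ w + (j + 1) * 2 ^ (4 * ((w + 1) div 2)) \<le> (2::nat) ^ (4 * w)"
    by linarith
  then show "scr j + 2 ^ (4 * ((w + 1) div 2)) \<le> q + 2 ^ (4 * w)"
    by (simp add: scr_def)
qed

lemma scr_disj:
  assumes "i \<noteq> j"
  shows "{scr i..<scr i + 2 ^ (4 * ((w + 1) div 2))} \<inter> {scr j..<scr j + 2 ^ (4 * ((w + 1) div 2))} = {}"
proof -
  have *: "scr i + 2 ^ (4 * ((w + 1) div 2)) \<le> scr j" if "i < j" for i j
  proof -
    have "(i + 1) * 2 ^ (4 * ((w + 1) div 2)) \<le> j * (2::nat) ^ (4 * ((w + 1) div 2))"
      using that by (intro mult_right_mono) auto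
    then show ?thesis by (simp add: scr_def)
  qed
  from *[of i j] *[of j i] assms show ?thesis by (cases "i < j") auto
qed

lemma eval_scratch:
  assumes "f 0 = w" "f 3 = q" "eval W f H e = j" "j \<le> 2 ^ (w div 2)" "reads W f H e = {}"
  shows "eval W f H (scratch_e e) = scr j" "reads W f H (scratch_e e) = {}"
    "cost (scratch_e e) = cost e + 14"
proof -
  define u where "u = (w + 1) div 2"
  have le: "q + 4 * 2 ^ w + j * 2 ^ (4 * u) + 2 ^ (4 * u) \<le> 2 ^ W"
    using scr_bounds(2)[OF assms(4)] q by (simp add: scr_def u_def)
  have p: "(0::nat) < 2 ^ (4 * u)" by simp
  have "4 * u < 2 ^ W"
    using W w by (intro le_less_power) (auto simp: u_def)
  moreover have "q + 4 * 2 ^ w + j * 2 ^ (4 * u) < 2 ^ W" "q < 2 ^ W" "q + 4 * 2 ^ w < 2 ^ W"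
    "4 * 2 ^ w < (2::nat) ^ W" "j * 2 ^ (4 * u) < 2 ^ W"
    using le p by linarith+
  moreover have "u * 2 ^ 2 = 4 * u" by simp
  moreover have "eval W f H half_e = u" using eval_half(1)[of f] assms(1) by (simp add: u_def)
  ultimately show "eval W f H (scratch_e e) = scr j"
    using assms powers unfolding scr_def u_def[symmetric]
    by (simp add: scratch_e_def mult.commute)
  show "reads W f H (scratch_e e) = {}" "cost (scratch_e e) = cost e + 14"
    using assms by (simp_all add: scratch_e_def)
qed

end

text \<open>The recursive call for cluster \<open>h\<close> owns the cells \<open>Z h\<close>.\<close>

locale group_calls = segment +
  fixes H :: memory and Z :: "nat \<Rightarrow> nat set" and Fc K' :: "nat \<Rightarrow> nat set"
    and tb :: "nat \<Rightarrow> nat" and db :: nat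
  assumes v: "view H"
    and slots: "j < N \<Longrightarrow> start j \<Longrightarrow> H (slot (hk j)) = j"
    and Z_disj: "h < 2 ^ (w div 2) \<Longrightarrow> h' < 2 ^ (w div 2) \<Longrightarrow> h \<noteq> h' \<Longrightarrow> Z h \<inter> Z h' = {}"
    and Z_RO: "h < 2 ^ (w div 2) \<Longrightarrow>
      Z h \<inter> ({lo..<lo + N + 1} \<union> {cls..<cls + 2 ^ (w div 2)} \<union> {q..<q + 4 * 2 ^ w}) = {}"
    and Fc_Z: "h < 2 ^ (w div 2) \<Longrightarrow> Fc h \<subseteq> Z h"
    and call: "i < N \<Longrightarrow> last_of_group i \<Longrightarrow>
      wp W prog batch (entry_frame [(w + 1) div 2, cp (hk i), lo + gstart i, i + 1 - gstart i, scr (hk i + 1)]) H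
        (\<lambda>f' H' T D R X. veb_at H' ((w + 1) div 2) (cp (hk i)) (K' (hk i)) (Fc (hk i)) \<and>
           R \<subseteq> {lo..<lo + N + 1} \<union> Z (hk i) \<and> X \<subseteq> Z (hk i) \<and> T \<le> tb (hk i) \<and> D \<le> db)"
begin

definition groups :: "nat \<Rightarrow> nat \<Rightarrow> nat set" where
  "groups i n = hk ` {j \<in> {i..<i + n}. last_of_group j}"

text \<open>In contrast to \<open>RO\<close> there are no cluster nodes in this set: the calls for
  other groups are writing to them, so the loop itself may look only at keys, cluster addresses and
  its own tables.\<close>

definition RL :: "nat set" where
  "RL = {lo..<lo + N + 1} \<union> {cls..<cls + 2 ^ (w div 2)} \<union> {q..<q + 4 * 2 ^ w}"

definition loop_ok where
  "loop_ok i n k f' H' T D R X \<longleftrightarrow>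
     (\<forall>h\<in>groups i n. veb_at H' ((w + 1) div 2) (cp h) (K' h) (Fc h)) \<and>
     R \<subseteq> RL \<union> \<Union> (Z ` groups i n) \<and> X \<subseteq> \<Union> (Z ` groups i n) \<and>
     T + 100 \<le> 300 * n + (\<Sum>h\<in>groups i n. tb h) \<and> D \<le> 200 + 100 * (k::nat) + db"

lemma groups_less: "i + n \<le> N \<Longrightarrow> h \<in> groups i n \<Longrightarrow> h < 2 ^ (w div 2)"
  using hk by (auto simp: groups_def)

lemma groups_split: "groups i (h + m) = groups i h \<union> groups (i + h) m"
proof -
  have "{j \<in> {i..<i + (h + m)}. last_of_group j} =
      {j \<in> {i..<i + h}. last_of_group j} \<union> {j \<in> {i + h..<i + h + m}. last_of_group j}"
    by auto
  then show ?thesis by (simp add: groups_def image_Un)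
qed

lemma groups_disj:
  assumes "i + h + m \<le> N"
  shows "groups i h \<inter> groups (i + h) m = {}"
proof -
  have "hk j \<noteq> hk j'"
    if "j \<in> {i..<i + h}" "last_of_group j" "j' \<in> {i + h..<i + h + m}" "last_of_group j'" for j j'
    using that assms inj_onD[OF inj_hk_last, of j j'] by auto
  then show ?thesis unfolding groups_def by blast
qed

lemma loop_leaf:
  assumes i: "i < N"
  shows "wp W prog loop (entry_frame [w, cls, lo, q, i, 1, N]) H (loop_ok i 1 k)"
proof -
  note b = words[OF i]
  let ?f = "entry_frame [w, cls, lo, q, i, 1, N]"
  let ?g = "?f(7 := hk i)"
  have e: "eval W ?f H (Var 4) = i" using b by simp
  note h = eval_high[OF v _ _ e i, simplified]
  note en = eval_end[OF v, of ?g i, simplified, OF i]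
  have e7: "eval W ?g H (Var 7) = hk i" using b by simp
  note sl = eval_slot[of ?g H "Var 7", OF _ _ e7, simplified, OF b(5)]
  note g = gstart[OF i]
  have Hs: "H (slot (hk i)) = gstart i"
    using slots[of "gstart i"] g i by simp
  show ?thesis
  proof (cases "last_of_group i")
    case False
    then have "groups i 1 = {}" by (simp add: groups_def)
    then show ?thesis
      unfolding loop_def
      using h en b powers False
      by (auto simp: loop_ok_def RL_def)
  next
    case True
    then have G: "groups i 1 = {hk i}" by (auto simp: groups_def)
    have c: "cls + hk i < 2 ^ W" "cls < 2 ^ W" "cp (hk i) < 2 ^ W" "H (cls + hk i) = cp (hk i)"
      using cls b(5) cp[OF b(5)] v by (auto simp: view_def)
    have gW: "gstart i < 2 ^ W" "lo + gstart i < 2 ^ W" "lo < 2 ^ W" "Suc i < 2 ^ W"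
      using g(2) b i lo by linarith+
    let ?g' = "?g(8 := gstart i)"
    have hW: "Suc (hk i) < 2 ^ W" using b(5) powers(1,9) by linarith
    then have e9: "eval W ?g' H (Var 7 [+] Const 1) = hk i + 1" by (simp add: b(4) powers)
    have "hk i + 1 \<le> 2 ^ (w div 2)" using b(5) by simp
    note sc = eval_scratch[of ?g' H, OF _ _ e9 this, simplified]
    have r: "slot (hk i) \<in> {q..<q + 4 * 2 ^ w}"
      using slot_bounds[OF b(5)] by auto
    have e5: "eval W ?f H (Var 5 [=] Const 1) \<noteq> 0" "eval W ?g H end_e \<noteq> 0"
      using powers en True by simp_all
    show ?thesis
      unfolding loop_def wp_If if_P[OF e5(1)]
      apply (rule wp_Assign_Seq[where v = "hk i", OF _ refl refl])
       apply (simp add: h)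
      unfolding wp_If if_P[OF e5(2)]
      apply (rule wp_Assign_Seq[where v = "gstart i", OF _ refl refl])
       apply (simp add: sl Hs b gW)
    proof (rule wp_Call[where P = prog and p = 0, OF _ _ call[OF i True, folded prog_simps(2)]], goal_cases)
      case 2
      show ?case
        using gW c b e9 sc powers by (simp add: args_def b(4) hW)
    next
      case (3 f' H' T D R X)
      show ?case
        using 3 G gW c b e9 sc powers h en sl r
        by (auto simp: loop_ok_def RL_def args_cost_def args_reads_def b(4) hW)
    qed simp
  qed
qed

lemma Z_groups_disj:
  assumes "i + h + m \<le> N"
  shows "\<Union> (Z ` groups i h) \<inter> \<Union> (Z ` groups (i + h) m) = {}"
proof -
  have "Z x \<inter> Z y = {}" if "x \<in> groups i h" "y \<in> groups (i + h) m" for x y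
    using that groups_disj[OF assms] groups_less[of i h x] groups_less[of "i + h" m y] assms
    by (intro Z_disj) auto
  then show ?thesis by blast
qed

lemma Z_groups_RL: "i + n \<le> N \<Longrightarrow> \<Union> (Z ` groups i n) \<inter> RL = {}"
  using Z_RO groups_less[of i n] unfolding RL_def by blast

lemma finite_groups: "finite (groups i n)"
  by (simp add: groups_def)

lemma loop_spec:
  "i + n \<le> N \<Longrightarrow> 1 \<le> n \<Longrightarrow> n \<le> 2 ^ k \<Longrightarrow>
    wp W prog loop (entry_frame [w, cls, lo, q, i, n, N]) H (loop_ok i n k)"
proof (induction k arbitrary: i n)
  case 0
  then have "n = 1" by simp
  with 0 show ?case using loop_leaf[of i 0] by simp
next
  case (Suc k)
  show ?case
  proof (cases "n = 1")
    case True
    with Suc.prems show ?thesis using loop_leaf[of i "Suc k"] by simp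
  next
    case False
    with Suc.prems have n: "2 \<le> n" by simp
    define h where "h = n div 2"
    define m where "m = n - h"
    have hm: "1 \<le> h" "1 \<le> m" "h \<le> 2 ^ k" "m \<le> 2 ^ k" "h < n" "n = h + m"
      using halves[OF n Suc.prems(3)] by (auto simp: h_def m_def)
    note fb = frame_bounds[OF Suc.prems(1)]
    have le: "i + h \<le> N" "i + h + m \<le> N" using Suc.prems(1) hm by auto
    note s1 = Suc.IH[OF le(1) hm(1,3)] and s2 = Suc.IH[OF le(2) hm(2,4)]
    let ?f = "entry_frame [w, cls, lo, q, i, n, N]"
    have e: "\<not> (eval W ?f H (Var 5 [=] Const 1) \<noteq> 0)"
      using fb powers n by simp
    have wm: "h < 2 ^ W" "m < 2 ^ W" "i + h < 2 ^ W" "N < 2 ^ W"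
      using fb hm lo by linarith+
    note gd = Z_groups_disj[OF le(2)] and g1 = Z_groups_RL[OF le(1)] and g2 = Z_groups_RL[OF le(2)]
    have gs: "groups i n = groups i h \<union> groups (i + h) m"
      by (simp add: hm(6) groups_split)
    have ts: "(\<Sum>x\<in>groups i n. tb x) = (\<Sum>x\<in>groups i h. tb x) + (\<Sum>x\<in>groups (i + h) m. tb x)"
      unfolding gs by (intro sum.union_disjoint finite_groups groups_disj le)
    show ?thesis
      unfolding loop_def wp_If if_not_P[OF e]
    proof (rule wp_Assign_Seq[where v = h, OF _ refl refl], goal_cases)
      case 1
      then show ?case using wm fb powers by (simp add: h_def)
    next
      case 2
      show ?case
      proof (rule wp_Fork[where vs = "[w, cls, lo, q, i, h, N]" and
            vs' = "[w, cls, lo, q, i + h, m, N]" and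
            ?Q1.0 = "loop_ok i h k" and ?Q2.0 = "loop_ok (i + h) m k"], goal_cases)
        case 3
        show ?case using wm fb powers by (simp add: args_def)
      next
        case 4
        show ?case using wm fb powers by (simp add: args_def m_def)
      next
        case 5
        show ?case using s1 by simp
      next
        case 6
        show ?case using s2 by simp
      next
        case (7 f1 H1 T1 D1 R1 X1 f2 H2 T2 D2 R2 X2)
        then have "X1 \<subseteq> \<Union> (Z ` groups i h)" "X2 \<subseteq> \<Union> (Z ` groups (i + h) m)"
          "R1 \<subseteq> RL \<union> \<Union> (Z ` groups i h)" "R2 \<subseteq> RL \<union> \<Union> (Z ` groups (i + h) m)"
          by (simp_all add: loop_ok_def)
        then show ?case using gd g1 g2 by blast
      next
        case (8 f1 H1 T1 D1 R1 X1 f2 H2 T2 D2 R2 X2 H')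
        note a1 = 8(1)[unfolded loop_ok_def] and a2 = 8(2)[unfolded loop_ok_def]
        have r1: "veb_at H' ((w + 1) div 2) (cp x) (K' x) (Fc x)" if x: "x \<in> groups i h" for x
        proof (rule veb_at_cong[where H = H1])
          show "veb_at H1 ((w + 1) div 2) (cp x) (K' x) (Fc x)" using a1 x by simp
          fix y assume "y \<in> Fc x"
          then have "y \<in> \<Union> (Z ` groups i h)" using Fc_Z[OF groups_less[OF le(1) x]] x by blast
          then have "y \<notin> X2" using gd a2 by blast
          then show "H' y = H1 y" by (rule 8(3))
        qed
        have r2: "veb_at H' ((w + 1) div 2) (cp x) (K' x) (Fc x)" if x: "x \<in> groups (i + h) m" for x
        proof (rule veb_at_cong[where H = H2])
          show "veb_at H2 ((w + 1) div 2) (cp x) (K' x) (Fc x)" using a2 x by simp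
          fix y assume "y \<in> Fc x"
          then have "y \<in> \<Union> (Z ` groups (i + h) m)" using Fc_Z[OF groups_less[OF le(2) x]] x by blast
          then have "y \<notin> X1" using gd a1 by blast
          then show "H' y = H2 y" by (rule 8(4))
        qed
        have xx: "X1 \<union> X2 \<subseteq> \<Union> (Z ` groups i n)" "R1 \<union> R2 \<subseteq> RL \<union> \<Union> (Z ` groups i n)"
          unfolding gs using a1 a2 by blast+
        have r: "\<forall>x\<in>groups i n. veb_at H' ((w + 1) div 2) (cp x) (K' x) (Fc x)"
          unfolding gs using r1 r2 by blast
        have tt: "T1 + T2 + 200 \<le> 300 * n + (\<Sum>x\<in>groups i n. tb x)"
          unfolding ts using a1 a2 hm(6) by linarith
        have dd: "D1 \<le> 200 + 100 * k + db" "D2 \<le> 200 + 100 * k + db"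
          using a1 a2 by simp_all
        show ?case
          using r tt dd xx
          by (simp add: args_cost_def args_reads_def loop_ok_def)
      qed simp_all
    qed
  qed
qed

end

section \<open>Work and span\<close>

text \<open>The slope 1400 exceeds 1300, the price of a remaining key: 300 in each of count, pack
  and loop, and 400 if it opens a cluster. The 400 of an empty tree cover two insertions at 100 each
  and the fixed overhead of the procedures.\<close>

definition work_bound :: "nat \<Rightarrow> nat \<Rightarrow> bool \<Rightarrow> nat" where
  "work_bound w n e = (if n = 0 then 10 else if e then 400 + 1400 * (n - 1) * (lg w + 1)
     else 1400 * n * (lg w + 1))"

text \<open>Two sequential insertions and three passes add at most \<open>900 * w + 997\<close> to
  the span at width \<open>(w + 1) div 2\<close>. The slope 6000 absorbs this and the rounding of
  the half for all \<open>w \<ge> 2\<close>.\<close>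

definition span_bound :: "nat \<Rightarrow> nat" where
  "span_bound w = 6000 * w + 300"

context segment
begin

lemma sorted_news: "i + n \<le> N \<Longrightarrow> sorted_wrt (<) (news i n)"
proof -
  assume le: "i + n \<le> N"
  have "sorted_wrt (<) (filter (\<lambda>j. start j \<and> emp (hk j)) [i..<i + n])"
    by (intro sorted_wrt_filter) simp
  then have "sorted_wrt (\<lambda>x y. hk x < hk y) (filter (\<lambda>j. start j \<and> emp (hk j)) [i..<i + n])"
  proof (rule sorted_wrt_mono_rel[rotated])
    fix x y assume "x \<in> set (filter (\<lambda>j. start j \<and> emp (hk j)) [i..<i + n])"
      "y \<in> set (filter (\<lambda>j. start j \<and> emp (hk j)) [i..<i + n])" "x < y"
    then have "hk x \<le> hk y" "hk x \<noteq> hk y"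
      using le hk_mono[of x y] inj_onD[OF inj_hk_start, of x y] by auto
    then show "hk x < hk y" by simp
  qed
  then show "sorted_wrt (<) (news i n)" by (simp add: news_def sorted_wrt_map)
qed

lemma set_news: "set (news 0 N) = {h \<in> hk ` {..<N}. emp h}"
proof -
  have "hk i \<in> set (news 0 N)" if "i < N" "emp (hk i)" for i
  proof -
    have "gstart i \<in> {j. j < N \<and> start j \<and> emp (hk j)}"
      using gstart[OF that(1)] that by simp
    then have "hk (gstart i) \<in> set (news 0 N)"
      unfolding news_def by simp
    then show ?thesis using gstart(1)[OF that(1)] by simp
  qed
  moreover have "set (news 0 N) \<subseteq> {h \<in> hk ` {..<N}. emp h}"
    by (auto simp: news_def)
  ultimately show ?thesis by blast
qed

lemma card_news: "card {h \<in> hk ` {..<N}. emp h} = length (news 0 N)"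
  using sorted_news[of 0 N] distinct_card[of "news 0 N"]
  by (simp add: set_news strict_sorted_iff)

definition gsize :: "nat \<Rightarrow> nat" where
  "gsize h = card {j. j < N \<and> hk j = h}"

lemma gsize_pos: "h \<in> hk ` {..<N} \<Longrightarrow> 1 \<le> gsize h"
  unfolding gsize_def by (intro leI notI) (auto simp: card_eq_0_iff)

lemma sum_gsize: "(\<Sum>h\<in>hk ` {..<N}. gsize h) = N"
proof -
  have "(\<Sum>h\<in>hk ` {..<N}. sum (\<lambda>_. 1) {j \<in> {..<N}. hk j = h}) = (\<Sum>j<N. (1::nat))"
    by (rule sum.group) auto
  then show ?thesis by (simp add: gsize_def)
qed

text \<open>Since \<open>lg w = lg ((w + 1) div 2) + 1\<close>, a group of \<open>g\<close> keys may
  cost \<open>1400 * g * lg w\<close>; if its cluster is empty, the bound is smaller by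
  \<open>1400 * lg w - 400\<close>. Exactly \<open>k\<close> groups are of this kind, and the
  summary needs at most \<open>10 + 1400 * k * lg w\<close>, whether it was empty or not; hence
  \<open>e\<close> is arbitrary.\<close>

lemma sum_work:
  assumes "k = length (news 0 N)"
  shows "(\<Sum>h\<in>hk ` {..<N}. work_bound ((w + 1) div 2) (gsize h) (emp h)) + work_bound (w div 2) k e
    \<le> 10 + 400 * k + 1400 * N * lg w"
proof -
  let ?G = "hk ` {..<N}"
  have e: "(\<Sum>h\<in>?G. if emp h then c else 0) = c * k" for c :: nat
    using card_news by (simp add: sum.If_cases Int_def assms)
  have L: "lg w = lg ((w + 1) div 2) + 1" using lg_ge2[OF w] by simp
  have "work_bound ((w + 1) div 2) (gsize h) (emp h) + (if emp h then 1400 * lg w else 0)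
      \<le> 1400 * lg w * gsize h + (if emp h then 400 else 0)" if "h \<in> ?G" for h
  proof -
    from gsize_pos[OF that] obtain g where "gsize h = Suc g" by (cases "gsize h") auto
    then show ?thesis by (simp add: work_bound_def L algebra_simps)
  qed
  then have "(\<Sum>h\<in>?G. work_bound ((w + 1) div 2) (gsize h) (emp h) + (if emp h then 1400 * lg w else 0))
      \<le> (\<Sum>h\<in>?G. 1400 * lg w * gsize h + (if emp h then 400 else 0))"
    by (rule sum_mono)
  then have 1: "(\<Sum>h\<in>?G. work_bound ((w + 1) div 2) (gsize h) (emp h)) + 1400 * lg w * k
      \<le> 1400 * lg w * N + 400 * k"
    unfolding sum.distrib e sum_distrib_left[symmetric] sum_gsize .
  have "lg (w div 2) + 1 \<le> lg w" unfolding L using lg_mono[of "w div 2" "(w + 1) div 2"] by simp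
  then have m: "k * (lg (w div 2) + 1) \<le> k * lg w" by (rule mult_le_mono2)
  have "work_bound (w div 2) k e \<le> 10 + 1400 * lg w * k"
  proof (cases k)
    case 0 then show ?thesis by (simp add: work_bound_def)
  next
    case (Suc k')
    then show ?thesis using m by (auto simp: work_bound_def algebra_simps)
  qed
  with 1 show ?thesis by (simp add: algebra_simps)
qed

end

text \<open>\<open>\<kappa>\<close> lists the reduced keys, so that strict monotonicity is demanded
  of them and not of the cells, which may still carry the bits already used up by ancestors.\<close>

definition batch_pre where
  "batch_pre W w a lo n q H K F \<kappa> \<longleftrightarrow>
     veb_at H w a K F \<and> 4 * (w + 1) \<le> W \<and> F \<subseteq> {..<2 ^ W} \<and> lo + n < 2 ^ W \<and>
     q + 2 ^ (4 * w) \<le> 2 ^ W \<and> (\<forall>i<n. H (lo + i) mod 2 ^ w = \<kappa> i) \<and>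
     (\<forall>i j. i < j \<and> j < n \<longrightarrow> \<kappa> i < \<kappa> j) \<and>
     F \<inter> {lo..<lo + n} = {} \<and> F \<inter> {q..<q + 2 ^ (4 * w)} = {} \<and>
     {lo..<lo + n} \<inter> {q..<q + 2 ^ (4 * w)} = ({} :: nat set)"

definition batch_ok where
  "batch_ok w a lo n q K F \<kappa> f' H' T D R X \<longleftrightarrow>
     veb_at H' w a (K \<union> \<kappa> ` {..<n}) F \<and>
     R \<subseteq> F \<union> {lo..<lo + n} \<union> {q..<q + 2 ^ (4 * w)} \<and> X \<subseteq> F \<union> {q..<q + 2 ^ (4 * w)} \<and>
     T \<le> work_bound w n (K = {}) \<and> D \<le> span_bound w"

lemma high_mono: "x \<le> y \<Longrightarrow> high w x \<le> high w y"
  by (simp add: high_def div_le_mono)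

text \<open>This makes the low bits of a group a strictly increasing batch for its cluster.\<close>

lemma low_strict_mono: "high w x = high w y \<Longrightarrow> x < y \<Longrightarrow> low w x < low w y"
proof -
  assume h: "high w x = high w y" and "x < y"
  have "x = high w x * 2 ^ ((w + 1) div 2) + low w x" "y = high w y * 2 ^ ((w + 1) div 2) + low w y"
    unfolding high_def low_def by (rule div_mult_mod_eq[symmetric])+
  with h \<open>x < y\<close> show ?thesis by (metis nat_add_left_cancel_less)
qed

section \<open>Distribution to summary and clusters\<close>

lemma inner_Un:
  assumes "finite K" "K \<noteq> {}" "finite S" "\<And>x. x \<in> S \<Longrightarrow> Min K < x \<and> x < Max K"
  shows "Min (K \<union> S) = Min K" "Max (K \<union> S) = Max K" "inner (K \<union> S) = inner K \<union> S"
proof -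
  have K: "Min K \<in> K" "Max K \<in> K" using assms(1,2) by (rule Min_in, rule Max_in)
  show m: "Min (K \<union> S) = Min K" "Max (K \<union> S) = Max K"
    by (rule Min_eqI Max_eqI; use assms(1,3,4) K in \<open>fastforce intro: less_imp_le\<close>)+
  show "inner (K \<union> S) = inner K \<union> S"
    unfolding inner_def m using assms(4) by auto
qed

text \<open>\<open>A\<close> and \<open>B\<close> are the cells owned by the two branches,
  \<open>A'\<close> and \<open>L\<close> what they only read. \<open>A'\<close> and \<open>L\<close>
  may overlap, as the packed array does with the tables of the loop.\<close>

lemma separated_no_race:
  assumes "X1 \<subseteq> A" "R1 \<subseteq> A \<union> A'" "X2 \<subseteq> B" "R2 \<subseteq> L \<union> B"
    and "A \<inter> B = {}" "A' \<inter> B = {}" "A \<inter> L = {}"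
  shows "X1 \<inter> (R2 \<union> X2) = {} \<and> X2 \<inter> (R1 \<union> X1) = {}"
  using assms by blast

text \<open>Counting, packing and looping each have depth at most \<open>w\<close>, whence
  \<open>300 * w\<close>. Summary and clusters are served in parallel, so only one recursive span is
  added.\<close>

lemma distribute_spec:
  assumes pre: "batch_pre W w a lo n q H K F \<kappa>" and n: "3 \<le> n" and K: "K \<noteq> {}"
    and mid: "\<And>i. 0 < i \<Longrightarrow> i < n - 1 \<Longrightarrow> Min K < \<kappa> i \<and> \<kappa> i < Max K"
    and f: "f 0 = w" "f 1 = a" "f 2 = lo" "f 3 = n" "f 4 = q"
    and IH: "\<And>v a lo n q H K F \<kappa>. v < w \<Longrightarrow> batch_pre W v a lo n q H K F \<kappa> \<Longrightarrow>
      wp W prog batch (entry_frame [v, a, lo, n, q]) H (batch_ok v a lo n q K F \<kappa>)"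
  shows "wp W prog distribute f H (\<lambda>f' H' T D R X.
      veb_at H' w a (K \<union> \<kappa> ` {1..<n - 1}) F \<and>
      R \<subseteq> F \<union> {lo..<lo + n} \<union> {q..<q + 2 ^ (4 * w)} \<and> X \<subseteq> F \<union> {q..<q + 2 ^ (4 * w)} \<and>
      T \<le> 110 + 1300 * (n - 2) + 1400 * (n - 2) * lg w \<and>
      D \<le> 750 + 300 * w + span_bound ((w + 1) div 2))"
proof -
  note pre' = pre[unfolded batch_pre_def]
  have vK: "veb_at H w a K F" and W: "4 * (w + 1) \<le> W" and FW: "F \<subseteq> {..<2 ^ W}"
    and lon: "lo + n < 2 ^ W" and qW: "q + 2 ^ (4 * w) \<le> 2 ^ W"
    and key: "\<And>i. i < n \<Longrightarrow> H (lo + i) mod 2 ^ w = \<kappa> i"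
    and smono: "\<And>i j. i < j \<Longrightarrow> j < n \<Longrightarrow> \<kappa> i < \<kappa> j"
    and dis: "F \<inter> {lo..<lo + n} = {}" "F \<inter> {q..<q + 2 ^ (4 * w)} = {}"
      "{lo..<lo + n} \<inter> {q..<q + 2 ^ (4 * w)} = {}"
    using pre' by auto
  note k = veb_at_keys[OF vK]
  have "Min K < \<kappa> 1" "\<kappa> 1 < Max K" using mid[of 1] n by auto
  have w: "2 \<le> w"
  proof (rule ccontr)
    assume "\<not> 2 \<le> w"
    then have "(2::nat) ^ w \<le> 2 ^ 1" by (intro power_increasing) auto
    moreover have "Max K < 2 ^ w" by (rule Min_Max_less(5)[OF k(1) K])
    ultimately show False using \<open>Min K < \<kappa> 1\<close> \<open>\<kappa> 1 < Max K\<close> by simp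
  qed
  define u where "u = (w + 1) div 2"
  define N where "N = n - 2"
  define cls where "cls = H (a + 3)"
  define cp where "cp = (\<lambda>h. H (cls + h))"
  define hk where "hk = (\<lambda>i. high w (\<kappa> (i + 1)))"
  define S where "S = \<kappa> ` {1..<n - 1}"
  define Kc where "Kc = (\<lambda>h. low w ` {x \<in> inner K. high w x = h})"
  define emp where "emp = (\<lambda>h. Kc h = {})"
  define RO where "RO = {lo..<lo + n} \<union> F"
  have Nn: "n = N + 2" "1 \<le> N" using n by (auto simp: N_def)
  have kw: "\<kappa> i < 2 ^ w" if "i < n" for i
    using key[OF that] mod_less_divisor[of "2 ^ w" "H (lo + i)"] by simp
  from vK obtain Fs Fc where
    s: "veb_at H (w div 2) (H (a + 2)) (high w ` inner K) Fs" and
    c0: "\<And>h. h < 2 ^ (w div 2) \<Longrightarrow> veb_at H ((w + 1) div 2) (H (H (a + 3) + h))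
          (low w ` {x \<in> inner K. high w x = h}) (Fc h)" and
    F: "veb_cells a (H (a + 3)) (2 ^ (w div 2)) Fs Fc F"
    unfolding veb_at_split[OF w] by blast
  have c: "\<And>h. h < 2 ^ (w div 2) \<Longrightarrow> veb_at H u (cp h) (Kc h) (Fc h)"
    using c0 by (simp add: u_def cp_def cls_def Kc_def)
  have F': "veb_cells a cls (2 ^ (w div 2)) Fs Fc F" using F by (simp add: cls_def)
  note bnd = veb_cells_le[OF F' FW]
  have cpF: "cp h \<in> F" "cp h < 2 ^ W" if "h < 2 ^ (w div 2)" for h
    using veb_at_keys(5)[OF c[OF that]] veb_cellsD(6)[OF F' that] FW by auto
  \<comment> \<open>Distinct keys below \<open>2 ^ w\<close> give \<open>n \<le> 2 ^ w\<close>: the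
    passes have depth at most \<open>w\<close>, and counts and packed array fit into blocks of
    \<open>2 ^ w\<close> cells.\<close>
  have "inj_on \<kappa> {..<n}"
    by (rule linorder_inj_onI') (use smono less_imp_neq in blast)
  then have "card (\<kappa> ` {..<n}) = n" by (simp add: card_image)
  moreover have "card (\<kappa> ` {..<n}) \<le> card {..<(2::nat) ^ w}"
    by (rule card_mono) (use kw in auto)
  ultimately have nw: "n \<le> 2 ^ w" by simp
  \<comment> \<open>Index \<open>i\<close> of the segment is key \<open>i + 1\<close> of the batch.
    The extra cell behind the segment that \<open>RO\<close> has to contain is the last key of the
    batch.\<close>
  interpret segment W w cls "lo + 1" q N hk emp cp RO
  proof
    show "hk i \<le> hk j" if "i \<le> j" "j < N" for i j
      unfolding hk_def
      using smono[of "i + 1" "j + 1"] that Nn by (cases "i = j") (auto intro!: high_mono)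
    show "hk i < 2 ^ (w div 2)" if "i < N" for i
      unfolding hk_def using that Nn by (intro high_less kw) auto
    show "{cls..<cls + 2 ^ (w div 2)} \<subseteq> RO" using veb_cellsD(8)[OF F'] by (auto simp: RO_def)
    show "RO \<inter> {q..<q + 2 ^ (4 * w)} = {}" using dis by (auto simp: RO_def)
    show "cls + 2 ^ (w div 2) \<le> 2 ^ W" using bnd by simp
  qed (use W w lon Nn nw qW cpF in \<open>auto simp: RO_def\<close>)
  have v: "view H"
    unfolding view_def
  proof (intro conjI allI impI)
    show "H (lo + 1 + j) mod 2 ^ w div 2 ^ ((w + 1) div 2) = hk j" if "j < N" for j
      using key[of "j + 1"] that Nn by (simp add: hk_def high_def)
    fix h :: nat assume h: "h < 2 ^ (w div 2)"
    show "H (cls + h) = cp h" by (simp add: cp_def)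
    have m: "H (cp h) = min_word u (Kc h)" "Kc h \<subseteq> {..<2 ^ u}"
      using veb_at_keys[OF c[OF h]] by auto
    show "H (cp h) < 2 ^ W"
      unfolding m(1) by (rule le_less_trans[OF min_max_word_le(1)[OF m(2)]]) (use powers(7) in \<open>simp add: u_def\<close>)
    show "(H (cp h) = 2 ^ ((w + 1) div 2)) = emp h"
      using min_word_eq_iff[OF m(2)] m(1) by (simp add: u_def emp_def)
  qed
  have N2: "N \<le> 2 ^ w" using nw Nn by simp
  define k where "k = length (news 0 N)"
  have "k \<le> N" unfolding k_def by (rule news_length)
  note sp = space powers(8)
  have wds: "lo < 2 ^ W" "n < 2 ^ W" "N < 2 ^ W" "Suc lo < 2 ^ W" "cls < 2 ^ W" "a < 2 ^ W" "a + 2 < 2 ^ W" "a + 3 < 2 ^ W"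
      "q < 2 ^ W" "q + 2 ^ w < 2 ^ W" "q + 4 * 2 ^ w < 2 ^ W" "k < 2 ^ W" "4 * 2 ^ w < (2::nat) ^ W"
  proof -
    have "(0::nat) < 2 ^ w" by simp
    moreover have "a + 3 < 2 ^ W" using bnd(1) by simp
    moreover have "cls < 2 ^ W"
      using bnd(2) zero_less_power[of "2::nat" "w div 2"] by linarith
    moreover have "q + 4 * 2 ^ w < 2 ^ W"
    proof -
      have "0 < (2 ^ (w div 2) + 1) * (2::nat) ^ (4 * ((w + 1) div 2))" by simp
      with scratch_space[OF w] qW show ?thesis by linarith
    qed
    ultimately show "lo < 2 ^ W" "n < 2 ^ W" "N < 2 ^ W" "Suc lo < 2 ^ W" "cls < 2 ^ W" "a < 2 ^ W"
      "a + 2 < 2 ^ W" "a + 3 < 2 ^ W" "q < 2 ^ W" "q + 2 ^ w < 2 ^ W" "q + 4 * 2 ^ w < 2 ^ W"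
      "k < 2 ^ W" "4 * 2 ^ w < (2::nat) ^ W"
      using lon Nn \<open>k \<le> N\<close> by linarith+
  qed
  define f1 where "f1 = f(2 := lo + 1, 3 := N, 5 := cls)"
  have f1: "f1 0 = w" "f1 (Suc 0) = a" "f1 2 = lo + 1" "f1 3 = N" "f1 4 = q" "f1 5 = cls"
    using f by (simp_all add: f1_def)
  define Z where "Z = (\<lambda>h. Fc h \<union> {scr (h + 1)..<scr (h + 1) + 2 ^ (4 * u)})"
  define n_of where "n_of = (\<lambda>h. Kc h \<union> low w ` {x \<in> S. high w x = h})"
  have S: "S = (\<lambda>j. \<kappa> (j + 1)) ` {..<N}"
  proof -
    have "{1..<n - 1} = Suc ` {..<N}" unfolding image_Suc_lessThan using Nn by auto
    then show ?thesis by (simp add: S_def image_image)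
  qed
  have hkw: "hk i < 2 ^ (w div 2)" if "i < N" for i by (rule words(5)[OF that])
  have uw: "u < w" "w div 2 < w" "4 * (u + 1) \<le> W" "4 * (w div 2 + 1) \<le> W" "w div 2 \<le> u"
    using w W by (auto simp: u_def)
  have scrs: "scr (h + 1) + 2 ^ (4 * u) \<le> q + 2 ^ (4 * w)" "q + 4 * 2 ^ w \<le> scr (h + 1)"
    if "h < 2 ^ (w div 2)" for h
    using scr_bounds[of "h + 1"] that by (simp_all add: u_def)
  have scr0: "scr 0 = q + 4 * 2 ^ w" "scr 0 + 2 ^ (4 * u) \<le> q + 2 ^ (4 * w)"
    using scr_bounds(2)[of 0] by (simp_all add: u_def scr_def)
  have fork: "wp W prog
     (Fork 7 0 [Var 0 [>>] Const 1, Load (Var 1 [+] Const 2), Var 4 [+] (Const 1 [<<] Var 0),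
               Var 6, Var 4 [+] (Const 4 [<<] Var 0)]
          7 4 [Var 0, Var 5, Var 2, Var 4, Const 0, Var 3, Var 3]) f2 H2
    (\<lambda>f' H' T D R X. veb_at H' w a (K \<union> S) F \<and>
      R \<subseteq> RO \<union> {q..<q + 2 ^ (4 * w)} \<and> X \<subseteq> F \<union> {q..<q + 2 ^ (4 * w)} \<and>
      T \<le> 50 + 700 * N + 1400 * N * lg w \<and>
      D \<le> 230 + 100 * w + span_bound u)"
    if f2: "f2 0 = w" "f2 (Suc 0) = a" "f2 2 = lo + 1" "f2 3 = N" "f2 4 = q" "f2 5 = cls" "f2 6 = k"
      and eq: "\<And>x. x \<in> RO \<Longrightarrow> H2 x = H x"
      and sl: "\<And>j. j < N \<Longrightarrow> start j \<Longrightarrow> H2 (slot (hk j)) = j"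
      and ne: "\<And>t. t < k \<Longrightarrow> H2 (q + 2 ^ w + t) = news 0 N ! t"
    for f2 H2
  proof -
    have eqF: "H2 x = H x" if "x \<in> F" for x using eq that by (simp add: RO_def)
    have vs: "veb_at H2 (w div 2) (H (a + 2)) (high w ` inner K) Fs"
      by (rule veb_at_cong[OF s], rule eqF) (use veb_cellsD(5)[OF F'] in blast)
    have vc: "veb_at H2 u (cp h) (Kc h) (Fc h)" if "h < 2 ^ (w div 2)" for h
      by (rule veb_at_cong[OF c[OF that]], rule eqF) (use veb_cellsD(6)[OF F' that] in blast)
    have FcF: "Fc h \<subseteq> F" if "h < 2 ^ (w div 2)" for h by (rule veb_cellsD(6)[OF F' that])
    have FsF: "Fs \<subseteq> F" by (rule veb_cellsD(5)[OF F'])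
    have nl: "news 0 N ! t < 2 ^ (w div 2)" if "t < k" for t
    proof -
      have "news 0 N ! t \<in> set (news 0 N)" using that by (simp add: k_def)
      then show ?thesis using hkw by (auto simp: set_news)
    qed
    have pre_s: "batch_pre W (w div 2) (H (a + 2)) (q + 2 ^ w) k (q + 4 * 2 ^ w) H2
        (high w ` inner K) Fs (\<lambda>t. news 0 N ! t)"
      unfolding batch_pre_def
    proof (intro conjI allI impI)
      have p: "(2::nat) ^ (4 * (w div 2)) \<le> 2 ^ (4 * u)" using uw by (intro power_increasing) auto
      have p2: "4 * 2 ^ w + 2 ^ (4 * (w div 2)) \<le> (2::nat) ^ (4 * w)"
        using p scr0 by linarith
      have z: "{q + 2 ^ w..<q + 2 ^ w + k} \<subseteq> {q..<q + 2 ^ (4 * w)}"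
        "{q + 4 * 2 ^ w..<q + 4 * 2 ^ w + 2 ^ (4 * (w div 2))} \<subseteq> {q..<q + 2 ^ (4 * w)}"
        using \<open>k \<le> N\<close> N2 sp p2 by auto
      show "q + 2 ^ w + k < 2 ^ W" using \<open>k \<le> N\<close> N2 wds(11) by linarith
      show "q + 4 * 2 ^ w + 2 ^ (4 * (w div 2)) \<le> 2 ^ W" using scr0 p qW by linarith
      show "Fs \<inter> {q + 2 ^ w..<q + 2 ^ w + k} = {}" using z(1) dis(2) FsF by blast
      show "Fs \<inter> {q + 4 * 2 ^ w..<q + 4 * 2 ^ w + 2 ^ (4 * (w div 2))} = {}"
        using z(2) dis(2) FsF by blast
      show "{q + 2 ^ w..<q + 2 ^ w + k} \<inter> {q + 4 * 2 ^ w..<q + 4 * 2 ^ w + 2 ^ (4 * (w div 2))} = {}"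
        using \<open>k \<le> N\<close> N2 by auto
      show "H2 (q + 2 ^ w + i) mod 2 ^ (w div 2) = news 0 N ! i" if "i < k" for i
        using ne[OF that] nl[OF that] by simp
      show "news 0 N ! i < news 0 N ! j" if "i < j \<and> j < k" for i j
        using sorted_wrt_nth_less[OF sorted_news[of 0 N], of i j] that by (simp add: k_def)
    qed (use vs uw FsF FW in auto)
    interpret group_calls W w cls "lo + 1" q N hk emp cp RO H2 Z Fc n_of
      "\<lambda>h. work_bound u (gsize h) (emp h)" "span_bound u"
    proof
      show "Z h \<inter> Z h' = {}" if h: "h < 2 ^ (w div 2)" "h' < 2 ^ (w div 2)" "h \<noteq> h'" for h h'
      proof -
        have "Fc h \<inter> Fc h' = {}" by (rule veb_cellsD(4)[OF F' h])
        moreover have "F \<inter> {scr (h + 1)..<scr (h + 1) + 2 ^ (4 * u)} = {}"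
            "F \<inter> {scr (h' + 1)..<scr (h' + 1) + 2 ^ (4 * u)} = {}"
          using scrs h dis(2) by fastforce+
        moreover have "{scr (h + 1)..<scr (h + 1) + 2 ^ (4 * u)} \<inter>
            {scr (h' + 1)..<scr (h' + 1) + 2 ^ (4 * u)} = {}"
          using scr_disj[of "h + 1" "h' + 1"] h(3) by (simp add: u_def)
        ultimately show ?thesis
          using FcF[OF h(1)] FcF[OF h(2)] unfolding Z_def by blast
      qed
      show "Z h \<inter> ({lo + 1..<lo + 1 + N + 1} \<union> {cls..<cls + 2 ^ (w div 2)} \<union> {q..<q + 4 * 2 ^ w}) = {}"
        if h: "h < 2 ^ (w div 2)" for h
      proof -
        have "{scr (h + 1)..<scr (h + 1) + 2 ^ (4 * u)} \<subseteq> {q..<q + 2 ^ (4 * w)}"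
          using scrs[OF h] by auto
        moreover have "{scr (h + 1)..<scr (h + 1) + 2 ^ (4 * u)} \<inter> {q..<q + 4 * 2 ^ w} = {}"
          using scrs[OF h] by auto
        moreover have "{lo + 1..<lo + 1 + N + 1} \<subseteq> {lo..<lo + n}" using Nn by auto
        moreover have "{q..<q + 4 * 2 ^ w} \<subseteq> {q..<q + 2 ^ (4 * w)}" using sp by auto
        moreover have "{cls..<cls + 2 ^ (w div 2)} \<subseteq> F" by (rule veb_cellsD(8)[OF F'])
        moreover have "Fc h \<inter> {cls..<cls + 2 ^ (w div 2)} = {}"
          using veb_cellsD(2)[OF F' h] by blast
        ultimately show ?thesis
          using FcF[OF h] dis unfolding Z_def by blast
      qed
      show "Fc h \<subseteq> Z h" for h by (simp add: Z_def)
      show "view H2" by (rule view_cong[OF v eq])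
      show "H2 (slot (hk j)) = j" if "j < N" "start j" for j by (rule sl[OF that])
      fix i assume i: "i < N" "last_of_group i"
      define g where "g = gstart i"
      define l where "l = i + 1 - g"
      define \<kappa>' where "\<kappa>' = (\<lambda>t. low w (\<kappa> (g + t + 1)))"
      note gr = group_of_last[OF i, folded g_def]
      have gi: "g \<le> i" using gstart(2)[OF i(1)] by (simp add: g_def)
      have hk_eq: "hk (g + t) = hk i" "g + t < N" if "t < l" for t
      proof -
        have "g + t \<in> {g..i}" using that gi by (auto simp: l_def)
        then have "g + t \<in> {j. j < N \<and> hk j = hk i}" unfolding gr .
        then show "hk (g + t) = hk i" "g + t < N" by auto
      qed
      note h = hkw[OF i(1)]
      have range: "{lo + 1 + g..<lo + 1 + g + l} \<subseteq> {lo..<lo + n}"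
        using i Nn gi by (auto simp: l_def)
      have pre_c: "batch_pre W u (cp (hk i)) (lo + 1 + g) l (scr (hk i + 1)) H2
         (Kc (hk i)) (Fc (hk i)) \<kappa>'"
        unfolding batch_pre_def
      proof (intro conjI allI impI)
        have z: "{scr (hk i + 1)..<scr (hk i + 1) + 2 ^ (4 * u)} \<subseteq> {q..<q + 2 ^ (4 * w)}"
          using scrs[OF h] by auto
        show "veb_at H2 u (cp (hk i)) (Kc (hk i)) (Fc (hk i))" by (rule vc[OF h])
        show "Fc (hk i) \<subseteq> {..<2 ^ W}" using FcF[OF h] FW by blast
        show "lo + 1 + g + l < 2 ^ W" using lon i Nn gi by (simp add: l_def)
        show "scr (hk i + 1) + 2 ^ (4 * u) \<le> 2 ^ W" using scrs[OF h] qW by linarith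
        show "Fc (hk i) \<inter> {lo + 1 + g..<lo + 1 + g + l} = {}" using FcF[OF h] range dis by blast
        show "Fc (hk i) \<inter> {scr (hk i + 1)..<scr (hk i + 1) + 2 ^ (4 * u)} = {}"
          using FcF[OF h] z dis by blast
        show "{lo + 1 + g..<lo + 1 + g + l} \<inter> {scr (hk i + 1)..<scr (hk i + 1) + 2 ^ (4 * u)} = {}"
          using range z dis by blast
        show "H2 (lo + 1 + g + t) mod 2 ^ u = \<kappa>' t" if t: "t < l" for t
        proof -
          have "H2 (lo + 1 + g + t) = H (lo + 1 + g + t)"
            by (rule eq) (use range t in \<open>auto simp: RO_def\<close>)
          moreover have "H (lo + 1 + g + t) mod 2 ^ w = \<kappa> (g + t + 1)"
            using key[of "g + t + 1"] hk_eq(2)[OF t] Nn by (simp add: add.assoc add.left_commute)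
          moreover have "H (lo + 1 + g + t) mod 2 ^ w mod 2 ^ u = H (lo + 1 + g + t) mod 2 ^ u"
            using uw by (intro mod_mod_cancel le_imp_power_dvd) simp
          ultimately show ?thesis by (simp add: \<kappa>'_def low_def u_def)
        qed
        show "\<kappa>' t < \<kappa>' t'" if t: "t < t' \<and> t' < l" for t t'
          unfolding \<kappa>'_def
        proof (rule low_strict_mono)
          show "high w (\<kappa> (g + t + 1)) = high w (\<kappa> (g + t' + 1))"
            using hk_eq(1)[of t] hk_eq(1)[of t'] t by (simp add: hk_def)
          show "\<kappa> (g + t + 1) < \<kappa> (g + t' + 1)"
            using smono hk_eq(2)[of t'] t Nn by simp
        qed
      qed (use uw in simp)
      have "\<kappa>' ` {..<l} = low w ` {x \<in> S. high w x = hk i}"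
      proof -
        have "{x \<in> S. high w x = hk i} = (\<lambda>j. \<kappa> (j + 1)) ` {j. j < N \<and> hk j = hk i}"
          unfolding S hk_def by auto
        also have "{j. j < N \<and> hk j = hk i} = (\<lambda>t. g + t) ` {..<l}"
        proof -
          have "{g..i} = (\<lambda>t. g + t) ` {0..<l}"
            unfolding image_add_atLeastLessThan using gi by (auto simp: l_def)
          with gr show ?thesis by (simp add: lessThan_atLeast0)
        qed
        finally show ?thesis by (simp add: \<kappa>'_def image_image)
      qed
      then have img: "Kc (hk i) \<union> \<kappa>' ` {..<l} = n_of (hk i)" by (simp add: n_of_def)
      have sz: "gsize (hk i) = l" unfolding gsize_def gr by (simp add: l_def)
      have "wp W prog batch (entry_frame [u, cp (hk i), lo + 1 + g, l, scr (hk i + 1)]) H2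
        (\<lambda>f' H' T D R X. veb_at H' u (cp (hk i)) (n_of (hk i)) (Fc (hk i)) \<and>
           R \<subseteq> {lo + 1..<lo + 1 + N + 1} \<union> Z (hk i) \<and> X \<subseteq> Z (hk i) \<and>
           T \<le> work_bound u (gsize (hk i)) (emp (hk i)) \<and> D \<le> span_bound u)"
      proof (rule wp_conseq[OF IH[OF uw(1) pre_c]], goal_cases)
        case (1 f' H' T D R X)
        have "{lo + 1 + g..<lo + 1 + g + l} \<subseteq> {lo + 1..<lo + 1 + N + 1}"
          using i gi by (auto simp: l_def)
        with 1(1) show ?case
          unfolding batch_ok_def img sz emp_def Z_def by blast
      qed
      then show "wp W prog batch
          (entry_frame [(w + 1) div 2, cp (hk i), lo + 1 + gstart i, i + 1 - gstart i, scr (hk i + 1)]) H2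
        (\<lambda>f' H' T D R X. veb_at H' ((w + 1) div 2) (cp (hk i)) (n_of (hk i)) (Fc (hk i)) \<and>
           R \<subseteq> {lo + 1..<lo + 1 + N + 1} \<union> Z (hk i) \<and> X \<subseteq> Z (hk i) \<and>
           T \<le> work_bound u (gsize (hk i)) (emp (hk i)) \<and> D \<le> span_bound u)"
        by (simp only: u_def g_def l_def)
    qed
    have s1: "wp W prog (prog ! 0) (entry_frame [w div 2, H (a + 2), q + 2 ^ w, k, q + 4 * 2 ^ w]) H2
      (batch_ok (w div 2) (H (a + 2)) (q + 2 ^ w) k (q + 4 * 2 ^ w) (high w ` inner K) Fs (\<lambda>t. news 0 N ! t))"
      using IH[OF uw(2) pre_s] by simp
    have s2: "wp W prog (prog ! 4) (entry_frame [w, cls, lo + 1, q, 0, N, N]) H2 (loop_ok 0 N w)"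
      using loop_spec[of 0 N w] Nn N2 by simp
    have g: "groups 0 N = hk ` {..<N}"
      unfolding groups_def hk_last_image ..
    have ZF: "Z h \<subseteq> F \<union> {q..<q + 2 ^ (4 * w)}" if "h < 2 ^ (w div 2)" for h
      using FcF[OF that] scrs[OF that] unfolding Z_def by fastforce
    define B where "B = \<Union> (Z ` hk ` {..<N})"
    have ZG: "B \<subseteq> F \<union> {q..<q + 2 ^ (4 * w)}"
      unfolding B_def using ZF hkw by blast
    have RLs: "RL \<subseteq> RO \<union> {q..<q + 2 ^ (4 * w)}"
    proof -
      have "{lo + 1..<lo + 1 + N + 1} \<subseteq> RO" "{cls..<cls + 2 ^ (w div 2)} \<subseteq> RO" by (rule RO(1), rule RO(2))
      moreover have "{q..<q + 4 * 2 ^ w} \<subseteq> {q..<q + 2 ^ (4 * w)}" using sp by auto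
      ultimately show ?thesis unfolding RL_def by blast
    qed
    define A where "A = Fs \<union> {q + 4 * 2 ^ w..<q + 4 * 2 ^ w + 2 ^ (4 * (w div 2))}"
    define A' where "A' = {q + 2 ^ w..<q + 2 ^ w + k}"
    have p: "(2::nat) ^ (4 * (w div 2)) \<le> 2 ^ (4 * u)" using uw by (intro power_increasing) auto
    have As: "A \<subseteq> F \<union> {q..<q + 2 ^ (4 * w)}" "A' \<subseteq> {q..<q + 4 * 2 ^ w}"
      "{q..<q + 4 * 2 ^ w} \<subseteq> {q..<q + 2 ^ (4 * w)}"
    proof -
      have "4 * 2 ^ w + 2 ^ (4 * (w div 2)) \<le> (2::nat) ^ (4 * w)" using p scr0 by linarith
      then show "A \<subseteq> F \<union> {q..<q + 2 ^ (4 * w)}" using FsF unfolding A_def by fastforce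
      show "A' \<subseteq> {q..<q + 4 * 2 ^ w}" using \<open>k \<le> N\<close> N2 by (auto simp: A'_def)
      show "{q..<q + 4 * 2 ^ w} \<subseteq> {q..<q + 2 ^ (4 * w)}" using sp by auto
    qed
    have scr0s: "{q + 4 * 2 ^ w..<q + 4 * 2 ^ w + 2 ^ (4 * (w div 2))} \<subseteq> {scr 0..<scr 0 + 2 ^ (4 * u)}"
      using scr0 p by auto
    have dA_RL: "A \<inter> RL = {}"
    proof -
      have "Fs \<inter> {cls..<cls + 2 ^ (w div 2)} = {}" using veb_cellsD(1)[OF F'] by blast
      moreover have "{lo + 1..<lo + 1 + N + 1} \<subseteq> {lo..<lo + n}" using Nn by auto
      moreover have "{cls..<cls + 2 ^ (w div 2)} \<subseteq> F" by (rule veb_cellsD(8)[OF F'])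
      moreover have "{q + 4 * 2 ^ w..<q + 4 * 2 ^ w + 2 ^ (4 * (w div 2))} \<inter> {q..<q + 4 * 2 ^ w} = {}" by auto
      moreover have "{q + 4 * 2 ^ w..<q + 4 * 2 ^ w + 2 ^ (4 * (w div 2))} \<subseteq> {q..<q + 2 ^ (4 * w)}"
        using scr0s scr0(2) scr0(1) by fastforce
      ultimately show ?thesis using FsF As(3) dis unfolding A_def RL_def by blast
    qed
    have dA_Z: "A \<inter> Z h = {}" if h: "h < 2 ^ (w div 2)" for h
    proof -
      have "{scr 0..<scr 0 + 2 ^ (4 * u)} \<inter> {scr (h + 1)..<scr (h + 1) + 2 ^ (4 * u)} = {}"
        using scr_disj[of 0 "h + 1"] by (simp add: u_def)
      moreover have "Fs \<inter> Fc h = {}" using veb_cellsD(2)[OF F' h] by blast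
      moreover have "{scr (h + 1)..<scr (h + 1) + 2 ^ (4 * u)} \<subseteq> {q..<q + 2 ^ (4 * w)}"
        using scrs[OF h] by auto
      moreover have "{scr 0..<scr 0 + 2 ^ (4 * u)} \<subseteq> {q..<q + 2 ^ (4 * w)}"
        using scr0 by auto
      ultimately show ?thesis
        using scr0s FsF FcF[OF h] dis unfolding A_def Z_def by blast
    qed
    have dA'_Z: "A' \<inter> Z h = {}" if h: "h < 2 ^ (w div 2)" for h
    proof -
      have "{scr (h + 1)..<scr (h + 1) + 2 ^ (4 * u)} \<inter> {q..<q + 4 * 2 ^ w} = {}"
        using scrs[OF h] by auto
      then show ?thesis using As FcF[OF h] dis unfolding Z_def by blast
    qed
    have dG: "A \<inter> B = {}" "A' \<inter> B = {}"
      unfolding B_def using dA_Z dA'_Z hkw by blast+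
    show ?thesis
    proof (rule wp_Fork[OF _ _ _ _ s1 s2], goal_cases)
      case 3
      have "a + 2 \<in> F" using veb_cellsD(7)[OF F'] by auto
      then have "w div 2 < 2 ^ W" "H (a + 2) < 2 ^ W" "H2 (a + 2) = H (a + 2)"
        using wds(3) powers(2) veb_at_keys(5)[OF s] FsF FW eqF[of "a + 2"]
        by auto
      then show ?case using f2 wds powers by (simp add: args_def)
    next
      case 4
      show ?case using f2 wds powers by (simp add: args_def)
    next
      case (5 f1 H1 T1 D1 R1 X1 f2' H2' T2 D2 R2 X2)
      show ?case
      proof (rule separated_no_race[OF _ _ _ _ dG dA_RL])
        show "X1 \<subseteq> A" using 5(1) unfolding batch_ok_def A_def by blast
        show "R1 \<subseteq> A \<union> A'" using 5(1) unfolding batch_ok_def A_def A'_def by blast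
        show "X2 \<subseteq> B" "R2 \<subseteq> RL \<union> B" using 5(2) unfolding loop_ok_def g B_def by blast+
      qed
    next
      case (6 f1 H1 T1 D1 R1 X1 f2' H2' T2 D2 R2 X2 H')
      note a1 = 6(1)[unfolded batch_ok_def] and a2 = 6(2)[unfolded loop_ok_def g]
      have X: "X1 \<subseteq> A" "R1 \<subseteq> A \<union> A'" "X2 \<subseteq> B" "R2 \<subseteq> RL \<union> B"
        using a1 a2 unfolding A_def A'_def B_def by blast+
      have eqB: "H' x = H x" if "x \<in> F" "x \<notin> Fs" "\<And>h. h < 2 ^ (w div 2) \<Longrightarrow> x \<notin> Fc h" for x
      proof -
        have nq: "x \<notin> {q..<q + 2 ^ (4 * w)}" using that(1) dis(2) by blast
        have "x \<notin> A" using that(2) nq scr0s scr0 unfolding A_def by fastforce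
        moreover have "x \<notin> Z h" if "h < 2 ^ (w div 2)" for h
          using \<open>\<And>h. h < 2 ^ (w div 2) \<Longrightarrow> x \<notin> Fc h\<close>[OF that] nq scrs[OF that]
          unfolding Z_def by auto
        then have "x \<notin> B" unfolding B_def using hkw by blast
        ultimately have "H' x = H2 x" using X by (intro 6(5)) blast+
        then show ?thesis using eqF[OF that(1)] by simp
      qed
      have iU: "Min (K \<union> S) = Min K" "Max (K \<union> S) = Max K" "inner (K \<union> S) = inner K \<union> S"
        by (rule inner_Un[OF k(2) K]; use mid in \<open>auto simp: S_def\<close>)+
      \<comment> \<open>A group whose cluster was nonempty has its index in the summary already, so
        the packed indices are all that is missing.\<close>
      have "high w ` inner (K \<union> S) = high w ` inner K \<union> (!) (news 0 N) ` {..<k}"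
      proof -
        define G where "G = hk ` {..<N}"
        have 1: "(!) (news 0 N) ` {..<k} = {h \<in> G. emp h}"
          unfolding G_def set_news[symmetric] k_def by (auto simp: set_conv_nth)
        have 2: "high w ` S = G" unfolding S hk_def G_def by (simp add: image_image)
        have 3: "h \<in> high w ` inner K" if "\<not> emp h" for h
          using that by (auto simp: emp_def Kc_def)
        show ?thesis unfolding iU image_Un 1 2 using 3 by blast
      qed
      then have "veb_at H1 (w div 2) (H (a + 2)) (high w ` inner (K \<union> S)) Fs"
        using a1 by simp
      then have vs': "veb_at H' (w div 2) (H (a + 2)) (high w ` inner (K \<union> S)) Fs"
      proof (rule veb_at_cong)
        fix x assume "x \<in> Fs"
        then have "x \<notin> X2" using X(3) dG(1) unfolding A_def by blast
        then show "H' x = H1 x" by (rule 6(3))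
      qed
      have low_eq: "low w ` {x \<in> inner (K \<union> S). high w x = h} = n_of h" for h
        unfolding iU n_of_def Kc_def by blast
      have vc': "veb_at H' u (cp h) (low w ` {x \<in> inner (K \<union> S). high w x = h}) (Fc h)"
        if h: "h < 2 ^ (w div 2)" for h
      proof (cases "h \<in> hk ` {..<N}")
        case True
        have "veb_at H2' u (cp h) (n_of h) (Fc h)" using a2 True unfolding u_def by blast
        then show ?thesis unfolding low_eq
        proof (rule veb_at_cong)
          fix x assume "x \<in> Fc h"
          then have "x \<notin> X1" using X(1) dA_Z[OF h] unfolding Z_def by blast
          then show "H' x = H2' x" by (rule 6(4))
        qed
      next
        case False
        \<comment> \<open>No key of the batch belongs to this cluster, and no call owns its
          cells.\<close>
        then have "n_of h = Kc h" unfolding n_of_def S hk_def by auto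
        moreover have "veb_at H' u (cp h) (Kc h) (Fc h)"
        proof (rule veb_at_cong[OF vc[OF h]])
          fix x assume x: "x \<in> Fc h"
          then have "x \<notin> X1" using X(1) dA_Z[OF h] unfolding Z_def by blast
          moreover have "x \<notin> Z h'" if "h' \<in> hk ` {..<N}" for h'
            using Z_disj[of h h'] h that hkw False x unfolding Z_def by blast
          then have "x \<notin> B" unfolding B_def by blast
          then have "x \<notin> X2" using X(3) by blast
          ultimately show "H' x = H2 x" by (rule 6(5))
        qed
        ultimately show ?thesis unfolding low_eq by simp
      qed
      have vf: "veb_at H' w a (K \<union> S) F"
      proof (rule veb_at_join[where H = H and Fs = Fs and Fc = Fc, OF w])
        show "veb_at H' (w div 2) (H (a + 2)) (high w ` inner (K \<union> S)) Fs" by (rule vs')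
        show "veb_at H' ((w + 1) div 2) (H (H (a + 3) + h))
           (low w ` {x \<in> inner (K \<union> S). high w x = h}) (Fc h)" if "h < 2 ^ (w div 2)" for h
          using vc'[OF that] by (simp add: u_def cp_def cls_def)
        show "veb_cells a (H (a + 3)) (2 ^ (w div 2)) Fs Fc F" by (rule F)
        show "K \<union> S \<subseteq> {..<2 ^ w}" using k(1) kw by (auto simp: S_def)
        have top: "H' x = H x" if "x \<in> {a..<a + 4} \<union> {cls..<cls + 2 ^ (w div 2)}" for x
          using that veb_cellsD(1,2,7,8)[OF F'] by (intro eqB) blast+
        show "H' a = min_word w (K \<union> S)" "H' (a + 1) = max_word w (K \<union> S)"
          using top[of a] top[of "a + 1"] k(3,4) K by (simp_all add: min_word_def max_word_def iU)
        show "H' x = H x" if "x \<in> {a + 2..<a + 4} \<union> {H (a + 3)..<H (a + 3) + 2 ^ (w div 2)}" for x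
          using that by (intro top) (auto simp: cls_def)
      qed
      have T: "T1 + T2 \<le> 10 + 700 * N + 1400 * N * lg w"
      proof -
        have "T1 \<le> work_bound (w div 2) k (high w ` inner K = {})" using a1 by simp
        moreover have "T2 + 100 \<le> 300 * N + (\<Sum>h\<in>hk ` {..<N}. work_bound u (gsize h) (emp h))"
          using a2 by simp
        ultimately show ?thesis
          using sum_work[OF k_def, of "high w ` inner K = {}", folded u_def] \<open>k \<le> N\<close> by linarith
      qed
      \<comment> \<open>The summary is no wider than a cluster, so the maximum of the two spans is
        bounded by that of a cluster and does not double.\<close>
      have "span_bound (w div 2) \<le> span_bound u" using uw by (simp add: span_bound_def)
      then have D: "max D1 D2 \<le> 200 + 100 * w + span_bound u"
        using a1 a2 by simp
      have XX: "X1 \<union> X2 \<subseteq> F \<union> {q..<q + 2 ^ (4 * w)}"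
        using X(1,3) As(1) ZG by blast
      have "F \<subseteq> RO" by (simp add: RO_def)
      then have RR: "R1 \<union> R2 \<subseteq> RO \<union> {q..<q + 2 ^ (4 * w)}"
        using X(2,4) As ZG RLs by blast
      have "a + 2 \<in> F" using veb_cellsD(7)[OF F'] by auto
      then have "a + 2 \<in> RO" by (simp add: RO_def)
      then have ar: "args_reads W f2 H2 [Var 0 [>>] Const 1, Load (Var 1 [+] Const 2),
           Var 4 [+] (Const 1 [<<] Var 0), Var 6, Var 4 [+] (Const 4 [<<] Var 0)] \<subseteq> RO"
        using f2 wds powers by (simp add: args_reads_def)
      show ?case
        using vf T D XX RR ar by (simp add: args_cost_def args_reads_def)
    qed simp_all
  qed
  have main: "wp W prog (Call 6 2 [Var 0, Var 5, Var 2, Var 4, Const 0, Var 3] ;;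
     Call 7 3 [Var 0, Var 5, Var 2, Var 4, Const 0, Var 3, Var 4 [+] (Const 1 [<<] Var 0)] ;;
     Fork 7 0 [Var 0 [>>] Const 1, Load (Var 1 [+] Const 2), Var 4 [+] (Const 1 [<<] Var 0),
               Var 6, Var 4 [+] (Const 4 [<<] Var 0)]
          7 4 [Var 0, Var 5, Var 2, Var 4, Const 0, Var 3, Var 3]) f1 H
    (\<lambda>f' H' T D R X. veb_at H' w a (K \<union> S) F \<and>
      R \<subseteq> F \<union> {lo..<lo + n} \<union> {q..<q + 2 ^ (4 * w)} \<and> X \<subseteq> F \<union> {q..<q + 2 ^ (4 * w)} \<and>
      T \<le> 90 + 1300 * N + 1400 * N * lg w \<and>
      D \<le> 730 + 300 * w + span_bound u)"
  proof -
    have c1: "wp W prog (prog ! 2) (entry_frame [w, cls, lo + 1, q, 0, N]) H (count_ok 0 N w)"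
      using count_spec[OF v, of 0 N w] Nn N2 by simp
    have sc: "{q..<q + 4 * 2 ^ w} \<subseteq> {q..<q + 2 ^ (4 * w)}" using sp by auto
    have ROs: "RO = F \<union> {lo..<lo + n}" by (auto simp: RO_def)
    show ?thesis
      unfolding wp_Seq
    proof (rule wp_Call[OF _ _ c1], goal_cases)
      case 2
      show ?case using f1 wds powers by (simp add: args_def)
    next
      case (3 g1 H1 T1 D1 R1 X1)
      note a1 = 3(1)[unfolded count_ok_def, folded k_def]
      have X1: "X1 \<subseteq> {q..<q + 3 * 2 ^ w}"
        using a1 count_cells_scratch[of 0 N] by auto
      then have X1s: "X1 \<subseteq> {q..<q + 4 * 2 ^ w}" by fastforce
      have eq1: "H1 x = H x" if "x \<in> RO" for x
        by (rule 3(2)) (use that X1s RO_scratch in blast)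
      have v1: "view H1" by (rule view_cong[OF v eq1])
      have c2: "wp W prog (prog ! 3) (entry_frame [w, cls, lo + 1, q, 0, N, q + 2 ^ w]) H1
          (pack_ok 0 N (q + 2 ^ w) w)"
        using pack_spec[OF v1, of 0 N w "q + 2 ^ w"] a1 Nn N2 by simp
      show ?case
      proof (rule wp_Call[OF _ _ c2], goal_cases)
        case 2
        show ?case using f1 wds powers by (simp add: args_def)
      next
        case (3 g2 H2 T2 D2 R2 X2)
        note a2 = 3(1)[unfolded pack_ok_def, folded k_def]
        have X2: "X2 \<subseteq> {q + 2 ^ w..<q + 2 * 2 ^ w}"
        proof -
          have "{q + 2 ^ w..<q + 2 ^ w + k} \<subseteq> {q + 2 ^ w..<q + 2 * 2 ^ w}"
            using \<open>k \<le> N\<close> N2 by auto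
          then show ?thesis using a2 by blast
        qed
        then have X2s: "X2 \<subseteq> {q..<q + 4 * 2 ^ w}" by fastforce
        have eq2: "H2 x = H x" if "x \<in> RO" for x
        proof -
          have "x \<notin> X2" using that X2s RO_scratch by blast
          then show ?thesis using 3(2) eq1[OF that] by simp
        qed
        have sl2: "H2 (slot (hk j)) = j" if "j < N" "start j" for j
        proof -
          have "slot (hk j) \<notin> X2"
            using X2 slot_bounds[OF hkw[OF that(1)]] by fastforce
          then show ?thesis using 3(2) a1 that by simp
        qed
        have R: "R1 \<subseteq> RO" "R2 \<subseteq> RO \<union> {q..<q + 4 * 2 ^ w}"
        proof -
          have "{q..<q + 2 ^ w} \<subseteq> {q..<q + 4 * 2 ^ w}" by auto
          then show "R1 \<subseteq> RO" "R2 \<subseteq> RO \<union> {q..<q + 4 * 2 ^ w}" using a1 a2 by blast+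
        qed
        have g1: "g1 0 = k" using a1 by simp
        show ?case
        proof (rule wp_conseq[OF fork], goal_cases)
          case (11 f' H' T D R X)
          have "R1 \<union> (R2 \<union> R) \<subseteq> F \<union> {lo..<lo + n} \<union> {q..<q + 2 ^ (4 * w)}"
            using 11(1) R sc unfolding ROs by blast
          moreover have "X1 \<union> (X2 \<union> X) \<subseteq> F \<union> {q..<q + 2 ^ (4 * w)}"
            using 11(1) X1s X2s sc by blast
          moreover have "T1 + T2 + T \<le> 50 + 1300 * N + 1400 * N * lg w"
            using 11(1) a1 a2 Nn(2) by linarith
          moreover have "D1 + D2 + D \<le> 630 + 300 * w + span_bound u"
            using 11(1) a1 a2 by linarith
          ultimately show ?case
            using 11(1) by (simp add: args_cost_def args_reads_def)
        qed (use f1 g1 eq2 sl2 a2 in simp_all)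
      qed simp
    qed simp
  qed
  show ?thesis
    unfolding distribute_def
    apply (rule wp_Assign_Seq[where v = "lo + 1", OF _ refl refl])
    subgoal by (simp add: f wds powers)
    apply (rule wp_Assign_Seq[where v = N, OF _ refl refl])
    subgoal by (simp add: f wds powers N_def[symmetric])
    apply (rule wp_Assign_Seq[where v = cls, OF _ refl refl])
    subgoal using wds by (simp add: f f(2)[unfolded One_nat_def] wds(5) powers cls_def[symmetric])
  proof (rule wp_conseq[OF main[unfolded f1_def]], goal_cases)
    case (1 f' H' T D R X)
    have "a + 3 \<in> F" using veb_cellsD(7)[OF F'] by auto
    then show ?case
      using 1(1) wds
      by (simp add: f f(2)[unfolded One_nat_def] u_def N_def[symmetric] S_def[symmetric, unfolded One_nat_def] powers)
  qed
qed

section \<open>Batch insertion\<close>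

lemma Min_Max_insert_ends:
  fixes x y z :: nat
  assumes "finite K" "x < z" "z < y"
  shows "Min (insert y (insert x K)) < z \<and> z < Max (insert y (insert x K))"
proof -
  have "Min (insert y (insert x K)) \<le> x" "y \<le> Max (insert y (insert x K))"
    by (rule Min_le Max_ge; use assms(1) in simp)+
  with assms(2,3) show ?thesis by linarith
qed

lemma batch_spec:
  "batch_pre W w a lo n q H K F \<kappa> \<Longrightarrow>
    wp W prog batch (entry_frame [w, a, lo, n, q]) H (batch_ok w a lo n q K F \<kappa>)"
proof (induction w arbitrary: a lo n q H K F \<kappa> rule: less_induct)
  case (less w)
  have vK: "veb_at H w a K F" and W: "4 * (w + 1) \<le> W" and FW: "F \<subseteq> {..<2 ^ W}"
    and lon: "lo + n < 2 ^ W" and qW: "q + 2 ^ (4 * w) \<le> 2 ^ W"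
    and key: "\<And>i. i < n \<Longrightarrow> H (lo + i) mod 2 ^ w = \<kappa> i"
    and smono: "\<And>i j. i < j \<Longrightarrow> j < n \<Longrightarrow> \<kappa> i < \<kappa> j"
    and dis: "F \<inter> {lo..<lo + n} = {}" "F \<inter> {q..<q + 2 ^ (4 * w)} = {}"
      "{lo..<lo + n} \<inter> {q..<q + 2 ^ (4 * w)} = {}"
    using less.prems by (auto simp: batch_pre_def)
  let ?f = "entry_frame [w, a, lo, n, q]"
  have wds: "lo < 2 ^ W" "n < 2 ^ W" "w < 2 ^ W" "a < 2 ^ W" "q < 2 ^ W" "0 < W"
     "(2::nat) ^ w < 2 ^ W" "Suc 0 < 2 ^ W" "2 < (2::nat) ^ W" "Suc (Suc 0) < 2 ^ W"
  proof -
    show "(2::nat) ^ w < 2 ^ W" "0 < W" "w < 2 ^ W" "Suc 0 < 2 ^ W" "2 < (2::nat) ^ W" "Suc (Suc 0) < 2 ^ W"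
      using W by (auto intro!: power_strict_increasing le_less_power)
    show "lo < 2 ^ W" "n < 2 ^ W" using lon by auto
    show "a < 2 ^ W" using veb_at_keys(5)[OF vK] FW by auto
    have "(0::nat) < 2 ^ (4 * w)" by simp
    with qW show "q < 2 ^ W" by linarith
  qed
  have kw: "\<kappa> i < 2 ^ w" if "i < n" for i
    using key[OF that] mod_less_divisor[of "2 ^ w" "H (lo + i)"] by simp
  have ld: "(H (lo + i) mod 2 ^ W) mod 2 ^ w = \<kappa> i" if "i < n" for i
  proof -
    have "(H (lo + i) mod 2 ^ W) mod 2 ^ w = H (lo + i) mod 2 ^ w"
      using W by (intro mod_mod_cancel le_imp_power_dvd) auto
    then show ?thesis using key[OF that] by simp
  qed
  have W4: "w + 4 \<le> W" using W by simp
  show ?case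
  proof (cases "n = 0")
    case True
    then show ?thesis using vK by (simp add: batch_def batch_ok_def work_bound_def span_bound_def)
  next
    case False
    then have n0: "0 < n" by simp
    define x where "x = \<kappa> 0"
    define y where "y = \<kappa> (n - 1)"
    have xy: "x < 2 ^ w" "y < 2 ^ w" using kw n0 by (simp_all add: x_def y_def)
    have xyW: "x < 2 ^ W" "y < 2 ^ W" using xy wds(7) by linarith+
    define K1 where "K1 = insert x K"
    define K2 where "K2 = insert y K1"
    define t1 where "t1 = (if card K \<le> 1 then 100 else 100 + 300 * lg w)"
    define t2 where "t2 = (if card K1 \<le> 1 then 100 else 100 + 300 * lg w)"
    have s1: "wp W prog (prog ! 1) (entry_frame [w, a, x]) H (ins_ok w a x K F t1)"
      using ins_spec[OF W4 vK xy(1) FW] by (simp add: t1_def)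
    have e: "eval W ?f H (Var 3) \<noteq> 0" using wds n0 by simp
    let ?post = "\<lambda>f' H' T D R X. veb_at H' w a (K \<union> \<kappa> ` {..<n}) F \<and>
      R \<subseteq> F \<union> {lo..<lo + n} \<union> {q..<q + 2 ^ (4 * w)} \<and> X \<subseteq> F \<union> {q..<q + 2 ^ (4 * w)} \<and>
      T \<le> (if n \<le> 2 then 5 else 115 + 1300 * (n - 2) + 1400 * (n - 2) * lg w) \<and>
      D \<le> (if n \<le> 2 then 5 else 755 + 300 * w + span_bound ((w + 1) div 2))"
    have rest: "wp W prog (If (Const 2 [<] Var 3) distribute Skip) f2 H2 ?post"
      if f2: "f2 0 = w" "f2 1 = a" "f2 2 = lo" "f2 3 = n" "f2 4 = q"
        and v2: "veb_at H2 w a K2 F" and eq: "\<And>i. i \<notin> F \<Longrightarrow> H2 i = H i" for f2 H2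
    proof (cases "n \<le> 2")
      case True
      have "\<kappa> ` {..<n} = {x, y}"
      proof -
        \<comment> \<open>For \<open>n = 1\<close> the two indices coincide.\<close>
        have "{..<n} = {0, n - 1}" using True n0 by auto
        then show ?thesis by (simp add: x_def y_def)
      qed
      then have "K2 = K \<union> \<kappa> ` {..<n}" by (auto simp: K2_def K1_def)
      then show ?thesis
        using True v2 by (simp add: f2 wds)
    next
      case False
      have fin: "finite K" by (rule veb_at_keys(2)[OF vK])
      have pre2: "batch_pre W w a lo n q H2 K2 F \<kappa>"
        unfolding batch_pre_def
      proof (intro conjI allI impI)
        show "H2 (lo + i) mod 2 ^ w = \<kappa> i" if "i < n" for i
        proof -
          have "lo + i \<in> {lo..<lo + n}" using that by simp
          then have "lo + i \<notin> F" using dis(1) by blast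
          then show ?thesis using key[OF that] eq by simp
        qed
      qed (use v2 W FW lon qW smono dis in auto)
      have un: "K2 \<union> \<kappa> ` {1..<n - 1} = K \<union> \<kappa> ` {..<n}"
      proof -
        have "{..<n} = insert 0 (insert (n - 1) {1..<n - 1})" using False by auto
        then show ?thesis by (simp add: K2_def K1_def x_def y_def insert_commute)
      qed
      have d: "wp W prog distribute f2 H2 (\<lambda>f' H' T D R X.
        veb_at H' w a (K2 \<union> \<kappa> ` {1..<n - 1}) F \<and>
        R \<subseteq> F \<union> {lo..<lo + n} \<union> {q..<q + 2 ^ (4 * w)} \<and> X \<subseteq> F \<union> {q..<q + 2 ^ (4 * w)} \<and>
        T \<le> 110 + 1300 * (n - 2) + 1400 * (n - 2) * lg w \<and>
        D \<le> 750 + 300 * w + span_bound ((w + 1) div 2))"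
      proof (rule distribute_spec[OF pre2])
        show "Min K2 < \<kappa> i \<and> \<kappa> i < Max K2" if "0 < i" "i < n - 1" for i
          unfolding K2_def K1_def
          by (rule Min_Max_insert_ends[OF fin]) (use smono that in \<open>auto simp: x_def y_def\<close>)
      qed (use False f2 less.IH in \<open>auto simp: K2_def\<close>)
      have e2: "eval W f2 H2 (Const 2 [<] Var 3) \<noteq> 0"
        using False f2 wds by simp
      show ?thesis
        unfolding wp_If if_P[OF e2]
        by (rule wp_conseq[OF d[unfolded un]]) (use False in auto)
    qed
    have main: "wp W prog (Call 6 1 [Var 0, Var 1, Load (Var 2) [%] (Const 1 [<<] Var 0)] ;;
      Call 6 1 [Var 0, Var 1, Load (Var 2 [+] (Var 3 [-] Const 1)) [%] (Const 1 [<<] Var 0)] ;;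
      If (Const 2 [<] Var 3) distribute Skip) ?f H
     (\<lambda>f' H' T D R X. veb_at H' w a (K \<union> \<kappa> ` {..<n}) F \<and>
      R \<subseteq> F \<union> {lo..<lo + n} \<union> {q..<q + 2 ^ (4 * w)} \<and> X \<subseteq> F \<union> {q..<q + 2 ^ (4 * w)} \<and>
      T \<le> t1 + t2 + (if n \<le> 2 then 45 else 155 + 1300 * (n - 2) + 1400 * (n - 2) * lg w) \<and>
      D \<le> t1 + t2 + (if n \<le> 2 then 45 else 795 + 300 * w + span_bound ((w + 1) div 2)))"
      unfolding wp_Seq
    proof (rule wp_Call[OF _ _ s1], goal_cases)
      case 2
      show ?case using wds ld[of 0] n0 xyW by (simp add: args_def x_def)
    next
      case (3 g1 H1 T1 D1 R1 X1)
      note a1 = 3(1)[unfolded ins_ok_def, folded K1_def]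
      have s2: "wp W prog (prog ! 1) (entry_frame [w, a, y]) H1 (ins_ok w a y K1 F t2)"
        using ins_spec[OF W4 _ xy(2) FW, of H1 a K1] a1 by (simp add: t2_def)
      have eq1: "H1 i = H i" if "i \<notin> F" for i
        by (rule 3(2)) (use a1 that in blast)
      have ad: "lo + (n - Suc 0) < 2 ^ W" "lo + (n - Suc 0) \<in> {lo..<lo + n}"
        using lon n0 by auto
      then have "H1 (lo + (n - 1)) = H (lo + (n - 1))"
        using dis(1) by (intro eq1) auto
      then have ldy: "(H1 (lo + (n - Suc 0)) mod 2 ^ W) mod 2 ^ w = y"
        using ld[of "n - 1"] n0 by (simp add: y_def)
      show ?case
      proof (rule wp_Call[OF _ _ s2], goal_cases)
        case 2
        show ?case using wds ldy ad xyW by (simp add: args_def)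
      next
        case (3 g2 H2 T2 D2 R2 X2)
        note a2 = 3(1)[unfolded ins_ok_def, folded K2_def]
        have eq2: "H2 i = H i" if "i \<notin> F" for i
        proof -
          have "i \<notin> X2" using a2 that by blast
          then show ?thesis using 3(2) eq1[OF that] by simp
        qed
        have lo_in: "lo \<in> {lo..<lo + n}" using n0 by simp
        show ?case
        proof (rule wp_conseq[OF rest], goal_cases)
          case (8 f' H' T D R X)
          show ?case
            using 8(1) a1 a2 \<open>D1 \<le> T1\<close> \<open>D2 \<le> T2\<close> wds ad lo_in
            by (auto simp: args_cost_def args_reads_def)
        qed (use a2 eq2 in simp_all)
      qed simp
    qed simp
    have t12: "t1 \<le> 100 + 300 * lg w" "t2 \<le> 100 + 300 * lg w"
      by (simp_all add: t1_def t2_def)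
    \<comment> \<open>The second insertion still meets a tree with only one key. This is the source
      of the saving that \<open>work_bound\<close> grants to empty trees.\<close>
    have t12e: "t1 = 100" "t2 = 100" if "K = {}"
      using that by (simp_all add: t1_def t2_def K1_def)
    show ?thesis
      unfolding batch_def wp_If if_P[OF e]
    proof (rule wp_conseq[OF main], goal_cases)
      case (1 f' H' T D R X)
      have T: "2 + T \<le> work_bound w n (K = {})"
      proof (cases "n \<le> 2")
        case True
        have "1 * (lg w + 1) \<le> n * (lg w + 1)" using n0 by (intro mult_le_mono1) simp
        then have "lg w + 1 \<le> n * (lg w + 1)" by simp
        then show ?thesis
          using True 1(1) t12 t12e n0 by (auto simp: work_bound_def)
      next
        case False
        define m where "m = n - 2"
        have "n = m + 2" using False by (simp add: m_def)
        then show ?thesis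
          using False 1(1) t12 t12e unfolding m_def[symmetric]
          by (auto simp: work_bound_def algebra_simps)
      qed
      have D: "2 + D \<le> span_bound w"
      proof (cases "n \<le> 2")
        case True
        then show ?thesis using 1(1) t12 lg_le[of w] by (simp add: span_bound_def)
      next
        case False
        \<comment> \<open>Three distinct keys exist. From \<open>w \<ge> 2\<close> follows
          \<open>6000 * ((w + 1) div 2) + 900 * w + 1297 \<le> 6000 * w + 300\<close>, which closes
          the span recurrence.\<close>
        have "2 \<le> w"
        proof (rule ccontr)
          assume "\<not> 2 \<le> w"
          then have "(2::nat) ^ w \<le> 2 ^ 1" by (intro power_increasing) auto
          then have "\<kappa> 2 < 2" using kw[of 2] False by simp
          with smono[of 0 1] smono[of 1 2] False show False by simp
        qed
        moreover have "2 * ((w + 1) div 2) \<le> w + 1" by (rule times_div_less_eq_dividend)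
        moreover have "D \<le> t1 + t2 + (795 + 300 * w + span_bound ((w + 1) div 2))"
          using 1(1) False by simp
        ultimately show ?thesis
          unfolding span_bound_def using t12 lg_le[of w] by linarith
      qed
      show ?case
        using 1(1) T D by (simp add: batch_ok_def)
    qed
  qed
qed

section \<open>Passage to real logarithms and the final bounds\<close>

lemma lg_le_log: "real (lg w) + 1 \<le> 3 * max 1 (log 2 (real w))"
proof (cases "w \<le> 1")
  case True
  then show ?thesis by (simp add: lg.simps[of w])
next
  case False
  then have "(2::nat) ^ lg w \<le> 2 * w" using two_power_lg[of w] by simp
  then have "real (2 ^ lg w) \<le> real (2 * w)"
    by (rule of_nat_mono)
  then have "(2::real) ^ lg w \<le> 2 * real w"
    by simp
  then have "log 2 (2 ^ lg w) \<le> log 2 (2 * real w)"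
    using False by (intro log_mono) auto
  also have "\<dots> = 1 + log 2 (real w)"
    using False by (simp add: log_mult)
  finally show ?thesis by simp
qed

text \<open>The estimate gives \<open>1400 * 3\<close>; the larger 6300 is \<open>6000 + 300\<close>
  from the span bound, so that one constant serves both.\<close>

lemma work_bound_le:
  "real (work_bound w m e) \<le> 6300 * real (max 1 m) * max 1 (log 2 (real w))"
proof -
  have "work_bound w m e \<le> 1400 * (max 1 m * (lg w + 1))"
    by (cases m) (auto simp: work_bound_def max_def algebra_simps)
  then have "real (work_bound w m e) \<le> real (1400 * (max 1 m * (lg w + 1)))"
    by (rule of_nat_mono)
  also have "\<dots> = 1400 * (real (max 1 m) * (real (lg w) + 1))"
    by (simp only: of_nat_mult of_nat_add of_nat_1 of_nat_numeral)
  also have "\<dots> \<le> 1400 * (real (max 1 m) * (3 * max 1 (log 2 (real w))))"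
    by (intro mult_left_mono lg_le_log) auto
  also have "\<dots> \<le> 6300 * real (max 1 m) * max 1 (log 2 (real w))"
    by simp
  finally show ?thesis .
qed

lemma span_bound_le: "real (span_bound w) \<le> 6300 * max 1 (real w)"
  by (auto simp: span_bound_def max_def)

theorem theorem5p1:
  shows "\<exists>(P :: program) (c :: nat) (C :: real).
    \<forall>(w :: nat) (U :: nat) (W :: nat) (H :: memory) (a :: nat) (K :: nat set) (F :: nat set)
      (b :: nat) (B :: nat set) (m :: nat) (s :: nat).
      U = 2 ^ w \<and> W \<ge> c * (w + 1) \<and>
      veb_at H w a K F \<and>
      B \<subseteq> {..<U} \<and> card B = m \<and> sorted_array_at H b B \<and>
      F \<inter> {b..<b + m} = {} \<and> F \<union> {b..<b + m} \<subseteq> {..<s} \<and> s \<le> 2 ^ (W - 1) \<longrightarrow>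
      (\<exists>H' T D.
        runs W P [w, a, b, m, s] H H' T D \<and>
        veb_at H' w a (K \<union> B) F \<and>
        real T \<le> C * real (max 1 m) * max 1 (log 2 (log 2 (real U))) \<and>
        real D \<le> C * max 1 (log 2 (real U)))"
proof (rule exI[of _ prog], rule exI[of _ 4], rule exI[of _ 6300], intro allI impI, elim conjE)
  fix w U W :: nat and H :: memory and a :: nat and K F :: "nat set" and b :: nat
    and B :: "nat set" and m s :: nat
  assume U: "U = 2 ^ w" and W: "4 * (w + 1) \<le> W" and v: "veb_at H w a K F"
    and B: "B \<subseteq> {..<U}" "card B = m" "sorted_array_at H b B"
    and d: "F \<inter> {b..<b + m} = {}" "F \<union> {b..<b + m} \<subseteq> {..<s}" and s: "s \<le> 2 ^ (W - 1)"
  have fin: "finite B" using finite_subset[OF B(1)] by simp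
  have "wp W prog batch (entry_frame [w, a, b, m, s]) H
    (\<lambda>f' H' T D R X. veb_at H' w a (K \<union> B) F \<and> T \<le> work_bound w m (K = {}) \<and> D \<le> span_bound w)"
  \<comment> \<open>For an empty batch nothing bounds \<open>b\<close>, and \<open>batch_pre\<close>
    could fail; but then the procedure returns at once.\<close>
  proof (cases "m = 0")
    case True
    with fin B(2) have "B = {}" by simp
    with True v show ?thesis by (simp add: batch_def work_bound_def span_bound_def)
  next
    case False
    define l where "l = sorted_list_of_set B"
    have l: "length l = m" "set l = B" "sorted_wrt (<) l"
      using fin B(2) by (simp_all add: l_def)
    have img: "(!) l ` {..<m} = B" using l by (auto simp: set_conv_nth)
    have "b + (m - 1) \<in> {b..<b + m}" using False by simp
    then have "b + (m - 1) < s" using d(2) by blast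
    then have bs: "b + m \<le> s" using False by simp
    \<comment> \<open>The upper half of the address space lies at or above \<open>s\<close>, and
      \<open>W \<ge> 4 * (w + 1)\<close> makes it large enough for the outermost scratch area, which
      starts at \<open>s\<close>.\<close>
    have pW: "(2::nat) ^ W = 2 ^ (W - 1) + 2 ^ (W - 1)" using W by (cases W) auto
    have p: "(2::nat) ^ (4 * w) \<le> 2 ^ (W - 1)" "(0::nat) < 2 ^ (W - 1)"
      using W by (auto intro!: power_increasing)
    have "batch_pre W w a b m s H K F ((!) l)"
      unfolding batch_pre_def
    proof (intro conjI allI impI)
      show "F \<subseteq> {..<2 ^ W}" using d(2) s pW by force
      show "b + m < 2 ^ W" "s + 2 ^ (4 * w) \<le> 2 ^ W" using bs s pW p by linarith+
      show "H (b + i) mod 2 ^ w = l ! i" if "i < m" for i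
      proof -
        have "l ! i < 2 ^ w" using that l B(1) U nth_mem[of i l] by auto
        moreover have "H (b + i) = l ! i" using that B(2,3) by (simp add: sorted_array_at_def l_def)
        ultimately show ?thesis by simp
      qed
      show "l ! i < l ! j" if "i < j \<and> j < m" for i j
        using that l sorted_wrt_nth_less[OF l(3), of i j] by simp
      show "F \<inter> {s..<s + 2 ^ (4 * w)} = {}" "{b..<b + m} \<inter> {s..<s + 2 ^ (4 * w)} = {}"
        using d(2) by fastforce+
    qed (use v W d in auto)
    from batch_spec[OF this] show ?thesis
      by (rule wp_conseq) (simp add: batch_ok_def img)
  qed
  then obtain f' H' T D R X where
    e: "exec W prog batch (entry_frame [w, a, b, m, s]) H f' H' T D R X" and
    r: "veb_at H' w a (K \<union> B) F" "T \<le> work_bound w m (K = {})" "D \<le> span_bound w"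
    unfolding wp_def by blast
  have U': "log 2 (real U) = real w" by (simp add: U)
  have "runs W prog [w, a, b, m, s] H H' T D"
    using e unfolding runs_def by (auto simp: prog_def)
  moreover have "real T \<le> 6300 * real (max 1 m) * max 1 (log 2 (log 2 (real U)))"
    unfolding U' using work_bound_le[of w m "K = {}"] r(2) by linarith
  moreover have "real D \<le> 6300 * max 1 (log 2 (real U))"
    unfolding U' using span_bound_le[of w] r(3) by linarith
  ultimately show "\<exists>H' T D. runs W prog [w, a, b, m, s] H H' T D \<and> veb_at H' w a (K \<union> B) F \<and>
        real T \<le> 6300 * real (max 1 m) * max 1 (log 2 (log 2 (real U))) \<and>
        real D \<le> 6300 * max 1 (log 2 (real U))"
    using r(1) by blast
qed

end
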